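(* Let $A^{\mathrm{SR}}$ be generated from the semirandom Stochastic Block Model (an arbitrary monotone adversary applied to the binary symmetric Stochastic Block Model with parameters $p,q$). (i) For any constants $c_0,c_1\in(0,1)$ there exist constants $C_I,C_e,C_e'>0$ such that, if $0<c_0p\le q<p\le1-c_1$ and $nI^*\ge C_I$, then with probability at least $1-10\exp(-\sqrt{\log n})$ every $\widehat Y\in\mathcal{Y}(A^{\mathrm{SR}})$ satisfies $$\frac1n\|\widehat Y-Y^*\|_1\le\left\lfloor n\exp\left[-\Big(1-C_e\sqrt{\tfrac1{nI^*}}\Big)\tfrac n2I^*\right]\right\rfloor,\qquad \mathrm{err}(\widehat\sigma^{\mathrm{sdp}},\sigma^* )\le\exp\left[-\Big(1-C_e'\sqrt{\tfrac1{nI^*}}\Big)\tfrac n2I^*\right].$$ (ii) For any constants $c_0,c_1\in(0,1)$, if $0<c_0p\le q<p\le1-c_1$ and $nI^*\to\infty$ as $n\to\infty$, then with probability $1-o(1)$ every $\widehat Y\in\mathcal{Y}(A^{\mathrm{SR}})$ satisfies $$\frac1n\|\widehat Y-Y^*\|_1\le\left\lfloor n\exp\left[-(1-o(1))\tfrac n2I^*\right]\right\rfloor,\qquad \mathrm{err}(\widehat\sigma^{\mathrm{sdp}},\sigma^* )\le\exp\left[-(1-o(1))\tfrac n2I^*\right].$$ Here $\widehat\sigma^{\mathrm{sdp}}\in\{\pm1\}^n$ is the vector of entrywise signs of a top eigenvector of $\widehat Y$.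
   Context: Binary symmetric Stochastic Block Model: $\sigma^*\in\{\pm1\}^n$ is a deterministic ground-truth vector with $\sum_i\sigma_i^*=0$; $Y^*=\sigma^*(\sigma^* )^\top$; $A\in\{0,1\}^{n\times n}$ is symmetric with independent entries $\{A_{ij}:i\le j\}$, $A_{ij}\sim\mathrm{Ber}(p)$ if $\sigma_i^*\sigma_j^*=1$ and $A_{ij}\sim\mathrm{Ber}(q)$ if $\sigma_i^*\sigma_j^*=-1$, where $0<q<p<1$ may depend on $n$. Semirandom Stochastic Block Model: a monotone adversary observes $A$ and $\sigma^*$, picks an arbitrary set $\mathcal{L}\subset\{(i,j)\in[n]\times[n]:i<j\}$ (allowed to depend on the realization of $A$), and outputs a symmetric matrix $A^{\mathrm{SR}}\in\{0,1\}^{n\times n}$ such that for each $i<j$: $A^{\mathrm{SR}}_{ij}=1$ if $(i,j)\in\mathcal{L}$ and $\sigma_i^*\sigma_j^*=1$; $A^{\mathrm{SR}}_{ij}=0$ if $(i,j)\in\mathcal{L}$ and $\sigma_i^*\sigma_j^*=-1$; $A^{\mathrm{SR}}_{ij}=A_{ij}$ if $(i,j)\notin\mathcal{L}$. (Diagonal entries are irrelevant because of the SDP diagonal constraint.) $I^*=-2\log[\sqrt{pq}+\sqrt{(1-p)(1-q)}]$. For a symmetric matrix $B$, $\mathcal{Y}(B)$ is the set of $Y\in\mathbb{R}^{n\times n}$ with $Y\succeq0$, $Y_{ii}=1$ for all $i$, $\sum_{i,j}Y_{ij}=0$, and $\langle B,Y\rangle\ge\langle B,Y^*\rangle$, where $\langle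 B,Y\rangle=\sum_{i,j}B_{ij}Y_{ij}$. $\|M\|_1=\sum_{i,j}|M_{ij}|$. $\mathrm{err}(\sigma,\sigma')=\min_{g\in\{\pm1\}}\frac1n\sum_{i=1}^n\mathbf{1}\{g\sigma_i\ne\sigma'_i\}$. The sign of $0$ is taken to be $1$. The $o(1)$ terms are deterministic sequences tending to $0$ as $n\to\infty$. *)

theory Defs
  imports "HOL-Probability.Product_PMF" "Jordan_Normal_Form.Char_Poly"
begin

unbundle no vec_syntax
hide_const (open) Finite_Cartesian_Product.mat Finite_Cartesian_Product.vec
hide_type (open) Finite_Cartesian_Product.vec

text \<open>The dimension \<open>n\<close> varies inside the statement, so vectors and matrices are those of
  \<^theory>\<open>Jordan_Normal_Form.Matrix\<close>, with indices \<open>0, \<dots>, n - 1\<close>.\<close>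

definition sign_vector :: "nat \<Rightarrow> real vec \<Rightarrow> bool" where
  "sign_vector n \<sigma> \<longleftrightarrow> \<sigma> \<in> carrier_vec n \<and> (\<forall>i<n. \<sigma> $ i \<in> {-1, 1})"

definition balanced_labels :: "nat \<Rightarrow> real vec \<Rightarrow> bool" where
  "balanced_labels n \<sigma> \<longleftrightarrow> sign_vector n \<sigma> \<and> (\<Sum>i<n. \<sigma> $ i) = 0"

definition outer_square :: "real vec \<Rightarrow> real mat" where
  "outer_square \<sigma> = mat (dim_vec \<sigma>) (dim_vec \<sigma>) (\<lambda>(i, j). \<sigma> $ i * \<sigma> $ j)"

definition symmetric_mat :: "nat \<Rightarrow> real mat \<Rightarrow> bool" where
  "symmetric_mat n B \<longleftrightarrow> B \<in> carrier_mat n n \<and> transpose_mat B = B"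

definition symmetric_binary_mats :: "nat \<Rightarrow> real mat set" where
  "symmetric_binary_mats n =
     {B. symmetric_mat n B \<and> (\<forall>i<n. \<forall>j<n. B $$ (i, j) \<in> {0, 1})}"

text \<open>Law of the random symmetric matrix \<open>A\<close>: the entries with \<open>i \<le> j\<close> are independent
  Bernoulli variables; the other entries are their mirror images.\<close>

definition sbm_pmf :: "nat \<Rightarrow> real vec \<Rightarrow> real \<Rightarrow> real \<Rightarrow> real mat pmf" where
  "sbm_pmf n \<sigma> p q =
     map_pmf (\<lambda>a. mat n n (\<lambda>(i, j). of_bool (a (min i j, max i j))))
       (Pi_pmf {(i, j). i \<le> j \<and> j < n} False
         (\<lambda>(i, j). bernoulli_pmf (if \<sigma> $ i * \<sigma> $ j = 1 then p else q)))"

text \<open>\<open>B\<close> is a possible output of the adversary on the realization \<open>A\<close> when it picks the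
  set \<open>L\<close>. The diagonal of \<open>B\<close> is an arbitrary 0/1 vector.\<close>

definition adversary_output ::
  "nat \<Rightarrow> real vec \<Rightarrow> real mat \<Rightarrow> (nat \<times> nat) set \<Rightarrow> real mat \<Rightarrow> bool" where
  "adversary_output n \<sigma> A L B \<longleftrightarrow>
     B \<in> symmetric_binary_mats n \<and>
     (\<forall>i j. i < j \<and> j < n \<longrightarrow>
        ((i, j) \<in> L \<and> \<sigma> $ i * \<sigma> $ j = 1 \<longrightarrow> B $$ (i, j) = 1) \<and>
        ((i, j) \<in> L \<and> \<sigma> $ i * \<sigma> $ j = -1 \<longrightarrow> B $$ (i, j) = 0) \<and>
        ((i, j) \<notin> L \<longrightarrow> B $$ (i, j) = A $$ (i, j)))"

text \<open>A strategy sends every realization \<open>A\<close> to the matrix returned by the adversary; the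
  chosen set \<open>L A\<close> may depend on \<open>A\<close> in an arbitrary way.\<close>

definition monotone_adversary :: "nat \<Rightarrow> real vec \<Rightarrow> (real mat \<Rightarrow> real mat) \<Rightarrow> bool" where
  "monotone_adversary n \<sigma> adv \<longleftrightarrow>
     (\<exists>L. \<forall>A \<in> symmetric_binary_mats n.
        L A \<subseteq> {(i, j). i < j \<and> j < n} \<and> adversary_output n \<sigma> A (L A) (adv A))"

definition semirandom_sbm_pmf ::
  "nat \<Rightarrow> real vec \<Rightarrow> real \<Rightarrow> real \<Rightarrow> (real mat \<Rightarrow> real mat) \<Rightarrow> real mat pmf" where
  "semirandom_sbm_pmf n \<sigma> p q adv = map_pmf adv (sbm_pmf n \<sigma> p q)"

definition sbm_snr :: "real \<Rightarrow> real \<Rightarrow> real" where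
  "sbm_snr p q = - 2 * ln (sqrt (p * q) + sqrt ((1 - p) * (1 - q)))"

definition mat_inner :: "real mat \<Rightarrow> real mat \<Rightarrow> real" where
  "mat_inner B Y = (\<Sum>i<dim_row B. \<Sum>j<dim_col B. B $$ (i, j) * Y $$ (i, j))"

definition mat_norm1 :: "real mat \<Rightarrow> real" where
  "mat_norm1 M = (\<Sum>i<dim_row M. \<Sum>j<dim_col M. \<bar>M $$ (i, j)\<bar>)"

definition psd_mat :: "nat \<Rightarrow> real mat \<Rightarrow> bool" where
  "psd_mat n Y \<longleftrightarrow>
     symmetric_mat n Y \<and> (\<forall>x \<in> carrier_vec n. scalar_prod x (Y *\<^sub>v x) \<ge> 0)"

definition sdp_set :: "nat \<Rightarrow> real vec \<Rightarrow> real mat \<Rightarrow> real mat set" where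
  "sdp_set n \<sigma> B =
     {Y. psd_mat n Y \<and> (\<forall>i<n. Y $$ (i, i) = 1) \<and> (\<Sum>i<n. \<Sum>j<n. Y $$ (i, j)) = 0 \<and>
         mat_inner B Y \<ge> mat_inner B (outer_square \<sigma>)}"

definition top_eigenvector :: "real mat \<Rightarrow> real vec \<Rightarrow> bool" where
  "top_eigenvector Y v \<longleftrightarrow> (\<exists>k. eigenvector Y v k \<and> (\<forall>k'. eigenvalue Y k' \<longrightarrow> k' \<le> k))"

text \<open>Not \<^const>\<open>sgn\<close>: the sign of 0 is 1.\<close>

definition entrywise_sign :: "real vec \<Rightarrow> real vec" where
  "entrywise_sign v = map_vec (\<lambda>x. if x \<ge> 0 then 1 else -1) v"

definition label_err :: "nat \<Rightarrow> real vec \<Rightarrow> real vec \<Rightarrow> real" where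
  "label_err n \<sigma> \<sigma>' =
     Min ((\<lambda>g. 1 / real n * (\<Sum>i<n. of_bool (g * \<sigma> $ i \<noteq> \<sigma>' $ i))) ` {-1, 1 :: real})"

end

theory Submission
  imports Defs "HOL-Real_Asymp.Real_Asymp"
begin

text \<open>Let \<open>R\<close> be a feasible matrix conjugated by the labels, \<open>x\<^sub>1, \<dots>, x\<^sub>n\<close> its centred Gram vectors and
  \<open>b\<^sub>i = |x\<^sub>i|\<^sup>2\<close>. Then \<open>b\<^sub>i \<le> 4\<close>, the sum of the \<open>b\<^sub>i\<close> equals the normalized error \<open>S\<close>, and monotone
  changes of the graph only help, so optimality gives
  \<open>\<Sum> d\<^sub>i b\<^sub>i \<le> \<Sum> (A - E A)\<^sub>i\<^sub>j \<sigma>\<^sub>i \<sigma>\<^sub>j \<langle>x\<^sub>i, x\<^sub>j\<rangle>\<close>, where \<open>d\<^sub>i = \<Sum>\<^sub>j A\<^sub>i\<^sub>j \<sigma>\<^sub>i \<sigma>\<^sub>j\<close>. The right-hand side is at most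
  \<open>C sqrt (n p) S\<close> once the vertices of degree above \<open>C n p\<close> are removed (Feige-Ofek: light pairs by a
  union bound over integer points, heavy pairs by discrepancy). These vertices are so few that they
  contribute \<open>O(S)\<close>. The left-hand side is governed by the average of the \<open>m\<close> smallest \<open>d\<^sub>i\<close>, and a
  Chernoff and union bound, of exponent \<open>m (ln (n / m) - n I / 2 + O(sqrt (n I)))\<close>, shows that this
  average exceeds \<open>C sqrt (n p)\<close> as soon as \<open>m\<close> is about \<open>n exp (- n I / 2 + C sqrt (n I))\<close>. Hence \<open>S\<close> is
  at most of that order, and it vanishes if this number is less than 1.

  The bound on the labels follows by perturbation of the top eigenvector.\<close>

section \<open>Exponential moments\<close>

text \<open>The signal strength n I is only assumed to exceed a constant, so n p may be bounded as
  well. Then some degrees can be far above n p, the norm of A - E A need not be O(sqrt (n p)), and a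
  union bound over single vertices is hopeless; hence the truncation by degree and the bounds for
  whole m-sets. A may be replaced by A - E A since E A is a combination of the all-ones matrix and
  the outer square of the labels. After conjugation these see the vectors x_i only through the sum
  of \<sigma>_i x_i, zero because the entries of Y sum to zero, and the sum of x_i, zero by
  centring. The threshold C sqrt (n p) for averaged signed degrees is cheap: the optimal Chernoff
  tilt is O((p - q) / p), so the exponent changes by O((p - q) sqrt (n / p)) = O(sqrt (n I)),
  because I \<ge> (p - q)^2 / (4 p). Relative to n I this is the term C_e sqrt (1 / (n I)). The good
  event concerns A alone and the rest is deterministic, so no union bound over adversaries is
  required.\<close>

definition upper_pairs :: "nat \<Rightarrow> (nat \<times> nat) set" where
  "upper_pairs n = {(i, j). i \<le> j \<and> j < n}"

definition sym_entry :: "(nat \<times> nat \<Rightarrow> bool) \<Rightarrow> nat \<Rightarrow> nat \<Rightarrow> real" where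
  "sym_entry a i j = of_bool (a (min i j, max i j))"

definition edge_pmf :: "nat \<Rightarrow> (nat \<Rightarrow> nat \<Rightarrow> real) \<Rightarrow> (nat \<times> nat \<Rightarrow> bool) pmf" where
  "edge_pmf n P = Pi_pmf (upper_pairs n) False (\<lambda>(i, j). bernoulli_pmf (P i j))"

abbreviation edge_prob :: "nat \<Rightarrow> (nat \<Rightarrow> nat \<Rightarrow> real) \<Rightarrow> (nat \<times> nat \<Rightarrow> bool) set \<Rightarrow> real" where
  "edge_prob n P \<equiv> measure_pmf.prob (edge_pmf n P)"

text \<open>Only the entries with i \<le> j are independent. A sum over ordered pairs is therefore
  folded: the weights of both orientations act on one Bernoulli variable, and the diagonal counts
  once.\<close>

definition fold_weight :: "(nat \<Rightarrow> nat \<Rightarrow> real) \<Rightarrow> nat \<times> nat \<Rightarrow> real" where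
  "fold_weight w = (\<lambda>(i, j). if i = j then w i j else w i j + w j i)"

lemma finite_upper_pairs [simp]: "finite (upper_pairs n)"
proof -
  have "upper_pairs n \<subseteq> {..<n} \<times> {..<n}" by (auto simp: upper_pairs_def)
  then show ?thesis by (rule finite_subset) simp
qed

lemma sum_fold_weight: "(\<Sum>e\<in>upper_pairs n. fold_weight w e) = (\<Sum>i<n. \<Sum>j<n. w i j)"
proof (induction n)
  case 0
  then show ?case by (simp add: upper_pairs_def)
next
  case (Suc n)
  have eq: "upper_pairs (Suc n) = upper_pairs n \<union> (\<lambda>i. (i, n)) ` {..n}"
    by (auto simp: upper_pairs_def)
  have "(\<Sum>e\<in>upper_pairs (Suc n). fold_weight w e)
      = (\<Sum>e\<in>upper_pairs n. fold_weight w e) + (\<Sum>e\<in>(\<lambda>i. (i, n)) ` {..n}. fold_weight w e)"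
    unfolding eq by (intro sum.union_disjoint finite_upper_pairs) (auto simp: upper_pairs_def)
  also have "(\<Sum>e\<in>(\<lambda>i. (i, n)) ` {..n}. fold_weight w e) = (\<Sum>i\<le>n. fold_weight w (i, n))"
    by (subst sum.reindex) (auto simp: inj_on_def)
  also have "\<dots> = (\<Sum>i<n. w i n + w n i) + w n n"
    unfolding lessThan_Suc_atMost[symmetric] by (simp add: fold_weight_def)
  finally show ?case
    by (simp add: Suc.IH sum.distrib)
qed

text \<open>Markov's inequality for the exponential. The product of moments is left unestimated
  because its applications bound a single factor in different ways.\<close>

lemma edge_pmf_chernoff:
  assumes P: "\<And>i j. P i j \<in> {0..1}"
  shows "edge_prob n P {a. t \<le> (\<Sum>i<n. \<Sum>j<n. w i j * sym_entry a i j)}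
     \<le> exp (- t) * (\<Prod>e\<in>upper_pairs n. 1 - case_prod P e + case_prod P e * exp (fold_weight w e))"
proof -
  let ?M = "edge_pmf n P"
  let ?f = "\<lambda>e x. exp (fold_weight w e * of_bool x) :: real"
  have fin: "finite (set_pmf ?M)"
    unfolding edge_pmf_def by (intro finite_subset[OF set_Pi_pmf_subset'[OF finite_upper_pairs]] finite_PiE_dflt) auto
  have S: "(\<Sum>i<n. \<Sum>j<n. w i j * sym_entry a i j) = (\<Sum>e\<in>upper_pairs n. fold_weight w e * of_bool (a e))" for a
  proof -
    have "(\<Sum>e\<in>upper_pairs n. fold_weight w e * of_bool (a e))
        = (\<Sum>e\<in>upper_pairs n. fold_weight (\<lambda>i j. w i j * sym_entry a i j) e)"
      by (intro sum.cong) (auto simp: upper_pairs_def fold_weight_def sym_entry_def)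
    then show ?thesis by (simp add: sum_fold_weight)
  qed
  have ex: "exp (\<Sum>i<n. \<Sum>j<n. w i j * sym_entry a i j) = (\<Prod>e\<in>upper_pairs n. ?f e (a e))" for a
    unfolding S by (rule exp_sum) simp
  have "measure_pmf.prob ?M {a. t \<le> (\<Sum>i<n. \<Sum>j<n. w i j * sym_entry a i j)}
      = measure_pmf.prob ?M {a \<in> space ?M. exp t \<le> (\<Prod>e\<in>upper_pairs n. ?f e (a e))}"
    by (simp add: ex[symmetric])
  also have "\<dots> \<le> measure_pmf.expectation ?M (\<lambda>a. \<Prod>e\<in>upper_pairs n. ?f e (a e)) / exp t"
    by (intro integral_Markov_inequality_measure[where A="{}"] integrable_measure_pmf_finite fin)
       (auto simp: prod_nonneg)
  also have "measure_pmf.expectation ?M (\<lambda>a. \<Prod>e\<in>upper_pairs n. ?f e (a e))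
      = (\<Prod>e\<in>upper_pairs n. measure_pmf.expectation (case_prod (\<lambda>i j. bernoulli_pmf (P i j)) e) (?f e))"
    unfolding edge_pmf_def
    by (intro expectation_prod_Pi_pmf) (auto intro!: integrable_measure_pmf_finite)
  also have "\<dots> = (\<Prod>e\<in>upper_pairs n. 1 - case_prod P e + case_prod P e * exp (fold_weight w e))"
    using P by (intro prod.cong) (auto simp: algebra_simps split: prod.splits)
  finally show ?thesis by (simp add: exp_minus field_simps)
qed

text \<open>For negative y, put u = - y: the product of 1 - u + u^2 with the quadratic Taylor
  polynomial of exp u is at least 1.\<close>

lemma exp_le_quadratic:
  fixes y :: real
  assumes "\<bar>y\<bar> \<le> 1"
  shows "exp y \<le> 1 + y + y\<^sup>2"
proof (cases "y \<ge> 0")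
  case True
  then show ?thesis using exp_bound[of y] assms by auto
next
  case False
  define u where "u = - y"
  have u: "0 \<le> u" "u \<le> 1" using False assms by (auto simp: u_def)
  have "1 + u + u\<^sup>2 / 2 \<le> exp u" using exp_lower_Taylor_quadratic[of u] u by auto
  moreover have "1 \<le> (1 - u + u\<^sup>2) * (1 + u + u\<^sup>2 / 2)"
  proof -
    have "(1 - u + u\<^sup>2) * (1 + u + u\<^sup>2 / 2) = 1 + u\<^sup>2 / 2 + u^3 / 2 + u^4 / 2"
      by (simp add: field_simps power_numeral_reduce)
    then show ?thesis using u by auto
  qed
  moreover have "0 \<le> 1 - u + u\<^sup>2" using u by auto
  ultimately have "1 \<le> (1 - u + u\<^sup>2) * exp u"
    by (meson mult_left_mono order_trans)
  then have "exp (- u) \<le> 1 - u + u\<^sup>2"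
    by (simp add: exp_minus field_simps)
  then show ?thesis by (simp add: u_def)
qed

text \<open>The bound 1/2 keeps every folded weight in [-1, 1], where
  \<open>exp_le_quadratic\<close> applies; centring cancels the linear term. The factor 2 comes from
  (a + b)^2 \<le> 2 a^2 + 2 b^2 for the two orientations.\<close>

lemma edge_pmf_bernstein:
  fixes p :: real
  assumes P: "\<And>i j. P i j \<in> {0..p}" "p \<le> 1" and sym: "\<And>i j. P i j = P j i"
    and w: "\<And>i j. \<bar>w i j\<bar> \<le> 1 / 2"
  shows "edge_prob n P {a. t \<le> (\<Sum>i<n. \<Sum>j<n. w i j * (sym_entry a i j - P i j))}
     \<le> exp (2 * p * (\<Sum>i<n. \<Sum>j<n. (w i j)\<^sup>2) - t)"
proof -
  have p0: "0 \<le> p" using P(1)[of 0 0] by auto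
  define m where "m = (\<Sum>i<n. \<Sum>j<n. w i j * P i j)"
  have "edge_prob n P {a. t \<le> (\<Sum>i<n. \<Sum>j<n. w i j * (sym_entry a i j - P i j))}
      = edge_prob n P {a. t + m \<le> (\<Sum>i<n. \<Sum>j<n. w i j * sym_entry a i j)}"
    by (simp add: m_def right_diff_distrib sum_subtractf le_diff_eq)
  also have "\<dots> \<le> exp (- (t + m)) * (\<Prod>e\<in>upper_pairs n. 1 - case_prod P e + case_prod P e * exp (fold_weight w e))"
    using P by (intro edge_pmf_chernoff) (auto intro: order_trans)
  also have "(\<Prod>e\<in>upper_pairs n. 1 - case_prod P e + case_prod P e * exp (fold_weight w e))
     \<le> (\<Prod>e\<in>upper_pairs n. exp (fold_weight (\<lambda>i j. w i j * P i j + 2 * p * (w i j)\<^sup>2) e))"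
  proof (intro prod_mono conjI)
    fix e :: "nat \<times> nat"
    obtain i j where e: "e = (i, j)" by (cases e)
    let ?c = "fold_weight w e" and ?q = "P i j"
    have q: "0 \<le> ?q" "?q \<le> p" "?q \<le> 1" using P(1)[of i j] P(2) by auto
    show "0 \<le> 1 - case_prod P e + case_prod P e * exp ?c" using q by (simp add: e)
    have c: "\<bar>?c\<bar> \<le> 1" using w[of i j] w[of j i] by (auto simp: e fold_weight_def abs_le_iff)
    have "1 - ?q + ?q * exp ?c \<le> 1 - ?q + ?q * (1 + ?c + ?c\<^sup>2)"
      using exp_le_quadratic[OF c] q by (auto intro: mult_left_mono)
    also have "\<dots> = 1 + ?q * (?c + ?c\<^sup>2)" by (simp add: algebra_simps)
    also have "\<dots> \<le> exp (?q * (?c + ?c\<^sup>2))" by (rule exp_ge_add_one_self)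
    also have "?q * (?c + ?c\<^sup>2) \<le> ?q * ?c + p * ?c\<^sup>2"
      using mult_right_mono[OF q(2), of "?c\<^sup>2"] by (simp add: algebra_simps)
    also have "\<dots> \<le> fold_weight (\<lambda>i j. w i j * P i j + 2 * p * (w i j)\<^sup>2) e"
    proof (cases "i = j")
      case True
      then show ?thesis using p0 by (simp add: e fold_weight_def algebra_simps)
    next
      case False
      have "(w i j + w j i)\<^sup>2 \<le> 2 * (w i j)\<^sup>2 + 2 * (w j i)\<^sup>2"
        using sum_squares_bound[of "w i j" "w j i"] by (simp add: power2_sum)
      then have "p * (w i j + w j i)\<^sup>2 \<le> p * (2 * (w i j)\<^sup>2 + 2 * (w j i)\<^sup>2)"
        using p0 by (rule mult_left_mono)
      then show ?thesis using False sym[of j i] by (simp add: e fold_weight_def algebra_simps)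
    qed
    finally show "1 - case_prod P e + case_prod P e * exp ?c \<le> exp (fold_weight (\<lambda>i j. w i j * P i j + 2 * p * (w i j)\<^sup>2) e)"
      by (simp add: e)
  qed
  also have "\<dots> = exp (m + 2 * p * (\<Sum>i<n. \<Sum>j<n. (w i j)\<^sup>2))"
    by (simp add: exp_sum[symmetric] sum_fold_weight m_def sum.distrib sum_distrib_left)
  finally have "edge_prob n P {a. t \<le> (\<Sum>i<n. \<Sum>j<n. w i j * (sym_entry a i j - P i j))}
     \<le> exp (- (t + m)) * exp (m + 2 * p * (\<Sum>i<n. \<Sum>j<n. (w i j)\<^sup>2))"
    by simp
  then show ?thesis unfolding exp_add[symmetric] by (simp add: algebra_simps)
qed

text \<open>\<open>Q\<close> may contain both orientations of a pair, so a folded weight is 0, l or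
  2 l. Replacing exp on [0, 2 l] by its chord makes the exponents linear in the folded weights,
  which add up to l |Q|.\<close>

lemma edge_pmf_upper_tail:
  fixes p :: real
  assumes P: "\<And>i j. P i j \<in> {0..p}" "p \<le> 1"
    and Q: "Q \<subseteq> {..<n} \<times> {..<n}" and l: "0 < l"
  shows "edge_prob n P {a. t \<le> (\<Sum>(i,j)\<in>Q. sym_entry a i j)}
     \<le> exp (p * real (card Q) * (exp (2 * l) - 1) / 2 - l * t)"
proof -
  define w where "w i j = l * of_bool ((i, j) \<in> Q)" for i j
  have p0: "0 \<le> p" using P(1)[of 0 0] by auto
  have Qs: "(\<Sum>i<n. \<Sum>j<n. w i j * f i j) = l * (\<Sum>(i,j)\<in>Q. f i j)" for f
  proof -
    have "(\<Sum>i<n. \<Sum>j<n. w i j * f i j) = (\<Sum>(i,j)\<in>{..<n} \<times> {..<n}. w i j * f i j)"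
      by (rule sum.cartesian_product)
    also have "\<dots> = (\<Sum>(i,j)\<in>Q. w i j * f i j)"
      using Q by (intro sum.mono_neutral_right) (auto simp: w_def)
    also have "\<dots> = (\<Sum>(i,j)\<in>Q. l * f i j)" by (intro sum.cong) (auto simp: w_def)
    also have "\<dots> = l * (\<Sum>(i,j)\<in>Q. f i j)" by (simp add: sum_distrib_left case_prod_unfold)
    finally show ?thesis .
  qed
  have "edge_prob n P {a. t \<le> (\<Sum>(i,j)\<in>Q. sym_entry a i j)}
      = edge_prob n P {a. l * t \<le> (\<Sum>i<n. \<Sum>j<n. w i j * sym_entry a i j)}"
    using l by (simp add: Qs)
  also have "\<dots> \<le> exp (- (l * t)) * (\<Prod>e\<in>upper_pairs n. 1 - case_prod P e + case_prod P e * exp (fold_weight w e))"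
    using P by (intro edge_pmf_chernoff) (auto intro: order_trans)
  also have "(\<Prod>e\<in>upper_pairs n. 1 - case_prod P e + case_prod P e * exp (fold_weight w e))
     \<le> (\<Prod>e\<in>upper_pairs n. exp (p * (exp (2 * l) - 1) / (2 * l) * fold_weight w e))"
  proof (intro prod_mono conjI)
    fix e :: "nat \<times> nat"
    obtain i j where e: "e = (i, j)" by (cases e)
    let ?c = "fold_weight w e" and ?q = "P i j"
    have q: "0 \<le> ?q" "?q \<le> p" "?q \<le> 1" using P(1)[of i j] P(2) by auto
    show "0 \<le> 1 - case_prod P e + case_prod P e * exp ?c" using q by (simp add: e)
    have c: "0 \<le> ?c" "?c \<le> 2 * l" using l by (auto simp: e fold_weight_def w_def)
    define u where "u = ?c / (2 * l)"
    have u: "0 \<le> u" "u \<le> 1" "?c = u * (2 * l)" using c l by (auto simp: u_def field_simps)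
    have "exp ((1 - u) *\<^sub>R 0 + u *\<^sub>R (2 * l)) \<le> (1 - u) * exp 0 + u * exp (2 * l)"
      using u by (intro convex_onD[OF exp_convex]) auto
    then have ec: "exp ?c - 1 \<le> u * (exp (2 * l) - 1)" using u by (simp add: algebra_simps)
    have "1 - ?q + ?q * exp ?c = 1 + ?q * (exp ?c - 1)" by (simp add: algebra_simps)
    also have "\<dots> \<le> exp (?q * (exp ?c - 1))" by (rule exp_ge_add_one_self)
    also have "?q * (exp ?c - 1) \<le> p * (u * (exp (2 * l) - 1))"
      using ec q c p0 by (intro mult_mono) auto
    also have "\<dots> = p * (exp (2 * l) - 1) / (2 * l) * ?c" by (simp add: u_def)
    finally show "1 - case_prod P e + case_prod P e * exp ?c \<le> exp (p * (exp (2 * l) - 1) / (2 * l) * ?c)"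
      by (simp add: e)
  qed
  also have "\<dots> = exp (p * (exp (2 * l) - 1) / (2 * l) * (l * real (card Q)))"
    using Qs[of "\<lambda>_ _. 1"]
    by (subst exp_sum[symmetric]) (simp_all only: sum_fold_weight sum_distrib_left[symmetric], simp_all)
  also have "p * (exp (2 * l) - 1) / (2 * l) * (l * real (card Q)) = p * real (card Q) * (exp (2 * l) - 1) / 2"
    using l by (simp add: field_simps)
  finally have "edge_prob n P {a. t \<le> (\<Sum>(i,j)\<in>Q. sym_entry a i j)}
     \<le> exp (- (l * t)) * exp (p * real (card Q) * (exp (2 * l) - 1) / 2)"
    by simp
  then show ?thesis unfolding exp_add[symmetric] by (simp add: algebra_simps)
qed

section \<open>Light pairs, discrepancy and degrees\<close>

text \<open>The radius fits rounding: if v has squared norm at most n, moving each coordinate by at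
  most 1 gives squares at most 2 v_i^2 + 2, which sum to 4 n.\<close>

definition int_ball :: "nat \<Rightarrow> (nat \<Rightarrow> int) set" where
  "int_ball n = {k \<in> {..<n} \<rightarrow>\<^sub>E UNIV. (\<Sum>i<n. (k i)\<^sup>2) \<le> 4 * int n}"

text \<open>For integers the square dominates the absolute value, so a two-sided geometric series of
  ratio 1/2 dominates the Gaussian sum.\<close>

lemma sum_exp_neg_square_le: "(\<Sum>z\<in>{- int N..int N}. exp (- (real_of_int z)\<^sup>2)) \<le> 3"
proof -
  have geo: "(\<Sum>z\<in>{- int N..int N}. (1 / 2 :: real) ^ nat \<bar>z\<bar>) = 3 - 2 * (1 / 2) ^ N"
  proof (induction N)
    case (Suc N)
    have ins: "{- int (Suc N)..int (Suc N)} = insert (- int (Suc N)) (insert (int (Suc N)) {- int N..int N})"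
      by auto
    have nat: "nat \<bar>- int (Suc N)\<bar> = Suc N" "nat \<bar>int (Suc N)\<bar> = Suc N" by linarith+
    have "(\<Sum>z\<in>{- int (Suc N)..int (Suc N)}. (1 / 2 :: real) ^ nat \<bar>z\<bar>)
        = (1 / 2) ^ nat \<bar>- int (Suc N)\<bar> + ((1 / 2) ^ nat \<bar>int (Suc N)\<bar> + (\<Sum>z\<in>{- int N..int N}. (1 / 2) ^ nat \<bar>z\<bar>))"
      unfolding ins by (subst sum.insert; simp)
    then show ?case unfolding nat Suc by simp
  qed auto
  have "exp (- (real_of_int z)\<^sup>2) \<le> (1 / 2) ^ nat \<bar>z\<bar>" for z :: int
  proof -
    define m where "m = nat \<bar>z\<bar>"
    have "\<bar>real_of_int z\<bar> = real m" by (simp add: m_def)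
    then have "(real_of_int z)\<^sup>2 = real m ^ 2" by (metis power2_abs)
    moreover have "real m \<le> real m ^ 2" by (cases m) (auto simp: power2_eq_square)
    ultimately have "exp (- (real_of_int z)\<^sup>2) \<le> exp (- real m)" by simp
    also have "\<dots> = exp (- 1) ^ m" using exp_of_nat_mult[of m "- 1 :: real"] by simp
    also have "\<dots> \<le> (1 / 2) ^ m"
      using exp_ge_add_one_self[of 1] by (intro power_mono) (auto simp: exp_minus field_simps)
    finally show ?thesis by (simp add: m_def)
  qed
  then have "(\<Sum>z\<in>{- int N..int N}. exp (- (real_of_int z)\<^sup>2)) \<le> (\<Sum>z\<in>{- int N..int N}. (1 / 2) ^ nat \<bar>z\<bar>)"
    by (intro sum_mono)
  also have "\<dots> \<le> 3" unfolding geo by simp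
  finally show ?thesis .
qed

lemma int_ball_subset: "int_ball n \<subseteq> {..<n} \<rightarrow>\<^sub>E {- int (4 * n)..int (4 * n)}"
proof
  fix k assume k: "k \<in> int_ball n"
  have "k i \<in> {- int (4 * n)..int (4 * n)}" if i: "i < n" for i
  proof -
    have "\<bar>k i\<bar> \<le> \<bar>k i\<bar>\<^sup>2" by (cases "k i = 0") (simp, rule self_le_power, auto)
    also have "\<dots> \<le> (\<Sum>i<n. (k i)\<^sup>2)"
      using i by (simp, intro member_le_sum) auto
    also have "\<dots> \<le> int (4 * n)" using k by (auto simp: int_ball_def)
    finally show ?thesis by auto
  qed
  then show "k \<in> {..<n} \<rightarrow>\<^sub>E {- int (4 * n)..int (4 * n)}"
    using k by (auto simp: int_ball_def PiE_iff)
qed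

lemma finite_int_ball [simp]: "finite (int_ball n)"
  by (rule finite_subset[OF int_ball_subset]) (auto intro: finite_PiE)

text \<open>Integer points are counted by giving each of them the Gaussian weight, which is at least
  \<open>exp (- 4 n)\<close> on the ball and factorizes over the coordinates.\<close>

lemma card_int_ball_le: "real (card (int_ball n)) \<le> exp (6 * real n)"
proof -
  let ?B = "{- int (4 * n)..int (4 * n)}"
  have "real (card (int_ball n)) = (\<Sum>k\<in>int_ball n. 1)" by simp
  also have "\<dots> \<le> (\<Sum>k\<in>int_ball n. exp (4 * real n) * (\<Prod>i<n. exp (- (real_of_int (k i))\<^sup>2)))"
  proof (intro sum_mono)
    fix k assume "k \<in> int_ball n"
    then have "(\<Sum>i<n. (k i)\<^sup>2) \<le> 4 * int n" by (simp add: int_ball_def)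
    then have "real_of_int (\<Sum>i<n. (k i)\<^sup>2) \<le> 4 * real n" by linarith
    then show "1 \<le> exp (4 * real n) * (\<Prod>i<n. exp (- (real_of_int (k i))\<^sup>2))"
      by (simp add: exp_sum[symmetric] exp_add[symmetric] sum_negf)
  qed
  also have "\<dots> \<le> (\<Sum>k\<in>{..<n} \<rightarrow>\<^sub>E ?B. exp (4 * real n) * (\<Prod>i<n. exp (- (real_of_int (k i))\<^sup>2)))"
    using int_ball_subset by (intro sum_mono2) (auto intro!: finite_PiE mult_nonneg_nonneg prod_nonneg)
  also have "\<dots> = exp (4 * real n) * (\<Prod>i<n. \<Sum>z\<in>?B. exp (- (real_of_int z)\<^sup>2))"
    by (subst prod_sum_PiE) (auto simp: sum_distrib_left)
  also have "\<dots> \<le> exp (4 * real n) * (\<Prod>i<n. 3)"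
    using sum_exp_neg_square_le[of "4 * n"] by (intro mult_left_mono prod_mono) (auto intro: sum_nonneg)
  also have "\<dots> \<le> exp (4 * real n) * exp 2 ^ n"
    using exp_ge_add_one_self[of 2] by (auto intro!: power_mono)
  also have "\<dots> = exp (6 * real n)"
    using exp_of_nat_mult[of n "2 :: real"] exp_add[of "4 * real n" "2 * real n"] by (simp add: mult.commute)
  finally show ?thesis .
qed

lemma prob_UN_le:
  assumes "finite I" "\<And>i. i \<in> I \<Longrightarrow> measure_pmf.prob M (B i) \<le> b i"
  shows "measure_pmf.prob M (\<Union>i\<in>I. B i) \<le> (\<Sum>i\<in>I. b i)"
proof -
  have "measure_pmf.prob M (\<Union>i\<in>I. B i) \<le> (\<Sum>i\<in>I. measure_pmf.prob M (B i))"
    using assms(1) by (intro measure_pmf.finite_measure_subadditive_finite) auto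
  also have "\<dots> \<le> (\<Sum>i\<in>I. b i)" by (intro sum_mono assms(2))
  finally show ?thesis .
qed

definition light_bound :: "nat \<Rightarrow> (nat \<Rightarrow> nat \<Rightarrow> real) \<Rightarrow> real \<Rightarrow> (nat \<Rightarrow> nat \<Rightarrow> real) \<Rightarrow> bool" where
  "light_bound n P p A \<longleftrightarrow> (\<forall>k\<in>int_ball n. \<forall>l\<in>int_ball n.
     (\<Sum>i<n. \<Sum>j<n. of_bool (\<bar>real_of_int (k i * l j)\<bar> \<le> sqrt (n * p)) * real_of_int (k i * l j) * (A i j - P i j))
       < 42 * n * sqrt (n * p))"

lemma int_ball_real: "k \<in> int_ball n \<Longrightarrow> (\<Sum>i<n. (real_of_int (k i))\<^sup>2) \<le> 4 * real n"
proof -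
  assume "k \<in> int_ball n"
  then have "(\<Sum>i<n. (k i)\<^sup>2) \<le> 4 * int n" by (simp add: int_ball_def)
  then have "real_of_int (\<Sum>i<n. (k i)\<^sup>2) \<le> 4 * real n" by linarith
  then show ?thesis by simp
qed

text \<open>After division by 2 sqrt (n p) the weights are at most 1/2, and 2 p times the sum of
  their squares is at most 2 p (4 n)^2 / (4 n p) = 8 n. The deviation 21 n leaves exp (- 13 n) for
  each of at most exp (12 n) pairs of points.\<close>

lemma prob_not_light_bound:
  fixes p :: real
  assumes P: "\<And>i j. P i j \<in> {0..p}" "p \<le> 1" and sym: "\<And>i j. P i j = P j i"
    and np: "0 < n" "0 < p"
  shows "edge_prob n P {a. \<not> light_bound n P p (sym_entry a)} \<le> exp (- real n)"
proof -
  define D where "D = sqrt (n * p)"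
  have D: "D > 0" "D\<^sup>2 = n * p" using np by (auto simp: D_def)
  define v where "v k l i j = of_bool (\<bar>real_of_int (k i * l j)\<bar> \<le> D) * real_of_int (k i * l j)"
    for k l :: "nat \<Rightarrow> int" and i j
  define E where "E = (\<lambda>(k, l). {a. 21 * real n \<le> (\<Sum>i<n. \<Sum>j<n. v k l i j / (2 * D) * (sym_entry a i j - P i j))})"
  have "{a. \<not> light_bound n P p (sym_entry a)} = (\<Union>kl\<in>int_ball n \<times> int_ball n. E kl)"
  proof -
    have "21 * real n \<le> (\<Sum>i<n. \<Sum>j<n. v k l i j / (2 * D) * (sym_entry a i j - P i j))
      \<longleftrightarrow> 42 * real n * D \<le> (\<Sum>i<n. \<Sum>j<n. v k l i j * (sym_entry a i j - P i j))" for k l a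
    proof -
      have "(\<Sum>i<n. \<Sum>j<n. v k l i j / (2 * D) * (sym_entry a i j - P i j))
        = (\<Sum>i<n. \<Sum>j<n. v k l i j * (sym_entry a i j - P i j)) / (2 * D)" (is "_ = ?X / _")
        by (simp add: sum_divide_distrib)
      moreover have "21 * real n \<le> ?X / (2 * D) \<longleftrightarrow> 42 * real n * D \<le> ?X"
        using D by (simp add: pos_le_divide_eq mult.commute mult.left_commute)
      ultimately show ?thesis by simp
    qed
    then show ?thesis by (auto simp: light_bound_def E_def v_def D_def not_less)
  qed
  also have "edge_prob n P \<dots> \<le> (\<Sum>kl\<in>int_ball n \<times> int_ball n. exp (- (13 * real n)))"
  proof (intro prob_UN_le)
    fix kl assume "kl \<in> int_ball n \<times> int_ball n"
    then obtain k l where kl: "kl = (k, l)" "k \<in> int_ball n" "l \<in> int_ball n" by auto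
    have "edge_prob n P (E kl) \<le> exp (2 * p * (\<Sum>i<n. \<Sum>j<n. (v k l i j / (2 * D))\<^sup>2) - 21 * real n)"
      unfolding E_def kl prod.case
      using D by (intro edge_pmf_bernstein P sym) (auto simp: v_def field_simps)
    also have "2 * p * (\<Sum>i<n. \<Sum>j<n. (v k l i j / (2 * D))\<^sup>2) \<le> 8 * real n"
    proof -
      have "(\<Sum>i<n. \<Sum>j<n. (v k l i j / (2 * D))\<^sup>2) \<le> (\<Sum>i<n. \<Sum>j<n. (real_of_int (k i))\<^sup>2 * (real_of_int (l j))\<^sup>2 / (4 * D\<^sup>2))"
        using D(1) by (intro sum_mono) (auto simp: v_def power_divide power_mult_distrib)
      also have "\<dots> = (\<Sum>i<n. (real_of_int (k i))\<^sup>2) * (\<Sum>i<n. (real_of_int (l i))\<^sup>2) / (4 * D\<^sup>2)"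
        by (simp add: sum_product sum_divide_distrib)
      also have "\<dots> \<le> (4 * real n) * (4 * real n) / (4 * D\<^sup>2)"
        using int_ball_real[OF kl(2)] int_ball_real[OF kl(3)]
        by (intro divide_right_mono mult_mono) (auto intro: sum_nonneg)
      finally have "2 * p * (\<Sum>i<n. \<Sum>j<n. (v k l i j / (2 * D))\<^sup>2) \<le> 2 * p * ((4 * real n) * (4 * real n) / (4 * D\<^sup>2))"
        using np by (intro mult_left_mono) auto
      also have "\<dots> = 8 * real n" using np by (simp add: D(2) field_simps)
      finally show ?thesis .
    qed
    finally show "edge_prob n P (E kl) \<le> exp (- (13 * real n))" by simp
  qed simp
  also have "\<dots> = (real (card (int_ball n)))\<^sup>2 * exp (- (13 * real n))"
    by (simp add: card_cartesian_product power2_eq_square)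
  also have "\<dots> \<le> (exp (6 * real n))\<^sup>2 * exp (- (13 * real n))"
    using card_int_ball_le by (intro mult_right_mono power_mono) auto
  also have "\<dots> = exp (- real n)"
    by (simp add: power2_eq_square exp_add[symmetric])
  finally show ?thesis .
qed

text \<open>The exponent of the entropy bound \<open>(e n / m)\<^sup>m\<close> for the number of \<open>m\<close>-element sets.\<close>

definition entropy :: "nat \<Rightarrow> nat \<Rightarrow> real" where
  "entropy n m = real m * (1 + ln (real n / real m))"

text \<open>Keep a single term of the expansion of (1 + m / n)^n, which is at most exp m.\<close>

lemma binomial_le_entropy:
  assumes "0 < m" "m \<le> n"
  shows "real (n choose m) \<le> exp (entropy n m)"
proof -
  have "real (n choose m) * (real m / real n) ^ m * 1 ^ (n - m) \<le> (\<Sum>k\<le>n. real (n choose k) * (real m / real n) ^ k * 1 ^ (n - k))"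
    using assms by (intro member_le_sum) auto
  also have "\<dots> = (real m / real n + 1) ^ n" by (rule binomial_ring[symmetric])
  also have "\<dots> \<le> exp (real m / real n) ^ n"
    using exp_ge_add_one_self[of "real m / real n"] by (intro power_mono) (auto simp: add.commute)
  also have "\<dots> = exp (real m)" using assms exp_of_nat_mult[of n "real m / real n"] by simp
  finally have "real (n choose m) * (real m / real n) ^ m \<le> exp (real m)" by simp
  then have "real (n choose m) \<le> exp (real m) * (real n / real m) ^ m"
    using assms by (simp add: field_simps power_divide)
  also have "(real n / real m) ^ m = exp (real m * ln (real n / real m))"
    using assms by (simp add: exp_of_nat_mult)
  finally show ?thesis by (simp add: entropy_def algebra_simps exp_add)
qed

text \<open>The left-hand side is the value at m = 1; the difference is (m - 1) ln (n / m) plus m -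
  1 - ln m, both nonnegative.\<close>

lemma entropy_ge:
  assumes "0 < m" "m \<le> n"
  shows "1 + ln (real n) \<le> entropy n m"
proof -
  have m: "1 \<le> real m" "real m \<le> real n" using assms by auto
  have "0 \<le> (real m - 1) * (ln (real n) - ln (real m))" using m by (intro mult_nonneg_nonneg) auto
  moreover have "ln (real m) \<le> real m - 1" using m by (intro ln_le_minus_one) auto
  ultimately show ?thesis using m by (simp add: entropy_def ln_div algebra_simps)
qed

lemma prob_UN_subsets_le:
  assumes m: "0 < m" "m \<le> n"
    and B: "\<And>M. M \<subseteq> {..<n} \<Longrightarrow> card M = m \<Longrightarrow> measure_pmf.prob X (B M) \<le> exp b"
  shows "measure_pmf.prob X (\<Union>M\<in>{M. M \<subseteq> {..<n} \<and> card M = m}. B M) \<le> exp (entropy n m + b)"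
proof -
  have "measure_pmf.prob X (\<Union>M\<in>{M. M \<subseteq> {..<n} \<and> card M = m}. B M)
      \<le> (\<Sum>M\<in>{M. M \<subseteq> {..<n} \<and> card M = m}. exp b)"
    using B by (intro prob_UN_le) auto
  also have "\<dots> = real (n choose m) * exp b" using n_subsets[of "{..<n}" m] by simp
  also have "\<dots> \<le> exp (entropy n m) * exp b" using binomial_le_entropy[OF m] by (intro mult_right_mono) auto
  finally show ?thesis by (simp add: exp_add)
qed

text \<open>One of the four powers pays for the number of m-sets; the other three leave n^(-3) for
  each of the n sizes.\<close>

lemma sum_entropy_le:
  assumes "0 < n"
  shows "(\<Sum>S\<in>Pow {..<n} - {{}}. exp (- 4 * entropy n (card S))) \<le> 1 / real n ^ 2"
proof -
  have "Pow {..<n} - {{}} = (\<Union>m\<in>{1..n}. {S. S \<subseteq> {..<n} \<and> card S = m})"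
    using card_mono[of "{..<n}"] by (auto simp: card_gt_0_iff Suc_le_eq finite_subset[of _ "{..<n}"])
  then have "(\<Sum>S\<in>Pow {..<n} - {{}}. exp (- 4 * entropy n (card S)))
     = (\<Sum>m\<in>{1..n}. \<Sum>S\<in>{S. S \<subseteq> {..<n} \<and> card S = m}. exp (- 4 * entropy n (card S)))"
    by (simp only:) (rule sum.UNION_disjoint, auto)
  also have "\<dots> = (\<Sum>m\<in>{1..n}. real (n choose m) * exp (- 4 * entropy n m))"
    using n_subsets[of "{..<n}"] by (intro sum.cong) auto
  also have "\<dots> \<le> (\<Sum>m\<in>{1..n}. 1 / real n ^ 3)"
  proof (intro sum_mono)
    fix m assume m: "m \<in> {1..n}"
    have "real (n choose m) * exp (- 4 * entropy n m) \<le> exp (entropy n m) * exp (- 4 * entropy n m)"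
      using m by (intro mult_right_mono binomial_le_entropy) auto
    also have "\<dots> = exp (- 3 * entropy n m)" by (simp flip: exp_add)
    also have "\<dots> \<le> exp (- 3 * ln (real n))" using entropy_ge[of m n] m by auto
    also have "\<dots> = 1 / real n ^ 3"
      using assms by (simp add: exp_minus exp_of_nat_mult[of 3, simplified] field_simps)
    finally show "real (n choose m) * exp (- 4 * entropy n m) \<le> 1 / real n ^ 3" .
  qed
  also have "\<dots> = 1 / real n ^ 2" using assms by (simp add: field_simps power_numeral_reduce)
  finally show ?thesis .
qed

text \<open>Used with \<open>x\<close> the budget per vertex and \<open>r\<close> the inverse density of a vertex set: the budget
  pays for the entropy.\<close>

lemma one_plus_ln_le:
  fixes x r u :: real
  assumes x: "1 / 2 \<le> x\<^sup>2" "0 < x" and r: "0 < r" "r \<le> x ^ 3 * u" and u: "1 \<le> u"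
  shows "1 + ln r \<le> 5 * (x * (1 + ln u / 2))"
proof -
  have x7: "7 / 10 \<le> x" by (rule power2_le_imp_le) (use x in \<open>simp_all add: power2_eq_square\<close>)
  have "ln r \<le> ln (x ^ 3 * u)" using r by simp
  also have "\<dots> = 3 * ln x + ln u" using x u by (simp add: ln_mult ln_realpow)
  also have "\<dots> \<le> 3 * (x - 1) + ln u" using ln_le_minus_one[of x] x by simp
  finally have "1 + ln r \<le> 3 * x + ln u" by simp
  also have "ln u \<le> (10 / 7 * x) * ln u"
    using mult_right_mono[of 1 "10 / 7 * x" "ln u"] x7 u by simp
  also have "3 * x + 10 / 7 * x * ln u \<le> 5 * x + 5 / 2 * (x * ln u)"
  proof -
    have "0 \<le> x * ln u" using x u by (intro mult_nonneg_nonneg) auto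
    then show ?thesis using x by (simp add: mult.assoc)
  qed
  finally show ?thesis by (simp add: algebra_simps)
qed

lemma exp_2_le: "exp (2 :: real) \<le> 8"
proof -
  have "exp (2 :: real) = exp 1 * exp 1" by (simp flip: exp_add)
  also have "\<dots> \<le> 2.72 * 2.72" using e_less_272 by (intro mult_mono) auto
  finally show ?thesis by simp
qed

text \<open>\<open>S\<close> and \<open>T\<close> will be level sets on which two vectors have entries of ratio about \<open>2 ^ h\<close>; the ratio
  decides how the excess over the mean is divided between the two sides.\<close>

definition discrepancy_bound :: "nat \<Rightarrow> real \<Rightarrow> (nat \<Rightarrow> nat \<Rightarrow> real) \<Rightarrow> bool" where
  "discrepancy_bound n p A \<longleftrightarrow>
    (\<forall>h S T. S \<subseteq> {..<n} \<longrightarrow> T \<subseteq> {..<n} \<longrightarrow> 2 ^ h < 2 * sqrt (n * p) \<longrightarrow>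
      (\<Sum>(i, j)\<in>S \<times> T. A i j) \<le> 24 * (p * real (card S) * real (card T)
        + sqrt (sqrt (n * p) / 2 ^ h) * card T + 4 ^ h * sqrt (sqrt (n * p) / 2 ^ h) * card S))"

text \<open>With mean \<mu> and budget b, the tilt l = 1 + ln (1 + b / \<mu>) / 2 makes the moment
  term at most 4 (\<mu> + b) l, so the factor 24 leaves the exponent - 20 b l. Since n p = 4^h g^4,
  the budgets g per vertex of \<open>T\<close> and 4^h g per vertex of \<open>S\<close> make 5 b l
  dominate both entropies.\<close>

lemma prob_discrepancy_pair:
  fixes p g :: real
  assumes P: "\<And>i j. P i j \<in> {0..p}" "p \<le> 1" and np: "0 < n" "0 < p"
    and h: "2 ^ h < 2 * sqrt (n * p)"
    and S: "S \<subseteq> {..<n}" "S \<noteq> {}" and T: "T \<subseteq> {..<n}" "T \<noteq> {}"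
    and g: "g = sqrt (sqrt (n * p) / 2 ^ h)"
  shows "edge_prob n P
      {a. 24 * (p * card S * card T + g * card T + 4 ^ h * g * card S) \<le> (\<Sum>(i, j)\<in>S \<times> T. sym_entry a i j)}
     \<le> exp (- 4 * entropy n (card S)) * exp (- 4 * entropy n (card T))"
proof -
  have finS: "finite S" "finite T" using S T by (auto intro: finite_subset)
  define s where "s = real (card S)"
  define t where "t = real (card T)"
  have s: "1 \<le> s" and t: "1 \<le> t" using S T finS
    by (auto simp: s_def t_def Suc_le_eq card_gt_0_iff)
  define \<mu> where "\<mu> = p * s * t"
  define b where "b = g * t + 4 ^ h * g * s"
  define u where "u = 1 + b / \<mu>"
  define l where "l = 1 + ln u / 2"
  have g2: "g\<^sup>2 = sqrt (n * p) / 2 ^ h" "0 < g" using np by (auto simp: g)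
  have mu: "0 < \<mu>" using np s t by (auto simp: \<mu>_def)
  have b: "0 < b" using g2 s t by (auto simp: b_def intro!: add_pos_nonneg)
  have u1: "1 \<le> u" using mu b by (auto simp: u_def)
  have l1: "1 \<le> l" using u1 by (auto simp: l_def)
  \<comment> \<open>The restriction on \<open>h\<close> is there for this lower bound, which
    \<open>one_plus_ln_le\<close> requires.\<close>
  have gh: "1 / 2 \<le> g\<^sup>2" unfolding g2 using h by (simp add: field_simps)
  have g4: "real n * p = 4 ^ h * g ^ 4"
  proof -
    have "g ^ 4 = (g\<^sup>2)\<^sup>2" by simp
    also have "\<dots> = real n * p / 4 ^ h"
      using np unfolding g2 power_divide by (simp add: power_mult[symmetric] power2_eq_square power_mult_distrib[symmetric])
    finally show ?thesis by simp
  qed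
  have eT: "1 + ln (real n / t) \<le> 5 * (g * l)"
    unfolding l_def
  proof (rule one_plus_ln_le[OF gh g2(2)])
    \<comment> \<open>The share of the budget that belongs to \<open>S\<close>, relative to the
      mean, controls the density of \<open>T\<close>. For \<open>eS\<close> the roles are
      exchanged.\<close>
    have "real n / t = g ^ 3 * (4 ^ h * g * s / \<mu>)"
      using np s t g4 g2 unfolding \<mu>_def by (simp add: field_simps power_numeral_reduce)
    also have "\<dots> \<le> g ^ 3 * u"
      using g2 b mu s t by (intro mult_left_mono) (auto simp: u_def b_def add_divide_distrib)
    finally show "real n / t \<le> g ^ 3 * u" .
  qed (use np t u1 in auto)
  have eS: "1 + ln (real n / s) \<le> 5 * ((4 ^ h * g) * l)"
    unfolding l_def
  proof (rule one_plus_ln_le)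
    have "1 * g\<^sup>2 \<le> (4 ^ h)\<^sup>2 * g\<^sup>2" by (intro mult_right_mono one_le_power) auto
    then show "1 / 2 \<le> (4 ^ h * g)\<^sup>2" using gh by (simp add: power_mult_distrib)
    have "real n / s = 4 ^ h * g ^ 3 * (g * t / \<mu>)"
      using np s t g4 g2 unfolding \<mu>_def by (simp add: field_simps power_numeral_reduce)
    also have "\<dots> \<le> (4 ^ h * g) ^ 3 * u"
    proof (intro mult_mono)
      have "(4 :: real) ^ h \<le> (4 ^ h) ^ 3" using power_increasing[of 1 3 "(4::real) ^ h"] by simp
      then show "4 ^ h * g ^ 3 \<le> (4 ^ h * g) ^ 3" using g2 by (simp add: power_mult_distrib mult_right_mono)
    qed (use g2 b mu s t in \<open>auto simp: u_def b_def add_divide_distrib\<close>)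
    finally show "real n / s \<le> (4 ^ h * g) ^ 3 * u" .
  qed (use np s g2 u1 in auto)
  have ent: "entropy n (card S) + entropy n (card T) \<le> 5 * (b * l)"
  proof -
    have "entropy n (card S) = s * (1 + ln (real n / s))" "entropy n (card T) = t * (1 + ln (real n / t))"
      by (auto simp: entropy_def s_def t_def)
    moreover have "s * (1 + ln (real n / s)) \<le> s * (5 * ((4 ^ h * g) * l))" using eS s by (intro mult_left_mono) auto
    moreover have "t * (1 + ln (real n / t)) \<le> t * (5 * (g * l))" using eT t by (intro mult_left_mono) auto
    ultimately show ?thesis by (simp add: b_def algebra_simps)
  qed
  have "edge_prob n P {a. 24 * (\<mu> + b) \<le> (\<Sum>(i, j)\<in>S \<times> T. sym_entry a i j)}
     \<le> exp (p * real (card (S \<times> T)) * (exp (2 * l) - 1) / 2 - l * (24 * (\<mu> + b)))"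
    using S T l1 by (intro edge_pmf_upper_tail P) auto
  also have "p * real (card (S \<times> T)) * (exp (2 * l) - 1) / 2 \<le> 4 * (\<mu> + b) * l"
  proof -
    have "p * real (card (S \<times> T)) * (exp (2 * l) - 1) / 2 = \<mu> * (exp (2 * l) - 1) / 2"
      by (simp add: \<mu>_def s_def t_def card_cartesian_product)
    also have "\<dots> \<le> \<mu> * (8 * u) / 2"
    proof -
      have "exp (2 * l) = exp 2 * u" using u1 by (simp add: l_def algebra_simps exp_add)
      also have "\<dots> \<le> 8 * u" using u1 exp_2_le by (intro mult_right_mono) auto
      finally show ?thesis using mu by (intro divide_right_mono mult_left_mono) auto
    qed
    also have "\<dots> = 4 * (\<mu> + b) * 1" using mu by (simp add: u_def field_simps)
    also have "\<dots> \<le> 4 * (\<mu> + b) * l" using mu b l1 by (intro mult_left_mono) auto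
    finally show ?thesis .
  qed
  also have "4 * (\<mu> + b) * l - l * (24 * (\<mu> + b)) \<le> - 4 * (5 * (b * l))"
    using mu l1 by (simp add: algebra_simps)
  also have "\<dots> \<le> - 4 * (entropy n (card S) + entropy n (card T))" using ent by simp
  finally show ?thesis
    by (simp add: \<mu>_def b_def s_def t_def exp_add[symmetric] algebra_simps)
qed

text \<open>Admissible \<open>h\<close> satisfy 2^h < 2 n, so there are at most 2 n of them, and for
  each the failure probabilities of all pairs of sets sum to at most n^(-4).\<close>

lemma prob_not_discrepancy_bound:
  fixes p :: real
  assumes P: "\<And>i j. P i j \<in> {0..p}" "p \<le> 1" and np: "2 \<le> n" "0 < p"
  shows "edge_prob n P {a. \<not> discrepancy_bound n p (sym_entry a)} \<le> 1 / real n"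
proof -
  define g where "g h = sqrt (sqrt (n * p) / 2 ^ h)" for h
  define H where "H = {h. 2 ^ h < 2 * sqrt (real n * p)}"
  define F where "F = Pow {..<n} - {{}}"
  define B where "B = (\<lambda>(h, S, T). {a. 24 * (p * card S * card T + g h * card T + 4 ^ h * g h * card S)
     \<le> (\<Sum>(i, j)\<in>S \<times> T. sym_entry a i j)})"
  have H: "H \<subseteq> {..<2 * n}"
  proof
    fix h assume "h \<in> H"
    then have "2 ^ h < 2 * sqrt (real n * p)" by (simp add: H_def)
    also have "sqrt (real n * p) \<le> sqrt (real n * real n)"
      using np P(2) by (intro real_sqrt_le_mono mult_left_mono) auto
    also have "2 * sqrt (real n * real n) = real (2 * n)" by simp
    finally have "real (2 ^ h) < real (2 * n)" by simp
    then have "2 ^ h < 2 * n" unfolding of_nat_less_iff .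
    moreover have "h < 2 ^ h" by (rule less_exp)
    ultimately show "h \<in> {..<2 * n}" by (simp only: lessThan_iff)
  qed
  have finH: "finite H" using H by (rule finite_subset) auto
  have "{a. \<not> discrepancy_bound n p (sym_entry a)} \<subseteq> (\<Union>x\<in>H \<times> F \<times> F. B x)"
  proof
    fix a assume "a \<in> {a. \<not> discrepancy_bound n p (sym_entry a)}"
    then obtain h S T where *: "S \<subseteq> {..<n}" "T \<subseteq> {..<n}" "h \<in> H"
      and gt: "24 * (p * card S * card T + g h * card T + 4 ^ h * g h * card S) < (\<Sum>(i, j)\<in>S \<times> T. sym_entry a i j)"
      by (auto simp: discrepancy_bound_def H_def g_def not_le)
    have "0 \<le> g h" using np by (simp add: g_def)
    then have "0 \<le> 24 * (p * card S * card T + g h * card T + 4 ^ h * g h * card S)" using np by simp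
    with gt have "S \<noteq> {}" "T \<noteq> {}" by auto
    then show "a \<in> (\<Union>x\<in>H \<times> F \<times> F. B x)" using * gt
      by (intro UN_I[of "(h, S, T)"]) (auto simp: F_def B_def)
  qed
  then have "edge_prob n P {a. \<not> discrepancy_bound n p (sym_entry a)}
     \<le> edge_prob n P (\<Union>x\<in>H \<times> F \<times> F. B x)"
    by (intro measure_pmf.finite_measure_mono) auto
  also have "\<dots> \<le> (\<Sum>(h, S, T)\<in>H \<times> F \<times> F. exp (- 4 * entropy n (card S)) * exp (- 4 * entropy n (card T)))"
  proof (intro prob_UN_le)
    fix x assume "x \<in> H \<times> F \<times> F"
    then obtain h S T where x: "x = (h, S, T)" "h \<in> H" "S \<in> F" "T \<in> F" by auto
    show "edge_prob n P (B x)
       \<le> (case x of (h, S, T) \<Rightarrow> exp (- 4 * entropy n (card S)) * exp (- 4 * entropy n (card T)))"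
      using x np unfolding x(1) B_def prod.case
      by (intro prob_discrepancy_pair P) (auto simp: H_def F_def g_def)
  qed (use finH in \<open>auto simp: F_def\<close>)
  also have "\<dots> = real (card H) * (\<Sum>S\<in>F. exp (- 4 * entropy n (card S))) ^ 2"
    by (simp add: sum.cartesian_product[symmetric] power2_eq_square sum_product)
  also have "\<dots> \<le> (2 * real n) * (1 / real n ^ 2) ^ 2"
    using np sum_entropy_le[of n] card_mono[OF _ H]
    unfolding F_def[symmetric] by (intro mult_mono power_mono) (auto intro: sum_nonneg)
  also have "\<dots> = (2 / real n ^ 2) * (1 / real n)" using np by (simp add: field_simps power_numeral_reduce)
  also have "\<dots> \<le> 1 * (1 / real n)"
  proof (intro mult_right_mono)
    have "2 * 2 \<le> real n * real n" using np by (intro mult_mono) auto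
    then show "2 / real n ^ 2 \<le> 1" by (simp add: power2_eq_square divide_simps)
  qed auto
  finally show ?thesis by simp
qed

section \<open>Degree sums over sets of m vertices\<close>

definition degree_bound :: "nat \<Rightarrow> real \<Rightarrow> nat \<Rightarrow> (nat \<Rightarrow> nat \<Rightarrow> real) \<Rightarrow> bool" where
  "degree_bound n d m A \<longleftrightarrow>
    (\<forall>M. M \<subseteq> {..<n} \<longrightarrow> card M = m \<longrightarrow> (\<Sum>i\<in>M. \<Sum>j<n. A i j) < d * m)"

text \<open>With tilt 1 the moment term is at most (exp 2 - 1) / 2 \<le> 4 times n p m, hence c -
  4.\<close>

lemma prob_not_degree_bound:
  fixes p :: real
  assumes P: "\<And>i j. P i j \<in> {0..p}" "p \<le> 1" and m: "0 < m" "m \<le> n"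
  shows "edge_prob n P {a. \<not> degree_bound n (c * (n * p)) m (sym_entry a)}
    \<le> exp (entropy n m - (c - 4) * (n * p) * m)"
proof -
  have p0: "0 \<le> p" using P(1)[of 0 0] by auto
  let ?B = "\<lambda>M. {a. c * (n * p) * m \<le> (\<Sum>(i, j)\<in>M \<times> {..<n}. sym_entry a i j)}"
  have "{a. \<not> degree_bound n (c * (n * p)) m (sym_entry a)} = (\<Union>M\<in>{M. M \<subseteq> {..<n} \<and> card M = m}. ?B M)"
    by (auto simp: degree_bound_def not_less sum.cartesian_product)
  also have "edge_prob n P \<dots> \<le> exp (entropy n m + (- (c - 4) * (n * p) * m))"
  proof (rule prob_UN_subsets_le[OF m])
    fix M assume M: "M \<subseteq> {..<n}" "card M = m"
    have "edge_prob n P (?B M)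
      \<le> exp (p * real (card (M \<times> {..<n})) * (exp (2 * 1) - 1) / 2 - 1 * (c * (n * p) * m))"
      using M by (intro edge_pmf_upper_tail P) auto
    also have "p * real (card (M \<times> {..<n})) * (exp (2 * 1) - 1) / 2 \<le> p * (m * n) * 8 / 2"
      using M p0 exp_2_le by (intro divide_right_mono mult_mono) (auto simp: card_cartesian_product)
    finally show "edge_prob n P (?B M) \<le> exp (- (c - 4) * (n * p) * m)"
      by (simp add: algebra_simps)
  qed
  finally show ?thesis by (simp add: algebra_simps)
qed

section \<open>Heavy pairs\<close>

text \<open>Dyadic shells of the absolute values of the coordinates; zero coordinates lie in none of
  them.\<close>

definition level_set :: "nat \<Rightarrow> (nat \<Rightarrow> nat) \<Rightarrow> nat \<Rightarrow> nat set" where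
  "level_set n k a = {i. i < n \<and> 2 ^ a \<le> k i \<and> k i < 2 ^ Suc a}"

lemma level_set_disjoint: "a \<noteq> b \<Longrightarrow> level_set n k a \<inter> level_set n k b = {}"
proof (induction a b rule: linorder_wlog)
  case (le a b)
  then have "(2::nat) ^ Suc a \<le> 2 ^ b" by (intro power_increasing) auto
  then show ?case by (auto simp: level_set_def)
qed (simp add: Int_commute)

lemma level_set_sub: "level_set n k a \<subseteq> {..<n}"
  by (auto simp: level_set_def)

lemma finite_level_set [simp]: "finite (level_set n k a)"
  using level_set_sub by (rule finite_subset) simp

lemma level_exists:
  assumes "0 < (m :: nat)"
  shows "\<exists>a \<le> m. 2 ^ a \<le> m \<and> m < 2 ^ Suc a"
proof -
  obtain a where a: "2 ^ a \<le> m" "m < 2 ^ (a + 1)"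
    using ex_power_ivl1[of 2 m] assms by auto
  moreover from a(1) have "a \<le> m"
    using less_exp[of a] by linarith
  ultimately show ?thesis by (intro exI[of _ a]) simp
qed

text \<open>The index map \<open>f\<close> lets the estimate serve for sums over levels
  \<open>b\<close>, over \<open>b + h\<close> with \<open>h\<close> fixed, and over
  \<open>b + h\<close> with \<open>b\<close> fixed.\<close>

lemma sum_level_set_le:
  assumes "finite I" "inj_on f I"
  shows "(\<Sum>a\<in>I. 4 ^ f a * real (card (level_set n k (f a)))) \<le> (\<Sum>i<n. (real (k i))\<^sup>2)"
proof -
  have "(\<Sum>a\<in>I. 4 ^ f a * real (card (level_set n k (f a)))) \<le> (\<Sum>a\<in>I. \<Sum>i\<in>level_set n k (f a). (real (k i))\<^sup>2)"
  proof (intro sum_mono)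
    fix a assume "a \<in> I"
    have "(\<Sum>i\<in>level_set n k (f a). (4 :: real) ^ f a) \<le> (\<Sum>i\<in>level_set n k (f a). (real (k i))\<^sup>2)"
    proof (intro sum_mono)
      fix i assume "i \<in> level_set n k (f a)"
      then have "real (2 ^ f a) \<le> real (k i)" unfolding of_nat_le_iff by (simp add: level_set_def)
      then have "(2 ^ f a)\<^sup>2 \<le> (real (k i))\<^sup>2" by (intro power_mono) auto
      moreover have "((2 :: real) ^ f a)\<^sup>2 = 4 ^ f a"
        by (simp add: power2_eq_square flip: power_mult_distrib)
      ultimately show "4 ^ f a \<le> (real (k i))\<^sup>2" by simp
    qed
    then show "4 ^ f a * real (card (level_set n k (f a))) \<le> (\<Sum>i\<in>level_set n k (f a). (real (k i))\<^sup>2)"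
      by (simp add: mult.commute)
  qed
  also have "\<dots> = (\<Sum>i\<in>(\<Union>a\<in>I. level_set n k (f a)). (real (k i))\<^sup>2)"
    using assms by (intro sum.UNION_disjoint[symmetric]) (auto dest: inj_onD intro!: level_set_disjoint)
  also have "\<dots> \<le> (\<Sum>i<n. (real (k i))\<^sup>2)"
    using level_set_sub by (intro sum_mono2) auto
  finally show ?thesis .
qed

text \<open>The summands are the geometric progression \<open>sqrt D * sqrt 2 ^ h\<close>, dominated
  by its last term, which is at most sqrt D sqrt (2 D). So summing over all ratios loses no
  logarithm of D.\<close>

lemma sum_ratio_budget:
  fixes D :: real
  assumes D: "0 < D"
  shows "finite {h::nat. 2 ^ h < 2 * D}"
    and "(\<Sum>h\<in>{h::nat. 2 ^ h < 2 * D}. 2 ^ h * sqrt (D / 2 ^ h)) \<le> 5 * D"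
proof -
  define H where "H = {h::nat. 2 ^ h < 2 * D}"
  obtain N where N: "2 * D < 2 ^ N" using real_arch_pow[of 2 "2 * D"] by auto
  have sub: "H \<subseteq> {..<N}"
  proof
    fix h assume "h \<in> H"
    then have "(2::real) ^ h < 2 ^ N" using N unfolding H_def mem_Collect_eq by (rule less_trans)
    then show "h \<in> {..<N}" by simp
  qed
  then have fin: "finite H" by (rule finite_subset) simp
  then show "finite {h::nat. 2 ^ h < 2 * D}" by (simp add: H_def)
  have summand: "2 ^ h * sqrt (D / 2 ^ h) = sqrt D * sqrt 2 ^ h" for h
  proof -
    have "(2 :: real) ^ h = sqrt 2 ^ h * sqrt 2 ^ h" by (simp flip: power_mult_distrib)
    then show ?thesis by (simp add: real_sqrt_divide real_sqrt_power)
  qed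
  have r: "1.4 \<le> sqrt (2 :: real)" by (rule real_le_rsqrt) (simp add: power2_eq_square)
  have "(\<Sum>h\<in>H. sqrt 2 ^ h) \<le> 5 * sqrt D"
  proof (cases "H = {}")
    case False
    define m where "m = Max H"
    have m: "m \<in> H" using False fin by (simp add: m_def)
    have "sqrt 2 ^ m \<le> sqrt (2 * D)"
      using m by (auto simp: H_def simp flip: real_sqrt_power)
    then have "sqrt 2 * sqrt 2 ^ m \<le> sqrt 2 * (sqrt 2 * sqrt D)"
      by (intro mult_left_mono) (auto simp: real_sqrt_mult)
    then have m2: "sqrt 2 ^ Suc m \<le> 2 * sqrt D" by (simp flip: mult.assoc)
    have "(\<Sum>h\<in>H. sqrt (2::real) ^ h) \<le> (\<Sum>h<Suc m. sqrt 2 ^ h)"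
      using fin by (intro sum_mono2) (auto simp: m_def less_Suc_eq_le)
    also have "\<dots> = (sqrt 2 ^ Suc m - 1) / (sqrt 2 - 1)"
      using r by (intro geometric_sum) auto
    also have "\<dots> \<le> (2 * sqrt D) / 0.4"
      using r m2 D by (intro frac_le) auto
    finally show ?thesis by simp
  qed (use D in simp)
  then have "sqrt D * (\<Sum>h\<in>H. sqrt 2 ^ h) \<le> sqrt D * (5 * sqrt D)"
    using D by (intro mult_left_mono) auto
  also have "\<dots> = 5 * D" using D by simp
  finally have "sqrt D * (\<Sum>h\<in>H. sqrt 2 ^ h) \<le> 5 * D" .
  then show "(\<Sum>h\<in>{h::nat. 2 ^ h < 2 * D}. 2 ^ h * sqrt (D / 2 ^ h)) \<le> 5 * D"
    by (simp only: summand H_def sum_distrib_left)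
qed

text \<open>A block is given by the lower level \<open>b\<close> and the ratio exponent
  \<open>h\<close>. On a heavy block w = 2^h 4^b exceeds D / 4, so 4 w \<le> 16 w^2 / D turns the
  mean term of the discrepancy into a product of the square masses of the two levels. The other two
  terms are summed over \<open>b\<close> by mass and over \<open>h\<close> by
  \<open>sum_ratio_budget\<close>. In total 24 (256 + 32 * 5) = 9984.\<close>

lemma sum_level_blocks_le:
  fixes A :: "nat \<Rightarrow> nat \<Rightarrow> real" and k l :: "nat \<Rightarrow> nat" and p D :: real
  assumes A: "\<And>i j. 0 \<le> A i j" and disc: "discrepancy_bound n p A" and np: "0 < n" "0 < p"
    and k: "(\<Sum>i<n. (real (k i))\<^sup>2) \<le> 4 * n" and l: "(\<Sum>i<n. (real (l i))\<^sup>2) \<le> 4 * n"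
    and D: "D = sqrt (n * p)"
    and S: "S = level_set n k" and T: "T = level_set n l"
  shows "(\<Sum>h\<in>{h. 2 ^ h < 2 * D}. \<Sum>b<N. of_bool (D < 4 * (2 ^ h * 4 ^ b)) * (4 * (2 ^ h * 4 ^ b)) *
     (\<Sum>(i, j)\<in>S (b + h) \<times> T b. A i j)) \<le> 9984 * real n * D"
proof -
  define H where "H = {h::nat. 2 ^ h < 2 * D}"
  define g where "g h = sqrt (D / 2 ^ h)" for h :: nat
  have D0: "0 < D" "D\<^sup>2 = n * p" using np by (auto simp: D)
  have finH: "finite H" unfolding H_def by (rule sum_ratio_budget[OF D0(1)])
  have g0: "0 \<le> g h" for h using D0 by (simp add: g_def)
  define \<alpha> where "\<alpha> a = 4 ^ a * real (card (S a))" for a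
  define \<beta> where "\<beta> b = 4 ^ b * real (card (T b))" for b
  let ?c = "\<lambda>h b. of_bool (D < 4 * (2 ^ h * 4 ^ b)) * (4 * (2 ^ h * 4 ^ b)) :: real"
  have sumT: "(\<Sum>b<N. \<beta> b) \<le> 4 * n"
    using sum_level_set_le[of "{..<N}" "\<lambda>b. b" n l] l by (simp add: T \<beta>_def)
  have sumS: "(\<Sum>b<N. \<alpha> (b + h)) \<le> 4 * n" for h
    using sum_level_set_le[of "{..<N}" "\<lambda>b. b + h" n k] k by (simp add: S \<alpha>_def)
  have sumS': "(\<Sum>h\<in>H. \<alpha> (b + h)) \<le> 4 * n" for b
    using sum_level_set_le[of H "\<lambda>h. b + h" n k] k finH by (simp add: S \<alpha>_def)
  have summand: "?c h b * (\<Sum>(i, j)\<in>S (b + h) \<times> T b. A i j)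
     \<le> 24 * (16 * p / D * (\<alpha> (b + h) * \<beta> b)
       + 4 * (2 ^ h * g h) * \<beta> b
       + 4 * (2 ^ h * g h) * \<alpha> (b + h))" (is "?L \<le> ?R")
    if h: "h \<in> H" for h b
  proof (cases "D < 4 * (2 ^ h * 4 ^ b)")
    case True
    define w :: real where "w = 2 ^ h * 4 ^ b"
    define s where "s = real (card (S (b + h)))"
    define t where "t = real (card (T b))"
    have w: "0 < w" "D < 4 * w" using True by (auto simp: w_def)
    have st: "0 \<le> s" "0 \<le> t" by (auto simp: s_def t_def)
    have "(\<Sum>(i, j)\<in>S (b + h) \<times> T b. A i j) \<le> 24 * (p * s * t + g h * t + 4 ^ h * g h * s)"
      using disc h level_set_sub[of n k "b + h"] level_set_sub[of n l b]
      unfolding discrepancy_bound_def H_def g_def s_def t_def S T D by auto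
    then have "?L \<le> (4 * w) * (24 * (p * s * t + g h * t + 4 ^ h * g h * s))"
      using True w unfolding w_def by (simp add: mult_left_mono)
    also have "\<dots> = 24 * ((4 * w) * (p * s * t) + 4 * w * (g h * t) + 4 * w * (4 ^ h * g h * s))"
      by (simp add: algebra_simps)
    also have "(4 * w) * (p * s * t) \<le> (16 * w\<^sup>2 / D) * (p * s * t)"
    proof (intro mult_right_mono)
      have "4 * w * D \<le> 4 * w * (4 * w)" using w by (intro mult_left_mono) auto
      then show "4 * w \<le> 16 * w\<^sup>2 / D" using D0 by (simp add: field_simps power2_eq_square)
    qed (use np st in auto)
    also have "w\<^sup>2 = 4 ^ (b + h) * 4 ^ b"
    proof -
      have "((2::real) ^ h)\<^sup>2 = 4 ^ h" by (simp add: power2_eq_square flip: power_mult_distrib)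
      then show ?thesis by (simp add: w_def power_mult_distrib power_add power2_eq_square)
    qed
    finally show ?thesis
      by (simp add: s_def t_def w_def \<alpha>_def \<beta>_def power_add algebra_simps)
  next
    case False
    have "0 \<le> ?R" using D0 np g0 by (intro mult_nonneg_nonneg add_nonneg_nonneg) (auto simp: \<alpha>_def \<beta>_def)
    then show ?thesis using False by simp
  qed
  have "(\<Sum>h\<in>H. \<Sum>b<N. ?c h b *
     (\<Sum>(i, j)\<in>S (b + h) \<times> T b. A i j))
    \<le> (\<Sum>h\<in>H. \<Sum>b<N. 24 * (16 * p / D * (\<alpha> (b + h) * \<beta> b)
       + 4 * (2 ^ h * g h) * \<beta> b
       + 4 * (2 ^ h * g h) * \<alpha> (b + h)))"
    by (intro sum_mono summand)
  also have "\<dots> = 24 * (16 * p / D * (\<Sum>h\<in>H. \<Sum>b<N. \<alpha> (b + h) * \<beta> b)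
       + (\<Sum>h\<in>H. 4 * (2 ^ h * g h) * (\<Sum>b<N. \<beta> b))
       + (\<Sum>h\<in>H. 4 * (2 ^ h * g h) * (\<Sum>b<N. \<alpha> (b + h))))"
    by (simp only: sum_distrib_left[symmetric] sum.distrib)
  also have "\<dots> \<le> 24 * (16 * p / D * ((4 * n) * (4 * n))
       + (\<Sum>h\<in>H. 4 * (2 ^ h * g h) * (4 * n)) + (\<Sum>h\<in>H. 4 * (2 ^ h * g h) * (4 * n)))"
  proof (intro mult_left_mono add_mono sum_mono)
    have "(\<Sum>h\<in>H. \<Sum>b<N. \<alpha> (b + h) * \<beta> b)
       = (\<Sum>b<N. (\<Sum>h\<in>H. \<alpha> (b + h)) * \<beta> b)"
      by (subst sum.swap) (simp only: sum_distrib_right)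
    also have "\<dots> \<le> (\<Sum>b<N. (4 * n) * \<beta> b)"
      using sumS' by (intro sum_mono mult_right_mono) (auto simp: \<beta>_def)
    also have "\<dots> = (4 * n) * (\<Sum>b<N. \<beta> b)" by (simp only: sum_distrib_left)
    also have "\<dots> \<le> real (4 * n) * real (4 * n)" using sumT by (intro mult_left_mono) auto
    finally show "(\<Sum>h\<in>H. \<Sum>b<N. \<alpha> (b + h) * \<beta> b) \<le> real ((4 * n) * (4 * n))"
      by simp
  qed (use sumT sumS g0 np D0 in auto)
  also have "\<dots> = 24 * (256 * n * (n * p / D) + 32 * n * (\<Sum>h\<in>H. 2 ^ h * g h))"
    by (simp only: sum_distrib_left[symmetric] sum_distrib_right[symmetric]) (simp add: algebra_simps)
  also have "\<dots> \<le> 24 * (256 * n * (n * p / D) + 32 * n * (5 * D))"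
    using sum_ratio_budget(2)[OF D0(1)] unfolding H_def g_def
    by (intro mult_left_mono add_left_mono) auto
  also have "n * p / D = D" using D0 by (simp add: field_simps power2_eq_square)
  also have "24 * (256 * n * D + 32 * n * (5 * D)) = 9984 * real n * D" by simp
  finally show ?thesis unfolding H_def .
qed

text \<open>Two regimes. If k_i \<ge> D l_j, the product is at most k_i^2 / D and the degree of i
  suffices; this is where large degrees would do harm. Otherwise the pair lies in a level block with
  2^h < 2 D, covered by the discrepancy bound.\<close>

lemma heavy_half_le:
  fixes A :: "nat \<Rightarrow> nat \<Rightarrow> real" and k l :: "nat \<Rightarrow> nat" and p c D :: real
  assumes A: "\<And>i j. 0 \<le> A i j" and disc: "discrepancy_bound n p A" and np: "0 < n" "0 < p"
    and k: "(\<Sum>i<n. (real (k i))\<^sup>2) \<le> 4 * n" and l: "(\<Sum>i<n. (real (l i))\<^sup>2) \<le> 4 * n"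
    and c: "0 \<le> c" and deg: "\<And>i. i < n \<Longrightarrow> k i \<noteq> 0 \<Longrightarrow> (\<Sum>j<n. A i j) \<le> c * (n * p)"
    and D: "D = sqrt (n * p)"
  shows "(\<Sum>i<n. \<Sum>j<n. of_bool (D < k i * l j \<and> l j \<le> k i) * real (k i * l j) * A i j) \<le> (4 * c + 9984) * real n * D"
proof -
  define S where "S = level_set n k"
  define T where "T = level_set n l"
  define H where "H = {h::nat. 2 ^ h < 2 * D}"
  \<comment> \<open>All levels of \<open>l\<close> lie below \<open>N\<close>, since b \<le> l_j
    \<le> l_j^2 \<le> 4 n.\<close>
  define N where "N = 4 * n + 1"
  have D0: "0 < D" "D\<^sup>2 = n * p" using np by (auto simp: D)
  have finH: "finite H" unfolding H_def by (rule sum_ratio_budget[OF D0(1)])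
  let ?c = "\<lambda>h b. of_bool (D < 4 * (2 ^ h * 4 ^ b)) * (4 * (2 ^ h * 4 ^ b)) :: real"
  define W where "W i j = (\<Sum>h\<in>H. \<Sum>b<N. ?c h b *
      (of_bool (i \<in> S (b + h) \<and> j \<in> T b) * A i j))" for i j
  have W0: "0 \<le> W i j" for i j
    unfolding W_def using A by (intro sum_nonneg mult_nonneg_nonneg) auto
  have summand: "of_bool (D < k i * l j \<and> l j \<le> k i) * real (k i * l j) * A i j \<le> (real (k i))\<^sup>2 / D * A i j + W i j"
    if ij: "i < n" "j < n" for i j
  proof (cases "D < k i * l j \<and> l j \<le> k i")
    case heavy: True
    then have pos: "0 < k i" "0 < l j" using D0 by (auto intro!: gr0I)
    show ?thesis
    proof (cases "D * l j \<le> k i")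
      case True
      then have "real (l j) \<le> k i / D" using D0 by (simp add: field_simps)
      then have "k i * real (l j) \<le> k i * (k i / D)" by (intro mult_left_mono) auto
      then have "k i * l j * A i j \<le> (real (k i))\<^sup>2 / D * A i j"
        using A[of i j] by (intro mult_right_mono) (auto simp: power2_eq_square)
      then show ?thesis using heavy W0[of i j] by simp
    next
      case False
      obtain a where a: "2 ^ a \<le> k i" "k i < 2 ^ Suc a" using level_exists[OF pos(1)] by auto
      obtain b where b: "b \<le> l j" "2 ^ b \<le> l j" "l j < 2 ^ Suc b" using level_exists[OF pos(2)] by auto
      have ar: "2 ^ a \<le> real (k i)" "real (k i) \<le> 2 * 2 ^ a"
        using a of_nat_mono[OF a(1), where 'a = real] of_nat_mono[OF less_imp_le[OF a(2)], where 'a = real] by auto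
      have br: "2 ^ b \<le> real (l j)" "real (l j) \<le> 2 * 2 ^ b"
        using b of_nat_mono[OF b(2), where 'a = real] of_nat_mono[OF less_imp_le[OF b(3)], where 'a = real] by auto
      have "2 ^ b < (2::nat) ^ Suc a" using a b heavy by linarith
      then have "b \<le> a" by (simp only: power_strict_increasing_iff less_Suc_eq_le)
      then obtain h where h: "a = b + h" by (auto simp: le_iff_add)
      have "(l j)\<^sup>2 \<le> 4 * n"
      proof -
        have "(real (l j))\<^sup>2 \<le> (\<Sum>i<n. (real (l i))\<^sup>2)" using ij by (intro member_le_sum) auto
        then have "real ((l j)\<^sup>2) \<le> real (4 * n)" using l by simp
        then show ?thesis unfolding of_nat_le_iff .
      qed
      moreover have "l j \<le> (l j)\<^sup>2" using pos by (intro self_le_power) auto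
      ultimately have bN: "b < N" using b by (simp add: N_def)
      have "2 ^ (b + h) < D * (2 * 2 ^ b)"
        using ar(1) br(2) False D0 mult_left_mono[OF br(2), of D] unfolding h by linarith
      then have hH: "h \<in> H" by (simp add: H_def power_add)
      have kl: "k i * real (l j) \<le> 4 * (2 ^ h * 4 ^ b)"
      proof -
        have "k i * real (l j) \<le> (2 * 2 ^ a) * (2 * 2 ^ b)" using ar br by (intro mult_mono) auto
        also have "\<dots> = 4 * (2 ^ h * 4 ^ b)"
          unfolding h by (simp add: power_add mult.assoc flip: power_mult_distrib)
        finally show ?thesis .
      qed
      define F where "F = (\<lambda>h b. ?c h b *
        (of_bool (i \<in> S (b + h) \<and> j \<in> T b) * A i j))"
      have F0: "0 \<le> F h b" for h b unfolding F_def using A by (intro mult_nonneg_nonneg) auto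
      have mem: "i \<in> S (b + h)" "j \<in> T b"
        using a b ij by (auto simp: S_def T_def level_set_def h)
      have "k i * l j * A i j \<le> 4 * (2 ^ h * 4 ^ b) * A i j"
        using kl A[of i j] by (intro mult_right_mono) auto
      also have "\<dots> = F h b" using kl heavy mem by (simp add: F_def)
      also have "\<dots> \<le> (\<Sum>b<N. F h b)" using bN F0 by (intro member_le_sum) auto
      also have "\<dots> \<le> (\<Sum>h\<in>H. \<Sum>b<N. F h b)"
        using hH finH F0 by (intro member_le_sum[of h]) (auto intro: sum_nonneg)
      also have "\<dots> = W i j" by (simp add: W_def F_def)
      finally have "k i * l j * A i j \<le> W i j" .
      moreover have "0 \<le> (real (k i))\<^sup>2 / D * A i j" using A[of i j] D0 by simp
      ultimately show ?thesis using heavy by simp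
    qed
  next
    case False
    then show ?thesis using W0[of i j] A[of i j] D0 by (auto intro!: add_nonneg_nonneg)
  qed
  have W: "(\<Sum>i<n. \<Sum>j<n. W i j) \<le> 9984 * real n * D"
  proof -
    have st: "(\<Sum>i<n. \<Sum>j<n. of_bool (i \<in> S a \<and> j \<in> T b) * A i j) = (\<Sum>(i, j)\<in>S a \<times> T b. A i j)" for a b
    proof -
      have "(\<Sum>i<n. \<Sum>j<n. of_bool (i \<in> S a \<and> j \<in> T b) * A i j)
         = (\<Sum>(i, j)\<in>{..<n} \<times> {..<n}. of_bool (i \<in> S a \<and> j \<in> T b) * A i j)"
        by (rule sum.cartesian_product)
      also have "\<dots> = (\<Sum>(i, j)\<in>S a \<times> T b. A i j)"
        using level_set_sub[of n k a] level_set_sub[of n l b]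
        by (intro sum.mono_neutral_cong_right) (auto simp: S_def T_def)
      finally show ?thesis .
    qed
    have "(\<Sum>i<n. \<Sum>j<n. W i j) = (\<Sum>h\<in>H. \<Sum>b<N. ?c h b *
      (\<Sum>i<n. \<Sum>j<n. of_bool (i \<in> S (b + h) \<and> j \<in> T b) * A i j))"
    proof -
      have "(\<Sum>i<n. \<Sum>j<n. W i j) = (\<Sum>i<n. \<Sum>h\<in>H. \<Sum>j<n. \<Sum>b<N. ?c h b *
         (of_bool (i \<in> S (b + h) \<and> j \<in> T b) * A i j))"
        unfolding W_def by (intro sum.cong[OF refl] sum.swap)
      also have "\<dots> = (\<Sum>i<n. \<Sum>h\<in>H. \<Sum>b<N. \<Sum>j<n. ?c h b *
         (of_bool (i \<in> S (b + h) \<and> j \<in> T b) * A i j))"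
        by (intro sum.cong[OF refl] sum.swap)
      also have "\<dots> = (\<Sum>h\<in>H. \<Sum>i<n. \<Sum>b<N. \<Sum>j<n. ?c h b *
         (of_bool (i \<in> S (b + h) \<and> j \<in> T b) * A i j))"
        by (rule sum.swap)
      also have "\<dots> = (\<Sum>h\<in>H. \<Sum>b<N. \<Sum>i<n. \<Sum>j<n. ?c h b *
         (of_bool (i \<in> S (b + h) \<and> j \<in> T b) * A i j))"
        by (intro sum.cong[OF refl] sum.swap)
      finally show ?thesis by (simp only: sum_distrib_left)
    qed
    also have "\<dots> \<le> 9984 * real n * D"
      unfolding st H_def by (rule sum_level_blocks_le[OF A disc np k l D S_def T_def])
    finally show ?thesis .
  qed
  have "(\<Sum>i<n. \<Sum>j<n. of_bool (D < k i * l j \<and> l j \<le> k i) * real (k i * l j) * A i j)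
     \<le> (\<Sum>i<n. \<Sum>j<n. (real (k i))\<^sup>2 / D * A i j + W i j)"
    by (intro sum_mono summand) auto
  also have "\<dots> = (\<Sum>i<n. (real (k i))\<^sup>2 / D * (\<Sum>j<n. A i j)) + (\<Sum>i<n. \<Sum>j<n. W i j)"
    by (simp only: sum.distrib sum_distrib_left)
  also have "(\<Sum>i<n. (real (k i))\<^sup>2 / D * (\<Sum>j<n. A i j)) \<le> (\<Sum>i<n. (real (k i))\<^sup>2 / D * (c * (n * p)))"
  proof (intro sum_mono)
    fix i assume "i \<in> {..<n}"
    then show "(real (k i))\<^sup>2 / D * (\<Sum>j<n. A i j) \<le> (real (k i))\<^sup>2 / D * (c * (n * p))"
      using deg[of i] D0 by (cases "k i = 0") (auto intro!: mult_left_mono divide_right_mono)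
  qed
  also have "\<dots> = (\<Sum>i<n. (real (k i))\<^sup>2) * (c * (n * p / D))"
    by (simp add: sum_distrib_right sum_divide_distrib)
  also have "n * p / D = D" using D0 by (simp add: field_simps power2_eq_square)
  also have "(\<Sum>i<n. (real (k i))\<^sup>2) * (c * D) \<le> (4 * n) * (c * D)"
    using k c D0 by (intro mult_right_mono) auto
  finally show ?thesis using W by (simp add: algebra_simps)
qed

section \<open>The spectral bound\<close>

lemma int_ball_nat:
  assumes "k \<in> int_ball n"
  shows "(\<Sum>i<n. (real (nat \<bar>k i\<bar>))\<^sup>2) \<le> 4 * real n"
  using int_ball_real[OF assms] by simp

text \<open>For a heavy pair of size w, the entry of A goes to \<open>R\<close> or \<open>R'\<close>
  according to which coordinate is larger, and its mean costs p w \<le> p w^2 / D. The constant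
  collects 42 for light pairs, 2 (4 c + 9984) for the two halves and 16 for the means.\<close>

lemma bilinear_le_on_int_ball:
  fixes A P :: "nat \<Rightarrow> nat \<Rightarrow> real" and p c :: real
  assumes A: "\<And>i j. 0 \<le> A i j" "\<And>i j. A i j = A j i" and P: "\<And>i j. P i j \<in> {0..p}"
    and np: "0 < n" "0 < p" and c: "0 \<le> c"
    and light: "light_bound n P p A" and disc: "discrepancy_bound n p A"
    and kl: "k \<in> int_ball n" "l \<in> int_ball n"
    and deg: "\<And>i. i < n \<Longrightarrow> k i \<noteq> 0 \<or> l i \<noteq> 0 \<Longrightarrow> (\<Sum>j<n. A i j) \<le> c * (n * p)"
  shows "(\<Sum>i<n. \<Sum>j<n. real_of_int (k i * l j) * (A i j - P i j)) \<le> (8 * c + 20026) * real n * sqrt (n * p)"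
proof -
  define D where "D = sqrt (n * p)"
  have D0: "0 < D" "D\<^sup>2 = n * p" using np by (auto simp: D_def)
  define x where "x i = nat \<bar>k i\<bar>" for i
  define y where "y i = nat \<bar>l i\<bar>" for i
  have xy: "\<bar>real_of_int (k i * l j)\<bar> = real (x i * y j)" for i j
    by (simp add: x_def y_def abs_mult)
  define R where "R i j = of_bool (D < real (x i * y j) \<and> y j \<le> x i) * real (x i * y j) * A i j" for i j
  define R' where "R' i j = of_bool (D < real (y i * x j) \<and> x j \<le> y i) * real (y i * x j) * A i j" for i j
  have xs: "(\<Sum>i<n. (real (x i))\<^sup>2) \<le> 4 * real n" "(\<Sum>i<n. (real (y i))\<^sup>2) \<le> 4 * real n"
    unfolding x_def y_def by (rule int_ball_nat[OF kl(1)], rule int_ball_nat[OF kl(2)])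
  have R: "(\<Sum>i<n. \<Sum>j<n. R i j) \<le> (4 * c + 9984) * real n * D"
    unfolding R_def by (rule heavy_half_le[OF A(1) disc np xs c _ D_def]) (use deg in \<open>auto simp: x_def\<close>)
  have R': "(\<Sum>i<n. \<Sum>j<n. R' i j) \<le> (4 * c + 9984) * real n * D"
    unfolding R'_def by (rule heavy_half_le[OF A(1) disc np xs(2) xs(1) c _ D_def]) (use deg in \<open>auto simp: y_def\<close>)
  have summand: "real_of_int (k i * l j) * (A i j - P i j)
     \<le> of_bool (\<bar>real_of_int (k i * l j)\<bar> \<le> D) * real_of_int (k i * l j) * (A i j - P i j)
       + (R i j + R' j i) + p / D * ((real (x i))\<^sup>2 * (real (y j))\<^sup>2)" for i j
  proof (cases "\<bar>real_of_int (k i * l j)\<bar> \<le> D")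
    case True
    have "0 \<le> R i j" "0 \<le> R' j i" using A by (auto simp: R_def R'_def)
    then show ?thesis using True D0 np by simp
  next
    case False
    define w where "w = real (x i * y j)"
    have w2: "\<bar>real_of_int (k i * l j)\<bar> = w" unfolding w_def by (rule xy)
    then have w: "D < w" "\<bar>real_of_int (k i * l j)\<bar> = w" using False by linarith+
    have "real_of_int (k i * l j) * (A i j - P i j) \<le> \<bar>real_of_int (k i * l j)\<bar> * \<bar>A i j - P i j\<bar>"
      by (metis abs_ge_self abs_mult)
    also have "\<dots> \<le> w * (A i j + p)"
      unfolding w(2) using w D0 A(1)[of i j] P[of i j] by (intro mult_left_mono) auto
    also have "\<dots> = w * A i j + p * w" by (simp add: algebra_simps)
    also have "w * A i j \<le> R i j + R' j i"
    proof (cases "y j \<le> x i")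
      case True
      have "0 \<le> R' j i" using A by (simp add: R'_def)
      then show ?thesis using True w by (simp add: R_def w_def)
    next
      case False
      have "0 \<le> R i j" using A by (simp add: R_def)
      then show ?thesis using False w by (simp add: R'_def w_def A(2)[of j i] mult.commute)
    qed
    also have "p * w \<le> p / D * ((real (x i))\<^sup>2 * (real (y j))\<^sup>2)"
    proof -
      have "w * D \<le> w * w" using w D0 by (intro mult_left_mono) auto
      then have "p * (w * D) \<le> p * (w * w)" by (rule mult_left_mono) (use np in simp)
      then have "p * w \<le> p / D * w\<^sup>2" using D0 by (simp add: field_simps power2_eq_square)
      then show ?thesis by (simp add: w_def power_mult_distrib)
    qed
    finally show ?thesis using False by simp
  qed
  have "(\<Sum>i<n. \<Sum>j<n. real_of_int (k i * l j) * (A i j - P i j))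
    \<le> (\<Sum>i<n. \<Sum>j<n. of_bool (\<bar>real_of_int (k i * l j)\<bar> \<le> D) * real_of_int (k i * l j) * (A i j - P i j)
       + (R i j + R' j i) + p / D * ((real (x i))\<^sup>2 * (real (y j))\<^sup>2))"
    by (intro sum_mono summand)
  also have "\<dots> = (\<Sum>i<n. \<Sum>j<n. of_bool (\<bar>real_of_int (k i * l j)\<bar> \<le> D) * real_of_int (k i * l j) * (A i j - P i j))
     + ((\<Sum>i<n. \<Sum>j<n. R i j) + (\<Sum>i<n. \<Sum>j<n. R' j i))
     + p / D * ((\<Sum>i<n. (real (x i))\<^sup>2) * (\<Sum>j<n. (real (y j))\<^sup>2))"
    unfolding sum_product by (simp only: sum.distrib sum_distrib_left)
  also have "(\<Sum>i<n. \<Sum>j<n. R' j i) = (\<Sum>i<n. \<Sum>j<n. R' i j)" by (rule sum.swap)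
  also have "(\<Sum>i<n. \<Sum>j<n. of_bool (\<bar>real_of_int (k i * l j)\<bar> \<le> D) * real_of_int (k i * l j) * (A i j - P i j)) \<le> 42 * real n * D"
    using light kl unfolding light_bound_def D_def by (auto intro: less_imp_le)
  also have "p / D * ((\<Sum>i<n. (real (x i))\<^sup>2) * (\<Sum>j<n. (real (y j))\<^sup>2)) \<le> p / D * ((4 * real n) * (4 * real n))"
    using xs np D0 by (intro mult_left_mono mult_mono) (auto intro: sum_nonneg)
  also have "p / D * ((4 * real n) * (4 * real n)) = 16 * real n * (n * p / D)" by simp
  also have "n * p / D = D" using D0 by (simp add: field_simps power2_eq_square)
  finally have "(\<Sum>i<n. \<Sum>j<n. real_of_int (k i * l j) * (A i j - P i j))
     \<le> 42 * real n * D + ((4 * c + 9984) * real n * D + (4 * c + 9984) * real n * D) + 16 * real n * D"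
    using R R' by linarith
  also have "\<dots> = (8 * c + 20026) * real n * D" by (simp add: algebra_simps)
  finally show ?thesis unfolding D_def .
qed

text \<open>Ceiling or floor is chosen by the sign of the coefficient. Zero coordinates stay zero,
  so a vector that avoids the vertices of high degree still does after rounding.\<close>

lemma round_to_int_ball:
  fixes v c :: "nat \<Rightarrow> real"
  assumes "(\<Sum>i<n. (v i)\<^sup>2) \<le> n"
  obtains k where "k \<in> int_ball n" "\<And>i. i < n \<Longrightarrow> v i = 0 \<Longrightarrow> k i = 0"
    "(\<Sum>i<n. v i * c i) \<le> (\<Sum>i<n. real_of_int (k i) * c i)"
proof -
  define k where "k = restrict (\<lambda>i. if 0 \<le> c i then \<lceil>v i\<rceil> else \<lfloor>v i\<rfloor>) {..<n}"
  have k: "\<bar>real_of_int (k i)\<bar> \<le> \<bar>v i\<bar> + 1" "v i * c i \<le> real_of_int (k i) * c i" "v i = 0 \<Longrightarrow> k i = 0"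
    if "i < n" for i
  proof -
    have "real_of_int \<lceil>v i\<rceil> < v i + 1" "v i \<le> real_of_int \<lceil>v i\<rceil>"
      "real_of_int \<lfloor>v i\<rfloor> \<le> v i" "v i < real_of_int \<lfloor>v i\<rfloor> + 1"
      using ceiling_correct[of "v i"] by linarith+
    then have "\<bar>real_of_int \<lceil>v i\<rceil>\<bar> \<le> \<bar>v i\<bar> + 1" "\<bar>real_of_int \<lfloor>v i\<rfloor>\<bar> \<le> \<bar>v i\<bar> + 1" by linarith+
    with that show "\<bar>real_of_int (k i)\<bar> \<le> \<bar>v i\<bar> + 1" "v i * c i \<le> real_of_int (k i) * c i" "v i = 0 \<Longrightarrow> k i = 0"
      by (auto simp: k_def intro: mult_right_mono mult_right_mono_neg)
  qed
  have "(real_of_int (k i))\<^sup>2 \<le> 2 * (v i)\<^sup>2 + 2" if "i < n" for i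
  proof -
    have "(real_of_int (k i))\<^sup>2 \<le> (\<bar>v i\<bar> + 1)\<^sup>2"
      using k(1)[OF that] by (metis abs_ge_zero power2_abs power_mono)
    also have "\<dots> \<le> 2 * (v i)\<^sup>2 + 2"
      using sum_squares_bound[of "\<bar>v i\<bar>" 1] by (simp add: power2_sum)
    finally show ?thesis .
  qed
  then have "(\<Sum>i<n. (real_of_int (k i))\<^sup>2) \<le> (\<Sum>i<n. 2 * (v i)\<^sup>2 + 2)" by (intro sum_mono) auto
  also have "\<dots> \<le> 4 * n" using assms by (simp add: sum.distrib flip: sum_distrib_left)
  finally have "real_of_int (\<Sum>i<n. (k i)\<^sup>2) \<le> real_of_int (4 * int n)" by simp
  then have "(\<Sum>i<n. (k i)\<^sup>2) \<le> 4 * int n" unfolding of_int_le_iff .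
  then have "k \<in> int_ball n" by (auto simp: int_ball_def k_def)
  then show ?thesis using k by (intro that[of k] sum_mono) auto
qed

text \<open>Feige-Ofek bound for the centred adjacency matrix on the vertices of bounded degree. Since the
  form is bilinear, rounding each argument to one of the two neighbouring integers in the direction
  of the gradient only increases it, so the integer points need not form a fine net.\<close>

lemma quadratic_form_le:
  fixes A P :: "nat \<Rightarrow> nat \<Rightarrow> real" and p c :: real
  assumes A: "\<And>i j. 0 \<le> A i j" "\<And>i j. A i j = A j i" and P: "\<And>i j. P i j \<in> {0..p}"
    and np: "0 < n" "0 < p" and c: "0 \<le> c"
    and light: "light_bound n P p A" and disc: "discrepancy_bound n p A"
    and deg: "\<And>i. i < n \<Longrightarrow> u i \<noteq> 0 \<Longrightarrow> (\<Sum>j<n. A i j) \<le> c * (n * p)"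
  shows "(\<Sum>i<n. \<Sum>j<n. u i * u j * (A i j - P i j)) \<le> (8 * c + 20026) * sqrt (n * p) * (\<Sum>i<n. (u i)\<^sup>2)"
proof -
  define q where "q = (\<Sum>i<n. (u i)\<^sup>2)"
  define M where "M i j = A i j - P i j" for i j
  have q0: "0 \<le> q" by (auto simp: q_def intro: sum_nonneg)
  show ?thesis
  proof (cases "q = 0")
    case True
    then have "u i = 0" if "i < n" for i
      using that by (auto simp: q_def sum_nonneg_eq_0_iff)
    then show ?thesis using True by (simp add: q_def)
  next
    case False
    \<comment> \<open>Scaling to squared norm n, the size at which rounding to integers stays inside
      \<open>int_ball\<close>.\<close>
    define s where "s = sqrt (n / q)"
    have s: "0 < s" "s\<^sup>2 = n / q" using False q0 np by (auto simp: s_def)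
    define v where "v i = s * u i" for i
    have vn: "(\<Sum>i<n. (v i)\<^sup>2) \<le> n"
    proof -
      have "(\<Sum>i<n. (v i)\<^sup>2) = n / q * q"
        unfolding q_def v_def power_mult_distrib s(2)[unfolded q_def] by (rule sum_distrib_left[symmetric])
      then show ?thesis using False by simp
    qed
    obtain k where k: "k \<in> int_ball n" "\<And>i. i < n \<Longrightarrow> v i = 0 \<Longrightarrow> k i = 0"
      "(\<Sum>i<n. v i * (\<Sum>j<n. M i j * v j)) \<le> (\<Sum>i<n. real_of_int (k i) * (\<Sum>j<n. M i j * v j))"
      by (rule round_to_int_ball[OF vn, of "\<lambda>i. \<Sum>j<n. M i j * v j"]) (rule that)
    \<comment> \<open>The second argument is rounded against the already rounded first one, so that
      both end up integral.\<close>
    obtain l where l: "l \<in> int_ball n" "\<And>i. i < n \<Longrightarrow> v i = 0 \<Longrightarrow> l i = 0"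
      "(\<Sum>j<n. v j * (\<Sum>i<n. M i j * real_of_int (k i))) \<le> (\<Sum>j<n. real_of_int (l j) * (\<Sum>i<n. M i j * real_of_int (k i)))"
      by (rule round_to_int_ball[OF vn, of "\<lambda>j. \<Sum>i<n. M i j * real_of_int (k i)"]) (rule that)
    have "(\<Sum>i<n. \<Sum>j<n. v i * v j * M i j) = (\<Sum>i<n. v i * (\<Sum>j<n. M i j * v j))"
      by (simp add: sum_distrib_left algebra_simps)
    also note k(3)
    also have "(\<Sum>i<n. real_of_int (k i) * (\<Sum>j<n. M i j * v j)) = (\<Sum>i<n. \<Sum>j<n. v j * (M i j * real_of_int (k i)))"
      by (simp add: sum_distrib_left algebra_simps)
    also have "\<dots> = (\<Sum>j<n. \<Sum>i<n. v j * (M i j * real_of_int (k i)))" by (rule sum.swap)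
    also have "\<dots> = (\<Sum>j<n. v j * (\<Sum>i<n. M i j * real_of_int (k i)))" by (simp add: sum_distrib_left)
    also note l(3)
    also have "(\<Sum>j<n. real_of_int (l j) * (\<Sum>i<n. M i j * real_of_int (k i)))
       = (\<Sum>j<n. \<Sum>i<n. real_of_int (k i * l j) * M i j)"
      by (simp add: sum_distrib_left algebra_simps)
    also have "\<dots> = (\<Sum>i<n. \<Sum>j<n. real_of_int (k i * l j) * (A i j - P i j))"
      unfolding M_def by (rule sum.swap)
    also have "\<dots> \<le> (8 * c + 20026) * real n * sqrt (n * p)"
    proof (rule bilinear_le_on_int_ball[OF A P np c light disc k(1) l(1)])
      fix i assume "i < n" "k i \<noteq> 0 \<or> l i \<noteq> 0"
      then have "u i \<noteq> 0" using k(2)[of i] l(2)[of i] by (auto simp: v_def)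
      then show "(\<Sum>j<n. A i j) \<le> c * (n * p)" using deg \<open>i < n\<close> by blast
    qed
    finally have "s\<^sup>2 * (\<Sum>i<n. \<Sum>j<n. u i * u j * M i j) \<le> (8 * c + 20026) * real n * sqrt (n * p)"
      by (simp add: v_def sum_distrib_left power2_eq_square algebra_simps)
    moreover have "s\<^sup>2 * ((8 * c + 20026) * sqrt (n * p) * q) = (8 * c + 20026) * real n * sqrt (n * p)"
    proof -
      have sq: "s\<^sup>2 * q = n" using False by (simp add: s(2))
      have "s\<^sup>2 * ((8 * c + 20026) * sqrt (n * p) * q) = (8 * c + 20026) * (s\<^sup>2 * q) * sqrt (n * p)"
        by (simp only: mult_ac)
      then show ?thesis unfolding sq .
    qed
    ultimately have "s\<^sup>2 * (\<Sum>i<n. \<Sum>j<n. u i * u j * M i j) \<le> s\<^sup>2 * ((8 * c + 20026) * sqrt (n * p) * q)"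
      by (simp only:)
    then have "(\<Sum>i<n. \<Sum>j<n. u i * u j * M i j) \<le> (8 * c + 20026) * sqrt (n * p) * q"
      using s(1) by (simp add: mult_le_cancel_left_pos)
    then show ?thesis by (simp add: M_def q_def)
  qed
qed

section \<open>The semidefinite relaxation\<close>

lemma sum_lessThan_Suc_pairs:
  fixes f :: "nat \<Rightarrow> nat \<Rightarrow> real"
  assumes "\<And>i j. f i j = f j i"
  shows "(\<Sum>i<Suc n. \<Sum>j<Suc n. f i j) = (\<Sum>i<n. \<Sum>j<n. f i j) + 2 * (\<Sum>i<n. f i n) + f n n"
proof -
  have "(\<Sum>j<n. f n j) = (\<Sum>i<n. f i n)" by (intro sum.cong refl assms)
  then show ?thesis by (simp add: sum.distrib)
qed

text \<open>Cholesky factorization: eliminate the last index, factor the Schur complement by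
  induction, and use the new coordinate for the pivot column. A zero pivot is harmless: its column
  vanishes, and division by zero makes \<open>v\<close> zero too.\<close>

lemma psd_gram:
  fixes Y :: "nat \<Rightarrow> nat \<Rightarrow> real"
  assumes "\<And>i j. Y i j = Y j i" and "\<And>x. 0 \<le> (\<Sum>i<n. \<Sum>j<n. x i * x j * Y i j)"
  shows "\<exists>w. \<forall>i<n. \<forall>j<n. Y i j = (\<Sum>k<n. w k i * w k j)"
  using assms
proof (induction n arbitrary: Y)
  case (Suc n)
  note sym = Suc.prems(1) and psd = Suc.prems(2)
  have form: "(\<Sum>i<Suc n. \<Sum>j<Suc n. x i * x j * Y i j)
      = (\<Sum>i<n. \<Sum>j<n. x i * x j * Y i j) + 2 * (x n * (\<Sum>i<n. x i * Y i n)) + (x n)\<^sup>2 * Y n n" for x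
    by (subst sum_lessThan_Suc_pairs) (auto simp: sym mult_ac sum_distrib_left power2_eq_square)
  have c0: "0 \<le> Y n n"
    using psd[of "\<lambda>i. of_bool (i = n)"] unfolding form by simp
  have zero: "Y i n = 0" if "Y n n = 0" "i < n" for i
  proof (rule ccontr)
    assume nz: "Y i n \<noteq> 0"
    \<comment> \<open>With a zero pivot the form at \<open>?x\<close> is Y_ii + 2 t Y_in, and this
      \<open>t\<close> makes it -1.\<close>
    define t where "t = - (Y i i + 1) / (2 * Y i n)"
    let ?x = "\<lambda>j. if j = n then t else of_bool (j = i)"
    have "(\<Sum>j<n. \<Sum>k<n. ?x j * ?x k * Y j k) = (\<Sum>j<n. \<Sum>k<n. if k = i then (if j = i then Y i i else 0) else 0)"
      by (intro sum.cong refl) auto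
    then have "(\<Sum>j<n. \<Sum>k<n. ?x j * ?x k * Y j k) = Y i i"
      using that(2) by simp
    moreover have "(\<Sum>j<n. ?x j * Y j n) = (\<Sum>j<n. if j = i then Y i n else 0)"
      by (intro sum.cong refl) auto
    then have "(\<Sum>j<n. ?x j * Y j n) = Y i n"
      using that(2) by simp
    ultimately have "0 \<le> Y i i + 2 * (t * Y i n)"
      using psd[of ?x] that unfolding form by simp
    then show False using nz by (simp add: t_def field_simps)
  qed
  define v where "v i = Y i n / sqrt (Y n n)" for i
  have vv: "v i * v j = Y i n * Y j n / Y n n" for i j
    using c0 by (simp add: v_def)
  have "\<exists>w. \<forall>i<n. \<forall>j<n. Y i j - v i * v j = (\<Sum>k<n. w k i * w k j)"
  proof (rule Suc.IH)
    show "Y i j - v i * v j = Y j i - v j * v i" for i j by (simp add: sym mult.commute)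
    fix x :: "nat \<Rightarrow> real"
    define s where "s = (\<Sum>i<n. x i * Y i n)"
    let ?y = "\<lambda>i. if i = n then - s / Y n n else x i"
    have "0 \<le> (\<Sum>i<n. \<Sum>j<n. x i * x j * Y i j) + 2 * (- s / Y n n * s) + (- s / Y n n)\<^sup>2 * Y n n"
      using psd[of ?y] unfolding form by (simp add: s_def)
    moreover have "2 * (- s / Y n n * s) + (- s / Y n n)\<^sup>2 * Y n n = - (s\<^sup>2 / Y n n)"
      by (cases "Y n n = 0") (auto simp: field_simps power2_eq_square)
    ultimately have "0 \<le> (\<Sum>i<n. \<Sum>j<n. x i * x j * Y i j) - s\<^sup>2 / Y n n" by linarith
    also have "s\<^sup>2 / Y n n = (\<Sum>i<n. \<Sum>j<n. x i * x j * (v i * v j))"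
      by (simp add: s_def power2_eq_square sum_product sum_divide_distrib vv mult_ac)
    finally show "0 \<le> (\<Sum>i<n. \<Sum>j<n. x i * x j * (Y i j - v i * v j))"
      by (simp add: right_diff_distrib sum_subtractf)
  qed
  then obtain w where w: "\<And>i j. i < n \<Longrightarrow> j < n \<Longrightarrow> Y i j - v i * v j = (\<Sum>k<n. w k i * w k j)" by blast
  define w' where "w' k i = (if k = n then v i else if i = n then 0 else w k i)" for k i
  have vn: "v n * v i = Y n i" if "i < Suc n" for i
    using zero[of i] that c0 by (cases "Y n n = 0"; cases "i = n") (auto simp: vv sym[of n i])
  have "Y i j = (\<Sum>k<Suc n. w' k i * w' k j)" if "i < Suc n" "j < Suc n" for i j
  proof (cases "i = n \<or> j = n")
    case True
    then have "(\<Sum>k<n. w' k i * w' k j) = 0" by (intro sum.neutral) (auto simp: w'_def)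
    then show ?thesis using True vn that sym[of i n] by (auto simp: w'_def mult.commute)
  next
    case False
    then have "(\<Sum>k<n. w' k i * w' k j) = (\<Sum>k<n. w k i * w k j)" by (intro sum.cong) (auto simp: w'_def)
    then show ?thesis using w[of i j] that False by (simp add: w'_def)
  qed
  then show ?case by blast
qed simp

text \<open>The columns of \<open>x\<close> are the centred rows of a Gram factor of the conjugated matrix \<open>R\<close>, so that
  \<open>\<Sum>k. x k i * x k j\<close> is the projection of \<open>R\<close> orthogonal to the constant vector.\<close>

lemma sdp_centered_gram:
  fixes Y :: "nat \<Rightarrow> nat \<Rightarrow> real" and s :: "nat \<Rightarrow> real"
  assumes n: "0 < n" and s: "\<And>i. i < n \<Longrightarrow> s i * s i = 1" and bal: "(\<Sum>i<n. s i) = 0"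
    and sym: "\<And>i j. Y i j = Y j i" and psd: "\<And>x. 0 \<le> (\<Sum>i<n. \<Sum>j<n. x i * x j * Y i j)"
    and diag: "\<And>i. i < n \<Longrightarrow> Y i i = 1" and total: "(\<Sum>i<n. \<Sum>j<n. Y i j) = 0"
  obtains x :: "nat \<Rightarrow> nat \<Rightarrow> real" where
    "\<And>i j. i < n \<Longrightarrow> j < n \<Longrightarrow> (\<Sum>k<n. (x k i - x k j)\<^sup>2) = 2 - 2 * (s i * s j * Y i j)"
    "\<And>i. i < n \<Longrightarrow> (\<Sum>k<n. (x k i)\<^sup>2) \<le> 4"
    "(\<Sum>i<n. \<Sum>k<n. (x k i)\<^sup>2) = (\<Sum>i<n. \<Sum>j<n. 1 - s i * s j * Y i j) / n"
    "\<And>k. k < n \<Longrightarrow> (\<Sum>i<n. x k i) = 0" "\<And>k. k < n \<Longrightarrow> (\<Sum>i<n. s i * x k i) = 0"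
    "\<And>i j. i < n \<Longrightarrow> j < n \<Longrightarrow> \<bar>s i * s j * Y i j\<bar> \<le> 1"
proof -
  obtain w where w: "\<And>i j. i < n \<Longrightarrow> j < n \<Longrightarrow> Y i j = (\<Sum>k<n. w k i * w k j)"
    using psd_gram[OF sym psd] by blast
  define z where "z k i = s i * w k i" for k i
  define m where "m k = (\<Sum>i<n. z k i) / n" for k
  define x where "x k i = z k i - m k" for k i
  have R: "(\<Sum>k<n. z k i * z k j) = s i * s j * Y i j" if "i < n" "j < n" for i j
    by (simp add: w[OF that] z_def sum_distrib_left mult_ac)
  have z1: "(\<Sum>k<n. (z k i)\<^sup>2) = 1" if "i < n" for i
    using R[OF that that] s[OF that] diag[OF that] by (simp add: power2_eq_square)
  have zz: "(\<Sum>k<n. (z k i - z k j)\<^sup>2) = 2 - 2 * (s i * s j * Y i j)" if "i < n" "j < n" for i j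
    using z1[OF that(1)] z1[OF that(2)] R[OF that]
    by (simp add: power2_diff sum.distrib sum_subtractf mult.assoc flip: sum_distrib_left)
  have zz': "(\<Sum>k<n. (z k i + z k j)\<^sup>2) = 2 + 2 * (s i * s j * Y i j)" if "i < n" "j < n" for i j
    using z1[OF that(1)] z1[OF that(2)] R[OF that]
    by (simp add: power2_sum sum.distrib mult.assoc flip: sum_distrib_left)
  have R1: "\<bar>s i * s j * Y i j\<bar> \<le> 1" if "i < n" "j < n" for i j
  proof -
    have "0 \<le> (\<Sum>k<n. (z k i - z k j)\<^sup>2)" "0 \<le> (\<Sum>k<n. (z k i + z k j)\<^sup>2)" by (auto intro: sum_nonneg)
    then show ?thesis unfolding zz[OF that] zz'[OF that] by linarith
  qed
  have sumx: "(\<Sum>i<n. x k i) = 0" for k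
    using n by (simp add: x_def sum_subtractf m_def)
  have "(\<Sum>k<n. (\<Sum>i<n. w k i)\<^sup>2) = (\<Sum>i<n. \<Sum>j<n. Y i j)"
  proof -
    have "(\<Sum>k<n. (\<Sum>i<n. w k i)\<^sup>2) = (\<Sum>k<n. \<Sum>i<n. \<Sum>j<n. w k i * w k j)"
      by (simp add: power2_eq_square sum_product)
    also have "\<dots> = (\<Sum>i<n. \<Sum>k<n. \<Sum>j<n. w k i * w k j)" by (rule sum.swap)
    also have "\<dots> = (\<Sum>i<n. \<Sum>j<n. \<Sum>k<n. w k i * w k j)" by (intro sum.cong refl sum.swap)
    also have "\<dots> = (\<Sum>i<n. \<Sum>j<n. Y i j)" by (intro sum.cong refl) (simp add: w)
    finally show ?thesis .
  qed
  \<comment> \<open>The total of Y is the squared length of the sum of its Gram vectors, so that sum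
    vanishes. Conjugation turns this into orthogonality to the labels.\<close>
  then have w0: "(\<Sum>i<n. w k i) = 0" if "k < n" for k
    using that total by (simp add: sum_nonneg_eq_0_iff)
  have sumsx: "(\<Sum>i<n. s i * x k i) = 0" if "k < n" for k
  proof -
    have "s i * x k i = w k i - m k * s i" if "i < n" for i
      using s[OF that] by (simp add: x_def z_def right_diff_distrib flip: mult.assoc)
    then have "(\<Sum>i<n. s i * x k i) = (\<Sum>i<n. w k i - m k * s i)" by (intro sum.cong) auto
    then show ?thesis using w0[OF that] bal by (simp add: sum_subtractf flip: sum_distrib_left)
  qed
  have b4: "(\<Sum>k<n. (x k i)\<^sup>2) \<le> 4" if i: "i < n" for i
  proof -
    \<comment> \<open>A centred vector is the mean of its differences to all Gram vectors, each of
      squared length at most 4; a squared mean is at most the mean of the squares.\<close>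
    have "(x k i)\<^sup>2 \<le> (\<Sum>j<n. (z k i - z k j)\<^sup>2) / n" for k
    proof -
      have "x k i = (\<Sum>j<n. z k i - z k j) / n"
        using n by (simp add: x_def m_def sum_subtractf field_simps)
      then have "(x k i)\<^sup>2 = (\<Sum>j<n. z k i - z k j)\<^sup>2 / (real n)\<^sup>2" by (simp add: power_divide)
      also have "\<dots> \<le> (real n * (\<Sum>j<n. (z k i - z k j)\<^sup>2)) / (real n)\<^sup>2"
        using sum_squared_le_sum_of_squares[of "\<lambda>j. z k i - z k j" "{..<n}"]
        by (intro divide_right_mono) (auto simp: mult.commute)
      finally show ?thesis using n by (simp add: power2_eq_square)
    qed
    then have "(\<Sum>k<n. (x k i)\<^sup>2) \<le> (\<Sum>k<n. (\<Sum>j<n. (z k i - z k j)\<^sup>2) / n)" by (intro sum_mono)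
    also have "\<dots> = (\<Sum>j<n. \<Sum>k<n. (z k i - z k j)\<^sup>2) / n"
      by (subst sum.swap) (simp add: sum_divide_distrib)
    also have "\<dots> \<le> (\<Sum>j<n. 4) / n"
    proof (intro divide_right_mono sum_mono)
      fix j assume "j \<in> {..<n}"
      then have "\<bar>s i * s j * Y i j\<bar> \<le> 1" using R1[OF i] by simp
      then show "(\<Sum>k<n. (z k i - z k j)\<^sup>2) \<le> 4"
        using zz[OF i] \<open>j \<in> {..<n}\<close> by (simp add: abs_le_iff)
    qed simp
    finally show ?thesis using n by simp
  qed
  have "(\<Sum>i<n. \<Sum>k<n. (x k i)\<^sup>2) = (\<Sum>i<n. \<Sum>j<n. 1 - s i * s j * Y i j) / n"
  proof -
    have "(\<Sum>i<n. (x k i)\<^sup>2) = (\<Sum>i<n. (z k i)\<^sup>2) - (\<Sum>i<n. \<Sum>j<n. z k i * z k j) / n" for k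
    proof -
      have "(\<Sum>i<n. (x k i)\<^sup>2) = (\<Sum>i<n. (z k i)\<^sup>2) - 2 * m k * (\<Sum>i<n. z k i) + n * (m k)\<^sup>2"
        by (simp add: x_def power2_diff sum.distrib sum_subtractf sum_distrib_left mult_ac)
      also have "\<dots> = (\<Sum>i<n. (z k i)\<^sup>2) - (\<Sum>i<n. z k i)\<^sup>2 / n"
        using n by (simp add: m_def field_simps power2_eq_square)
      finally show ?thesis by (simp add: power2_eq_square sum_product)
    qed
    then have "(\<Sum>k<n. \<Sum>i<n. (x k i)\<^sup>2) = (\<Sum>k<n. \<Sum>i<n. (z k i)\<^sup>2) - (\<Sum>k<n. \<Sum>i<n. \<Sum>j<n. z k i * z k j) / n"
      by (simp add: sum_subtractf sum_divide_distrib)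
    also have "(\<Sum>k<n. \<Sum>i<n. (z k i)\<^sup>2) = (\<Sum>i<n. \<Sum>k<n. (z k i)\<^sup>2)" by (rule sum.swap)
    also have "\<dots> = n" using z1 by simp
    also have "(\<Sum>k<n. \<Sum>i<n. \<Sum>j<n. z k i * z k j) = (\<Sum>i<n. \<Sum>k<n. \<Sum>j<n. z k i * z k j)" by (rule sum.swap)
    also have "\<dots> = (\<Sum>i<n. \<Sum>j<n. \<Sum>k<n. z k i * z k j)" by (intro sum.cong refl sum.swap)
    also have "\<dots> = (\<Sum>i<n. \<Sum>j<n. s i * s j * Y i j)" by (intro sum.cong refl) (simp add: R)
    also have "n - (\<Sum>i<n. \<Sum>j<n. s i * s j * Y i j) / n = (\<Sum>i<n. \<Sum>j<n. 1 - s i * s j * Y i j) / n"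
      using n by (simp add: sum_subtractf field_simps)
    finally show ?thesis by (subst sum.swap) simp
  qed
  then show ?thesis
    using zz b4 sumx sumsx R1 by (intro that[of x]) (auto simp: x_def)
qed

text \<open>Optimality is expanded by 2 - 2 R_ij = b_i + b_j - 2 X_ij. Dropping the pairs that meet
  \<open>H\<close> costs 8 W before the inequality is halved, and putting them back on the left
  costs another 8 W, hence the factor 12. The term in (card H)^2 repairs the orthogonality
  relations, which deletion of \<open>H\<close> destroys.\<close>

lemma weighted_degree_sum_le:
  fixes A :: "nat \<Rightarrow> nat \<Rightarrow> real" and s :: "nat \<Rightarrow> real" and x :: "nat \<Rightarrow> nat \<Rightarrow> real" and p q \<kappa> :: real
  assumes s: "\<And>i. i < n \<Longrightarrow> s i * s i = 1"
    and A: "\<And>i j. 0 \<le> A i j" "\<And>i j. A i j = A j i" and pq: "0 \<le> q" "q \<le> p"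
    and x: "\<And>i j. i < n \<Longrightarrow> j < n \<Longrightarrow> (\<Sum>k<n. (x k i - x k j)\<^sup>2) = 2 - 2 * R i j"
    and b4: "\<And>i. i < n \<Longrightarrow> (\<Sum>k<n. (x k i)\<^sup>2) \<le> 4"
    and x0: "\<And>k. k < n \<Longrightarrow> (\<Sum>i<n. x k i) = 0" "\<And>k. k < n \<Longrightarrow> (\<Sum>i<n. s i * x k i) = 0"
    and R1: "\<And>i j. i < n \<Longrightarrow> j < n \<Longrightarrow> \<bar>R i j\<bar> \<le> 1"
    and opt: "(\<Sum>i<n. \<Sum>j<n. A i j * (s i * s j) * (1 - R i j)) \<le> 0"
    and H: "H \<subseteq> {..<n}"
    and form: "\<And>u. (\<And>i. i \<in> H \<Longrightarrow> u i = 0) \<Longrightarrow>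
      (\<Sum>i<n. \<Sum>j<n. u i * u j * (A i j - ((p + q) / 2 + (p - q) / 2 * (s i * s j)))) \<le> \<kappa> * (\<Sum>i<n. (u i)\<^sup>2)"
    and \<kappa>: "0 \<le> \<kappa>"
  shows "(\<Sum>i<n. (\<Sum>j<n. A i j * (s i * s j)) * (\<Sum>k<n. (x k i)\<^sup>2))
    \<le> \<kappa> * (\<Sum>i<n. \<Sum>k<n. (x k i)\<^sup>2) + 12 * (\<Sum>i\<in>H. \<Sum>j<n. A i j) + 4 * p * (real (card H))\<^sup>2"
proof -
  define a where "a i j = A i j * (s i * s j)" for i j
  define b where "b i = (\<Sum>k<n. (x k i)\<^sup>2)" for i
  define X where "X i j = (\<Sum>k<n. x k i * x k j)" for i j
  define g where "g i = (of_bool (i \<notin> H) :: real)" for i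
  define W where "W = (\<Sum>i\<in>H. \<Sum>j<n. A i j)"
  have s1: "\<bar>s i\<bar> = 1" if "i < n" for i
    using s[OF that] by (metis abs_mult_self_eq abs_of_nonneg abs_1 abs_ge_zero mult_cancel_right1 power2_eq_iff_nonneg power2_eq_square zero_le_one mult_1)
  have asym: "a i j = a j i" for i j by (simp add: a_def A(2)[of i j] mult.commute)
  have aA: "\<bar>a i j\<bar> = A i j" if "i < n" "j < n" for i j
    using s1 that A(1)[of i j] by (simp add: a_def abs_mult)
  have b0: "0 \<le> b i" for i by (auto simp: b_def intro: sum_nonneg)
  have bX: "b i + b j - 2 * X i j = 2 - 2 * R i j" if "i < n" "j < n" for i j
    unfolding x[OF that, symmetric]
    by (simp add: b_def X_def power2_diff sum.distrib sum_subtractf sum_distrib_left mult.assoc)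
  have W1: "(\<Sum>i<n. \<Sum>j<n. A i j * (1 - g i)) = W"
  proof -
    have "(\<Sum>i<n. \<Sum>j<n. A i j * (1 - g i)) = (\<Sum>i\<in>H. \<Sum>j<n. A i j)"
      using H by (intro sum.mono_neutral_cong_right) (auto simp: g_def)
    then show ?thesis by (simp add: W_def)
  qed
  have W2: "(\<Sum>i<n. \<Sum>j<n. A i j * (1 - g j)) = W"
    by (subst sum.swap) (use W1 in \<open>simp add: A(2)\<close>)
  have W3: "(\<Sum>i<n. \<Sum>j<n. 4 * (A i j * (1 - g i) + A i j * (1 - g j))) = 8 * W"
    using W1 W2 by (simp add: sum.distrib flip: sum_distrib_left)
  have step1: "(\<Sum>i<n. \<Sum>j<n. g i * g j * a i j * (2 - 2 * R i j)) \<le> 8 * W"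
  proof -
    have "(\<Sum>i<n. \<Sum>j<n. g i * g j * a i j * (2 - 2 * R i j))
      \<le> (\<Sum>i<n. \<Sum>j<n. 2 * (a i j * (1 - R i j)) + 4 * (A i j * (1 - g i) + A i j * (1 - g j)))"
    proof (intro sum_mono)
      fix i j assume "i \<in> {..<n}" "j \<in> {..<n}"
      then have ij: "i < n" "j < n" by auto
      have "\<bar>a i j * (2 - 2 * R i j)\<bar> \<le> A i j * 4"
        unfolding abs_mult aA[OF ij] using R1[OF ij] A(1) by (intro mult_left_mono) auto
      then have "- (a i j * (2 - 2 * R i j)) \<le> 4 * A i j" by linarith
      then show "g i * g j * a i j * (2 - 2 * R i j) \<le> 2 * (a i j * (1 - R i j)) + 4 * (A i j * (1 - g i) + A i j * (1 - g j))"
        using A(1)[of i j] by (auto simp: g_def algebra_simps)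
    qed
    also have "\<dots> = 2 * (\<Sum>i<n. \<Sum>j<n. a i j * (1 - R i j)) + 8 * W"
      using W3 by (simp add: sum.distrib flip: sum_distrib_left)
    finally show ?thesis using opt by (simp add: a_def)
  qed
  have step2: "(\<Sum>i<n. \<Sum>j<n. g i * g j * a i j * (2 - 2 * R i j))
     = 2 * (\<Sum>i<n. \<Sum>j<n. g i * g j * a i j * b i) - 2 * (\<Sum>i<n. \<Sum>j<n. g i * g j * a i j * X i j)"
  proof -
    have "(\<Sum>i<n. \<Sum>j<n. g i * g j * a i j * (2 - 2 * R i j))
       = (\<Sum>i<n. \<Sum>j<n. g i * g j * a i j * b i + g i * g j * a i j * b j - 2 * (g i * g j * a i j * X i j))"
    proof (intro sum.cong refl)
      fix i j assume "i \<in> {..<n}" "j \<in> {..<n}"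
      then have eq: "2 - 2 * R i j = b i + b j - 2 * X i j" using bX by simp
      show "g i * g j * a i j * (2 - 2 * R i j) = g i * g j * a i j * b i + g i * g j * a i j * b j - 2 * (g i * g j * a i j * X i j)"
        unfolding eq by (simp add: algebra_simps)
    qed
    also have "\<dots> = (\<Sum>i<n. \<Sum>j<n. g i * g j * a i j * b i) + (\<Sum>i<n. \<Sum>j<n. g i * g j * a i j * b j)
       - 2 * (\<Sum>i<n. \<Sum>j<n. g i * g j * a i j * X i j)"
      by (simp add: sum.distrib sum_subtractf sum_distrib_left)
    also have "(\<Sum>i<n. \<Sum>j<n. g i * g j * a i j * b j) = (\<Sum>j<n. \<Sum>i<n. g i * g j * a i j * b j)" by (rule sum.swap)
    also have "\<dots> = (\<Sum>i<n. \<Sum>j<n. g i * g j * a i j * b i)"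
      by (intro sum.cong refl) (simp add: asym mult_ac)
    finally show ?thesis by simp
  qed
  have step3: "(\<Sum>i<n. (\<Sum>j<n. a i j) * b i) \<le> (\<Sum>i<n. \<Sum>j<n. g i * g j * a i j * b i) + 8 * W"
  proof -
    have "(\<Sum>i<n. (\<Sum>j<n. a i j) * b i) \<le> (\<Sum>i<n. \<Sum>j<n. g i * g j * a i j * b i + 4 * (A i j * (1 - g i) + A i j * (1 - g j)))"
      unfolding sum_distrib_right
    proof (intro sum_mono)
      fix i j assume "i \<in> {..<n}" "j \<in> {..<n}"
      then have ij: "i < n" "j < n" by auto
      have "\<bar>a i j * b i\<bar> \<le> A i j * 4"
        unfolding abs_mult aA[OF ij] using b4[OF ij(1)] b0[of i] A(1) by (intro mult_left_mono) (auto simp: b_def)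
      then have "a i j * b i \<le> 4 * A i j" by linarith
      then show "a i j * b i \<le> g i * g j * a i j * b i + 4 * (A i j * (1 - g i) + A i j * (1 - g j))"
        using A(1)[of i j] by (auto simp: g_def)
    qed
    also have "\<dots> = (\<Sum>i<n. \<Sum>j<n. g i * g j * a i j * b i) + 8 * W"
      using W3 by (simp add: sum.distrib)
    finally show ?thesis .
  qed
  have step4: "(\<Sum>i<n. \<Sum>j<n. g i * g j * a i j * X i j) \<le> \<kappa> * (\<Sum>i<n. b i) + 4 * p * (real (card H))\<^sup>2"
  proof -
    define u where "u k i = s i * (g i * x k i)" for k i
    have finH: "finite H" using H by (rule finite_subset) simp
    \<comment> \<open>The full sum vanishes, so the truncated one is minus the sum over
      \<open>H\<close>, and Cauchy-Schwarz gives the factor |H|.\<close>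
    have small: "(\<Sum>i<n. t i * (g i * x k i))\<^sup>2 \<le> card H * (\<Sum>i\<in>H. (x k i)\<^sup>2)"
      if t: "(\<Sum>i<n. t i * x k i) = 0" "\<And>i. i < n \<Longrightarrow> t i * t i = 1" for t :: "nat \<Rightarrow> real" and k
    proof -
      have "(\<Sum>i<n. t i * (g i * x k i)) = (\<Sum>i<n. t i * x k i) - (\<Sum>i<n. t i * ((1 - g i) * x k i))"
        by (simp add: algebra_simps flip: sum_subtractf)
      also have "(\<Sum>i<n. t i * ((1 - g i) * x k i)) = (\<Sum>i\<in>H. t i * x k i)"
        using H by (intro sum.mono_neutral_cong_right) (auto simp: g_def)
      finally have "(\<Sum>i<n. t i * (g i * x k i))\<^sup>2 = (\<Sum>i\<in>H. t i * x k i)\<^sup>2" using t by simp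
      also have "\<dots> \<le> card H * (\<Sum>i\<in>H. (t i * x k i)\<^sup>2)"
        using sum_squared_le_sum_of_squares[of "\<lambda>i. t i * x k i" H] finH by (auto simp: mult.commute)
      also have "(\<Sum>i\<in>H. (t i * x k i)\<^sup>2) = (\<Sum>i\<in>H. (x k i)\<^sup>2)"
      proof (intro sum.cong refl)
        fix i assume "i \<in> H"
        then have "t i * t i = 1" using H t(2) by auto
        then show "(t i * x k i)\<^sup>2 = (x k i)\<^sup>2" by (simp add: power_mult_distrib power2_eq_square)
      qed
      finally show ?thesis .
    qed
    have per_k: "(\<Sum>i<n. \<Sum>j<n. u k i * u k j * A i j) \<le> \<kappa> * (\<Sum>i<n. (x k i)\<^sup>2) + p * (card H * (\<Sum>i\<in>H. (x k i)\<^sup>2))"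
      if k: "k < n" for k
    proof -
      define S0 where "S0 = (\<Sum>i<n. u k i)"
      define S1 where "S1 = (\<Sum>i<n. 1 * (g i * x k i))"
      have S1: "(\<Sum>i<n. u k i * s i) = S1"
        unfolding S1_def
      proof (intro sum.cong refl)
        fix i assume "i \<in> {..<n}"
        then have "s i * s i = 1" using s by simp
        then show "u k i * s i = 1 * (g i * x k i)" unfolding u_def by (metis mult.commute mult.assoc mult_1)
      qed
      \<comment> \<open>The mean matrix contributes the squares of the two truncated sums, with
        coefficients adding up to p.\<close>
      have "(\<Sum>i<n. \<Sum>j<n. u k i * u k j * A i j)
        = (\<Sum>i<n. \<Sum>j<n. u k i * u k j * (A i j - ((p + q) / 2 + (p - q) / 2 * (s i * s j)))
             + (p + q) / 2 * (u k i * u k j) + (p - q) / 2 * ((u k i * s i) * (u k j * s j)))"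
        by (intro sum.cong refl) (simp add: algebra_simps)
      also have "\<dots> = (\<Sum>i<n. \<Sum>j<n. u k i * u k j * (A i j - ((p + q) / 2 + (p - q) / 2 * (s i * s j))))
          + (p + q) / 2 * S0\<^sup>2 + (p - q) / 2 * S1\<^sup>2"
        unfolding S1[symmetric] S0_def power2_eq_square sum_product by (simp only: sum.distrib sum_distrib_left)
      also have "\<dots> \<le> \<kappa> * (\<Sum>i<n. (u k i)\<^sup>2) + (p + q) / 2 * (card H * (\<Sum>i\<in>H. (x k i)\<^sup>2)) + (p - q) / 2 * (card H * (\<Sum>i\<in>H. (x k i)\<^sup>2))"
      proof (intro add_mono mult_left_mono form)
        show "S0\<^sup>2 \<le> card H * (\<Sum>i\<in>H. (x k i)\<^sup>2)"
          unfolding S0_def u_def using x0(2)[OF k] s by (intro small) auto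
        show "S1\<^sup>2 \<le> card H * (\<Sum>i\<in>H. (x k i)\<^sup>2)"
          unfolding S1_def using x0(1)[OF k] by (intro small) auto
      qed (use pq in \<open>auto simp: u_def g_def\<close>)
      also have "(\<Sum>i<n. (u k i)\<^sup>2) \<le> (\<Sum>i<n. (x k i)\<^sup>2)"
      proof (intro sum_mono)
        fix i assume "i \<in> {..<n}"
        then have "s i * s i = 1" using s by simp
        then have "(u k i)\<^sup>2 = (g i * x k i)\<^sup>2" by (simp add: u_def power_mult_distrib power2_eq_square)
        then show "(u k i)\<^sup>2 \<le> (x k i)\<^sup>2" by (simp add: g_def)
      qed
      also have "\<kappa> * (\<Sum>i<n. (x k i)\<^sup>2) + (p + q) / 2 * (card H * (\<Sum>i\<in>H. (x k i)\<^sup>2)) + (p - q) / 2 * (card H * (\<Sum>i\<in>H. (x k i)\<^sup>2))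
         = \<kappa> * (\<Sum>i<n. (x k i)\<^sup>2) + p * (card H * (\<Sum>i\<in>H. (x k i)\<^sup>2))"
        by (simp add: field_simps)
      finally show ?thesis using \<kappa> by (auto intro: mult_left_mono)
    qed
    have "(\<Sum>i<n. \<Sum>j<n. g i * g j * a i j * X i j) = (\<Sum>i<n. \<Sum>j<n. \<Sum>k<n. u k i * u k j * A i j)"
      by (simp add: X_def a_def u_def sum_distrib_left mult_ac)
    also have "\<dots> = (\<Sum>i<n. \<Sum>k<n. \<Sum>j<n. u k i * u k j * A i j)" by (intro sum.cong refl sum.swap)
    also have "\<dots> = (\<Sum>k<n. \<Sum>i<n. \<Sum>j<n. u k i * u k j * A i j)" by (rule sum.swap)
    also have "\<dots> \<le> (\<Sum>k<n. \<kappa> * (\<Sum>i<n. (x k i)\<^sup>2) + p * (card H * (\<Sum>i\<in>H. (x k i)\<^sup>2)))"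
      by (intro sum_mono per_k) auto
    also have "\<dots> = \<kappa> * (\<Sum>k<n. \<Sum>i<n. (x k i)\<^sup>2) + p * (card H * (\<Sum>k<n. \<Sum>i\<in>H. (x k i)\<^sup>2))"
      by (simp only: sum.distrib sum_distrib_left)
    also have "(\<Sum>k<n. \<Sum>i<n. (x k i)\<^sup>2) = (\<Sum>i<n. b i)" unfolding b_def by (rule sum.swap)
    also have "(\<Sum>k<n. \<Sum>i\<in>H. (x k i)\<^sup>2) = (\<Sum>i\<in>H. b i)" unfolding b_def by (rule sum.swap)
    also have "p * (card H * (\<Sum>i\<in>H. b i)) \<le> p * (card H * (\<Sum>i\<in>H. 4 :: real))"
    proof -
      have hb: "(\<Sum>i\<in>H. b i) \<le> (\<Sum>i\<in>H. 4)"
        using H b4 by (intro sum_mono) (auto simp: b_def)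
      show ?thesis by (intro mult_left_mono hb) (use pq in simp_all)
    qed
    finally show ?thesis by (simp add: power2_eq_square mult_ac)
  qed
  have "(\<Sum>i<n. (\<Sum>j<n. a i j) * b i) \<le> \<kappa> * (\<Sum>i<n. b i) + 12 * W + 4 * p * (real (card H))\<^sup>2"
    using step1 step2 step3 step4 by linarith
  then show ?thesis by (simp add: a_def b_def W_def)
qed

section \<open>Signed degrees\<close>

text \<open>2 (1 - v) is, up to normalization, the squared Hellinger distance of the two Bernoulli
  laws, and - ln v \<ge> 1 - v. The upper bound follows from v \<ge> 1 - p.\<close>

lemma sbm_snr_bounds:
  fixes p q c1 :: real
  assumes pq: "0 < q" "q < p" "p \<le> 1 - c1" and c1: "0 < c1"
  shows "(p - q)\<^sup>2 / (4 * p) \<le> sbm_snr p q" and "sbm_snr p q \<le> 2 * p / c1"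
proof -
  define v where "v = sqrt (p * q) + sqrt ((1 - p) * (1 - q))"
  have I: "sbm_snr p q = - 2 * ln v" by (simp add: sbm_snr_def v_def)
  have vlow: "1 - p \<le> v"
  proof -
    have "1 - p = sqrt ((1 - p) * (1 - p))" using pq c1 by simp
    also have "\<dots> \<le> sqrt ((1 - p) * (1 - q))" using pq c1 by (intro real_sqrt_le_mono mult_left_mono) auto
    also have "\<dots> \<le> v" using pq by (simp add: v_def)
    finally show ?thesis .
  qed
  have vpos: "0 < v" using vlow pq c1 by linarith
  have "(p - q)\<^sup>2 / (4 * p) \<le> (sqrt p - sqrt q)\<^sup>2"
  proof -
    have "p - q = (sqrt p - sqrt q) * (sqrt p + sqrt q)" using pq by (simp add: algebra_simps)
    then have "(p - q)\<^sup>2 = (sqrt p - sqrt q)\<^sup>2 * (sqrt p + sqrt q)\<^sup>2" by (simp add: power_mult_distrib)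
    also have "\<dots> \<le> (sqrt p - sqrt q)\<^sup>2 * (4 * p)"
    proof (intro mult_left_mono)
      have "(sqrt p + sqrt q)\<^sup>2 \<le> (sqrt p + sqrt p)\<^sup>2" using pq by (intro power_mono add_mono) auto
      also have "\<dots> = 4 * p" using pq by (simp add: power2_eq_square algebra_simps)
      finally show "(sqrt p + sqrt q)\<^sup>2 \<le> 4 * p" .
    qed auto
    finally show ?thesis using pq by (simp add: field_simps)
  qed
  also have "\<dots> \<le> (sqrt p - sqrt q)\<^sup>2 + (sqrt (1 - p) - sqrt (1 - q))\<^sup>2" by simp
  also have "\<dots> = 2 * (1 - v)"
    using pq c1 by (simp add: power2_diff v_def real_sqrt_mult)
  also have "\<dots> \<le> - 2 * ln v" using ln_le_minus_one[OF vpos] by simp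
  finally show "(p - q)\<^sup>2 / (4 * p) \<le> sbm_snr p q" by (simp add: I)
  have p1: "0 < 1 - p" using pq c1 by linarith
  have "sbm_snr p q \<le> 2 * ln (1 / (1 - p))"
    using vlow p1 vpos by (simp add: I ln_div)
  also have "\<dots> \<le> 2 * (1 / (1 - p) - 1)"
    using p1 by (intro mult_left_mono ln_le_minus_one) auto
  also have "\<dots> = 2 * p / (1 - p)" using p1 by (simp add: field_simps)
  also have "\<dots> \<le> 2 * p / c1" using pq c1 by (intro divide_left_mono) auto
  finally show "sbm_snr p q \<le> 2 * p / c1" .
qed

text \<open>The minimizer t of (1 - p + p exp (- t)) (1 - q + q exp t); the minimum is exp (- I) for
  I = \<open>sbm_snr p q\<close>.\<close>

definition chernoff_tilt :: "real \<Rightarrow> real \<Rightarrow> real" where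
  "chernoff_tilt p q = ln (p * (1 - q) / (q * (1 - p))) / 2"

text \<open>Moment of exp (- t m e X) for the entry X of a pair with label product \<open>e\<close>;
  off the diagonal, \<open>m\<close> will be the number of endpoints in the chosen vertex
  set.\<close>

definition edge_mgf :: "real \<Rightarrow> real \<Rightarrow> real \<Rightarrow> real \<Rightarrow> real" where
  "edge_mgf p q e m = (if e = 1 then 1 - p + p * exp (- chernoff_tilt p q * m) else 1 - q + q * exp (chernoff_tilt p q * m))"

text \<open>As q is comparable to p and p is bounded away from 1, the odds ratio exceeds 1 by only
  O((p - q) / p).\<close>

lemma chernoff_tilt_bounds:
  fixes p q c0 c1 :: real
  assumes c: "0 < c0" "0 < c1" and pq: "0 < p" "c0 * p \<le> q" "q < p" "p \<le> 1 - c1"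
  shows "0 < chernoff_tilt p q" "chernoff_tilt p q \<le> (p - q) / (c0 * c1 * p)"
    "exp (chernoff_tilt p q) - 1 \<le> (p - q) / (c0 * c1 * p)"
proof -
  define t where "t = chernoff_tilt p q"
  define r where "r = p * (1 - q) / (q * (1 - p))"
  have q: "0 < q" using c pq mult_pos_pos[of c0 p] by linarith
  have p1: "c1 \<le> 1 - p" "0 < 1 - p" using c pq by linarith+
  have r1: "r - 1 = (p - q) / (q * (1 - p))" using q p1 by (simp add: r_def field_simps)
  have "0 < r - 1" unfolding r1 using q p1 pq by simp
  then have r: "1 < r" by simp
  have t: "t = ln r / 2" by (simp add: t_def chernoff_tilt_def r_def)
  show t0: "0 < chernoff_tilt p q" using r by (simp add: t flip: t_def)
  have "r - 1 \<le> (p - q) / ((c0 * p) * c1)"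
    unfolding r1 using c pq p1 q by (intro divide_left_mono mult_mono) auto
  then have r2: "r - 1 \<le> (p - q) / (c0 * c1 * p)" by (simp add: mult_ac)
  have "ln r \<le> r - 1" using r by (intro ln_le_minus_one) auto
  then have "ln r / 2 \<le> r - 1" using r by linarith
  then show "chernoff_tilt p q \<le> (p - q) / (c0 * c1 * p)"
    unfolding t_def[symmetric] t using r2 by linarith
  have "t \<le> ln r" using t0 by (simp add: t flip: t_def)
  then have "exp t \<le> r" using r by (simp add: ln_ge_iff)
  then show "exp (chernoff_tilt p q) - 1 \<le> (p - q) / (c0 * c1 * p)"
    unfolding t_def[symmetric] using r2 by linarith
qed

lemma edge_mgf_prod:
  fixes p q :: real
  assumes "0 < q" "q < p" "p < 1"
  shows "ln (edge_mgf p q 1 1) + ln (edge_mgf p q (- 1) 1) = - sbm_snr p q"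
    and "0 < edge_mgf p q e m"
proof -
  define E where "E = exp (chernoff_tilt p q)"
  define a where "a = sqrt (p * q)"
  define b where "b = sqrt ((1 - p) * (1 - q))"
  have pos: "0 < p" "0 < 1 - p" "0 < 1 - q" using assms by auto
  have E0: "0 < E" by (simp add: E_def)
  have E2: "E\<^sup>2 = p * (1 - q) / (q * (1 - p))"
    using assms pos exp_of_nat_mult[of 2 "chernoff_tilt p q"] by (simp add: E_def chernoff_tilt_def)
  have ab: "0 < a" "0 < b" "a\<^sup>2 = p * q" "b\<^sup>2 = (1 - p) * (1 - q)" using assms pos by (auto simp: a_def b_def)
  have "((1 - p) * q * E)\<^sup>2 = (a * b)\<^sup>2"
    unfolding power_mult_distrib E2 ab using assms pos by (simp add: power2_eq_square field_simps)
  then have 1: "(1 - p) * q * E = a * b" by (rule power2_eq_imp_eq) (use assms pos E0 ab in auto)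
  have "(p * (1 - q) / E)\<^sup>2 = (a * b)\<^sup>2"
    unfolding power_mult_distrib power_divide E2 ab using assms pos by (simp add: power2_eq_square field_simps)
  then have 2: "p * (1 - q) / E = a * b" by (rule power2_eq_imp_eq) (use assms pos E0 ab in auto)
  have "edge_mgf p q 1 1 * edge_mgf p q (- 1) 1 = (1 - p + p / E) * (1 - q + q * E)"
    by (simp add: edge_mgf_def E_def exp_minus divide_inverse)
  also have "\<dots> = (1 - p) * (1 - q) + (1 - p) * q * E + p * (1 - q) / E + p * q"
    using E0 by (simp add: field_simps)
  also have "\<dots> = (a + b)\<^sup>2" unfolding 1 2 by (simp add: power2_sum ab)
  finally have prod: "edge_mgf p q 1 1 * edge_mgf p q (- 1) 1 = (a + b)\<^sup>2" .
  show pos': "0 < edge_mgf p q e m" for e m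
    using assms pos by (auto simp: edge_mgf_def intro!: add_pos_pos)
  have "ln (edge_mgf p q 1 1) + ln (edge_mgf p q (- 1) 1) = ln ((a + b)\<^sup>2)"
    using pos'[of 1 1] pos'[of "- 1" 1] by (simp add: prod[symmetric] ln_mult)
  also have "\<dots> = - sbm_snr p q" using ab by (simp add: ln_realpow sbm_snr_def a_def b_def)
  finally show "ln (edge_mgf p q 1 1) + ln (edge_mgf p q (- 1) 1) = - sbm_snr p q" .
qed

text \<open>Pairs inside the vertex set are counted twice; their second moment exceeds the squared first
  moment only by a variance, which is of the order of \<open>sbm_snr p q\<close>.\<close>

lemma edge_mgf_two_le:
  fixes p q c0 c1 :: real
  assumes c: "0 < c0" "0 < c1" and pq: "0 < p" "c0 * p \<le> q" "q < p" "p \<le> 1 - c1"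
  shows "edge_mgf p q e 2 \<le> exp (2 * ln (edge_mgf p q e 1) + 4 / (c0\<^sup>2 * c1 ^ 4) * sbm_snr p q)"
proof -
  define t where "t = chernoff_tilt p q"
  define \<delta> where "\<delta> = (p - q) / (c0 * c1 * p)"
  note tb = chernoff_tilt_bounds[OF c pq, folded t_def \<delta>_def]
  have q: "0 < q" using c pq mult_pos_pos[of c0 p] by linarith
  have p1: "c1 \<le> 1 - p" "0 < 1 - p" using c pq by linarith+
  have d: "p * \<delta>\<^sup>2 / c1\<^sup>2 \<le> 4 / (c0\<^sup>2 * c1 ^ 4) * sbm_snr p q"
  proof -
    have "p * \<delta>\<^sup>2 / c1\<^sup>2 = 4 / (c0\<^sup>2 * c1 ^ 4) * ((p - q)\<^sup>2 / (4 * p))"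
      using c pq by (simp add: \<delta>_def power_divide power_mult_distrib field_simps power_numeral_reduce)
    also have "\<dots> \<le> 4 / (c0\<^sup>2 * c1 ^ 4) * sbm_snr p q"
      using sbm_snr_bounds(1)[OF q pq(3,4) c(2)] c by (intro mult_left_mono) auto
    finally show ?thesis .
  qed
  have pos: "0 < edge_mgf p q e 1" using edge_mgf_prod(2)[OF q pq(3)] p1 by simp
  have c1': "c1 \<le> 1" using p1 pq by linarith
  have "\<exists>r y. 0 \<le> r \<and> r \<le> p \<and> 0 < y \<and> \<bar>y - 1\<bar> \<le> \<delta> \<and> c1 \<le> edge_mgf p q e 1 \<and>
     edge_mgf p q e 1 = 1 - r + r * y \<and> edge_mgf p q e 2 = 1 - r + r * y\<^sup>2"
  proof (cases "e = 1")
    case True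
    have "1 - t \<le> exp (- t)" using exp_ge_add_one_self[of "- t"] by simp
    moreover have "exp (- t) \<le> 1" using tb by simp
    ultimately have "\<bar>exp (- t) - 1\<bar> \<le> \<delta>" using tb by linarith
    moreover have "c1 \<le> 1 - p + p * exp (- t)"
    proof -
      have "0 \<le> p * exp (- t)" using pq by simp
      then show ?thesis using p1 by linarith
    qed
    moreover have "exp (- (t * 2)) = (exp (- t))\<^sup>2" by (simp flip: exp_double)
    ultimately show ?thesis using pq True
      by (intro exI[of _ p] exI[of _ "exp (- t)"]) (auto simp: edge_mgf_def t_def)
  next
    case False
    have "1 \<le> exp t" using tb by simp
    then have "\<bar>exp t - 1\<bar> \<le> \<delta>" "q * 1 \<le> q * exp t" using tb q by auto
    moreover from this(2) have "c1 \<le> 1 - q + q * exp t" using c1' by linarith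
    moreover have "exp (t * 2) = (exp t)\<^sup>2" by (simp flip: exp_double add: mult.commute)
    ultimately show ?thesis using pq False q c1'
      by - (rule exI[of _ q], rule exI[of _ "exp t"], auto simp: edge_mgf_def t_def)
  qed
  then obtain r y where r: "0 \<le> r" "r \<le> p" and y: "\<bar>y - 1\<bar> \<le> \<delta>"
    and f: "c1 \<le> edge_mgf p q e 1" "edge_mgf p q e 1 = 1 - r + r * y" "edge_mgf p q e 2 = 1 - r + r * y\<^sup>2" by blast
  define f1 where "f1 = edge_mgf p q e 1"
  \<comment> \<open>The last summand is the variance of a variable equal to y with probability r and
    to 1 otherwise. As f1 \<ge> c1, it becomes a factor 1 + O(I).\<close>
  have "edge_mgf p q e 2 = f1\<^sup>2 + r * (1 - r) * (y - 1)\<^sup>2"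
    by (simp add: f1_def f power2_eq_square algebra_simps)
  also have "r * (1 - r) * (y - 1)\<^sup>2 \<le> p * \<delta>\<^sup>2"
  proof (intro mult_mono)
    have "r * (1 - r) \<le> r * 1" using r by (intro mult_left_mono) auto
    then show "r * (1 - r) \<le> p" using r by simp
    show "(y - 1)\<^sup>2 \<le> \<delta>\<^sup>2" using power_mono[OF y, of 2] by simp
  qed (use r p1 pq in auto)
  also have "p * \<delta>\<^sup>2 \<le> f1\<^sup>2 * (p * \<delta>\<^sup>2 / c1\<^sup>2)"
  proof -
    have "c1\<^sup>2 \<le> f1\<^sup>2" using f c by (intro power_mono) (auto simp: f1_def)
    then have "c1\<^sup>2 * (p * \<delta>\<^sup>2 / c1\<^sup>2) \<le> f1\<^sup>2 * (p * \<delta>\<^sup>2 / c1\<^sup>2)" using pq by (intro mult_right_mono) auto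
    then show ?thesis using c by simp
  qed
  also have "f1\<^sup>2 + f1\<^sup>2 * (p * \<delta>\<^sup>2 / c1\<^sup>2) = f1\<^sup>2 * (1 + p * \<delta>\<^sup>2 / c1\<^sup>2)" by (simp add: algebra_simps)
  also have "\<dots> \<le> f1\<^sup>2 * exp (p * \<delta>\<^sup>2 / c1\<^sup>2)"
    using exp_ge_add_one_self[of "p * \<delta>\<^sup>2 / c1\<^sup>2"] by (intro mult_left_mono) auto
  also have "\<dots> \<le> f1\<^sup>2 * exp (4 / (c0\<^sup>2 * c1 ^ 4) * sbm_snr p q)"
    using d by (intro mult_left_mono) auto
  also have "f1\<^sup>2 = exp (2 * ln f1)" using pos by (simp add: f1_def exp_double)
  finally show ?thesis by (simp add: f1_def exp_add)
qed

definition signed_degree_bound :: "nat \<Rightarrow> (nat \<Rightarrow> real) \<Rightarrow> real \<Rightarrow> nat \<Rightarrow> (nat \<Rightarrow> nat \<Rightarrow> real) \<Rightarrow> bool" where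
  "signed_degree_bound n s \<tau> m A \<longleftrightarrow>
    (\<forall>M. M \<subseteq> {..<n} \<longrightarrow> card M = m \<longrightarrow> \<tau> * m < (\<Sum>i\<in>M. \<Sum>j<n. A i j * (s i * s j)))"

text \<open>By balance each row of the vertex set has n / 2 entries of either label product, so the
  optimal tilt gives exp (- n I / 2) per row. Pairs inside the set occur in two rows and cost an
  extra exp (O(I)) each, which is the term quadratic in \<open>m\<close>.\<close>

lemma prob_not_signed_degree_bound:
  fixes p q c0 c1 :: real
  assumes c: "0 < c0" "0 < c1" and pq: "0 < p" "c0 * p \<le> q" "q < p" "p \<le> 1 - c1"
    and m: "0 < m" "m \<le> n"
    and s: "\<And>i. i < n \<Longrightarrow> s i \<in> {- 1, 1}" and bal: "(\<Sum>i<n. s i) = 0"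
  shows "edge_prob n (\<lambda>i j. if s i * s j = 1 then p else q)
      {a. \<not> signed_degree_bound n s \<tau> m (sym_entry a)}
    \<le> exp (entropy n m + m * (chernoff_tilt p q * \<tau> - n / 2 * sbm_snr p q + 4 / (c0\<^sup>2 * c1 ^ 4) * sbm_snr p q * m))"
proof -
  define t where "t = chernoff_tilt p q"
  define I where "I = sbm_snr p q"
  define K where "K = 4 / (c0\<^sup>2 * c1 ^ 4)"
  define P where "P i j = (if s i * s j = 1 then p else q)" for i j
  define \<phi> where "\<phi> i j = ln (edge_mgf p q (s i * s j) 1)" for i j
  let ?B = "\<lambda>M. {a. (\<Sum>i\<in>M. \<Sum>j<n. sym_entry a i j * (s i * s j)) \<le> \<tau> * m}"
  have q: "0 < q" using c pq mult_pos_pos[of c0 p] by linarith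
  have p1: "p < 1" using c pq by linarith
  have t0: "0 < t" unfolding t_def by (rule chernoff_tilt_bounds[OF c pq])
  have I0: "0 \<le> I"
  proof -
    have "0 \<le> (p - q)\<^sup>2 / (4 * p)" using pq by simp
    also have "\<dots> \<le> I" unfolding I_def using sbm_snr_bounds(1)[OF q pq(3,4) c(2)] .
    finally show ?thesis .
  qed
  have KI: "0 \<le> K * I" using I0 c by (simp add: K_def)
  have phi_row: "(\<Sum>j<n. \<phi> i j) = - (n / 2 * I)" if i: "i < n" for i
  proof -
    define u where "u = ln (edge_mgf p q 1 1)"
    define v where "v = ln (edge_mgf p q (- 1) 1)"
    have uv: "u + v = - I" unfolding u_def v_def I_def by (rule edge_mgf_prod(1)[OF q pq(3) p1])
    \<comment> \<open>The two values of \<phi>, interpolated affinely in the label product, so that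
      balance cancels the linear part.\<close>
    have "\<phi> i j = (u + v) / 2 + (u - v) / 2 * s i * s j" if "j < n" for j
      using s[OF i] s[OF that] by (auto simp: \<phi>_def u_def v_def field_simps)
    then have "(\<Sum>j<n. \<phi> i j) = (\<Sum>j<n. (u + v) / 2 + (u - v) / 2 * s i * s j)" by (intro sum.cong) auto
    also have "\<dots> = n * ((u + v) / 2) + (\<Sum>j<n. (u - v) / 2 * s i * s j)" by (simp add: sum.distrib)
    also have "(\<Sum>j<n. (u - v) / 2 * s i * s j) = (u - v) / 2 * s i * (\<Sum>j<n. s j)"
      by (simp only: sum_distrib_left)
    finally show ?thesis using uv bal by simp
  qed
  have "{a. \<not> signed_degree_bound n s \<tau> m (sym_entry a)} = (\<Union>M\<in>{M. M \<subseteq> {..<n} \<and> card M = m}. ?B M)"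
    by (auto simp: signed_degree_bound_def not_less)
  also have "edge_prob n P \<dots> \<le> exp (entropy n m + m * (t * \<tau> - n / 2 * I + K * I * m))"
  proof (rule prob_UN_subsets_le[OF m])
    fix M assume M: "M \<subseteq> {..<n}" "card M = m"
    define \<chi> where "\<chi> i = (of_bool (i \<in> M) :: real)" for i
    define w where "w i j = - t * (\<chi> i * (s i * s j))" for i j
    \<comment> \<open>Arranged so that folding an off-diagonal pair gives \<phi> once per endpoint
      in \<open>M\<close>, plus 2 K I if both endpoints are in \<open>M\<close>.\<close>
    define \<psi> where "\<psi> i j = \<chi> i * \<phi> i j + K * I * (\<chi> i * \<chi> j)" for i j
    have sumM: "(\<Sum>i<n. \<chi> i * f i) = (\<Sum>i\<in>M. f i)" for f :: "nat \<Rightarrow> real"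
      using M by (intro sum.mono_neutral_cong_right) (auto simp: \<chi>_def)
    have ww: "(\<Sum>i<n. \<Sum>j<n. w i j * sym_entry a i j) = - t * (\<Sum>i\<in>M. \<Sum>j<n. sym_entry a i j * (s i * s j))" for a
    proof -
      have "(\<Sum>i<n. \<Sum>j<n. w i j * sym_entry a i j) = - t * (\<Sum>i<n. \<chi> i * (\<Sum>j<n. sym_entry a i j * (s i * s j)))"
        by (simp add: w_def sum_distrib_left mult_ac)
      then show ?thesis by (simp add: sumM)
    qed
    have "?B M = {a. - (t * \<tau> * m) \<le> (\<Sum>i<n. \<Sum>j<n. w i j * sym_entry a i j)}"
      unfolding ww using t0 by (simp add: mult.assoc)
    then have "edge_prob n P (?B M)
       \<le> exp (- (- (t * \<tau> * m))) * (\<Prod>e\<in>upper_pairs n. 1 - case_prod P e + case_prod P e * exp (fold_weight w e))"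
      using edge_pmf_chernoff[of P n "- (t * \<tau> * m)" w] q p1 pq by (simp add: P_def)
    also have "(\<Prod>e\<in>upper_pairs n. 1 - case_prod P e + case_prod P e * exp (fold_weight w e))
       \<le> (\<Prod>e\<in>upper_pairs n. exp (fold_weight \<psi> e))"
    proof (intro prod_mono conjI)
      fix e assume "e \<in> upper_pairs n"
      then obtain i j where e: "e = (i, j)" "i \<le> j" "j < n" by (auto simp: upper_pairs_def)
      have sij: "s i \<in> {- 1, 1}" "s j \<in> {- 1, 1}" using s e by auto
      show "0 \<le> 1 - case_prod P e + case_prod P e * exp (fold_weight w e)"
        using q p1 pq by (auto simp: e P_def)
      define k where "k = (if i = j then \<chi> i else \<chi> i + \<chi> j)"
      have mgf: "1 - case_prod P e + case_prod P e * exp (fold_weight w e) = edge_mgf p q (s i * s j) k"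
        using sij by (auto simp: e P_def fold_weight_def w_def edge_mgf_def k_def algebra_simps simp flip: t_def)
      have psi: "fold_weight \<psi> e = k * \<phi> i j + K * I * (if i = j then \<chi> i else 2 * (\<chi> i * \<chi> j))"
      proof (cases "i = j")
        case True
        have "\<chi> i * \<chi> i = \<chi> i" by (simp add: \<chi>_def)
        then show ?thesis using True by (simp add: e fold_weight_def \<psi>_def k_def)
      next
        case False
        have "\<phi> j i = \<phi> i j" by (simp add: \<phi>_def mult.commute)
        then show ?thesis using False by (simp add: e fold_weight_def \<psi>_def k_def algebra_simps)
      qed
      let ?R = "exp (k * \<phi> i j + K * I * (if i = j then \<chi> i else 2 * (\<chi> i * \<chi> j)))"
      have "k = 0 \<or> k = 1 \<or> (k = 2 \<and> i \<noteq> j \<and> \<chi> i * \<chi> j = 1)"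
        by (auto simp: k_def \<chi>_def)
      then show "1 - case_prod P e + case_prod P e * exp (fold_weight w e) \<le> exp (fold_weight \<psi> e)"
        unfolding mgf psi
      proof (elim disjE conjE)
        assume "k = 0"
        then show "edge_mgf p q (s i * s j) k \<le> ?R"
          using KI by (auto simp: edge_mgf_def \<chi>_def)
      next
        assume k: "k = 1"
        have "edge_mgf p q (s i * s j) k = exp (k * \<phi> i j)"
          using k edge_mgf_prod(2)[OF q pq(3) p1] by (simp add: \<phi>_def)
        also have "\<dots> \<le> ?R"
          using KI by (auto simp: \<chi>_def)
        finally show "edge_mgf p q (s i * s j) k \<le> ?R" .
      next
        assume k: "k = 2" "i \<noteq> j" "\<chi> i * \<chi> j = 1"
        have "edge_mgf p q (s i * s j) 2 \<le> exp (2 * \<phi> i j + K * I)"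
          unfolding \<phi>_def K_def I_def by (rule edge_mgf_two_le[OF c pq])
        also have "\<dots> \<le> ?R"
          using k KI by (simp add: mult.commute[of I])
        finally show "edge_mgf p q (s i * s j) k \<le> ?R"
          using k by simp
      qed
    qed
    also have "\<dots> = exp (\<Sum>i<n. \<Sum>j<n. \<psi> i j)"
      by (subst exp_sum[symmetric]) (simp_all only: sum_fold_weight finite_upper_pairs)
    also have "(\<Sum>i<n. \<Sum>j<n. \<psi> i j) = m * (- (n / 2 * I)) + K * I * (m * m)"
    proof -
      have "(\<Sum>i<n. \<Sum>j<n. \<psi> i j) = (\<Sum>i<n. \<chi> i * (\<Sum>j<n. \<phi> i j)) + K * I * (\<Sum>i<n. \<chi> i * (\<Sum>j<n. \<chi> j * 1))"
        by (simp add: \<psi>_def sum.distrib sum_distrib_left)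
      also have "\<dots> = (\<Sum>i\<in>M. \<Sum>j<n. \<phi> i j) + K * I * (m * m)" unfolding sumM using M by simp
      also have "(\<Sum>i\<in>M. \<Sum>j<n. \<phi> i j) = (\<Sum>i\<in>M. - (n / 2 * I))" using M phi_row by (intro sum.cong) auto
      finally show ?thesis using M by simp
    qed
    finally have "edge_prob n P (?B M) \<le> exp (- (- (t * \<tau> * m))) * exp (m * (- (n / 2 * I)) + K * I * (m * m))"
      by simp
    then show "edge_prob n P (?B M) \<le> exp (m * (t * \<tau> - n / 2 * I + K * I * m))"
      unfolding exp_add[symmetric] by (simp add: algebra_simps)
  qed
  finally show ?thesis unfolding P_def t_def I_def K_def .
qed

text \<open>A minimizing \<open>m\<close>-set consists of the \<open>m\<close> smallest values; with the largest of them as a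
  threshold, the fractional weights \<open>b\<close> cannot do better.\<close>

lemma weighted_sum_ge:
  fixes f b :: "nat \<Rightarrow> real"
  assumes m: "0 < m" "m \<le> n" and b: "\<And>i. i < n \<Longrightarrow> 0 \<le> b i" "\<And>i. i < n \<Longrightarrow> b i \<le> 4"
    and mS: "m = 1 \<or> 4 * real m \<le> (\<Sum>i<n. b i)"
    and f: "\<And>M. M \<subseteq> {..<n} \<Longrightarrow> card M = m \<Longrightarrow> \<tau> * m \<le> (\<Sum>i\<in>M. f i)"
  shows "\<tau> * (\<Sum>i<n. b i) \<le> (\<Sum>i<n. f i * b i)"
proof (cases "m = 1")
  case True
  have "\<tau> \<le> f i" if "i < n" for i using f[of "{i}"] that True by simp
  then have "(\<Sum>i<n. \<tau> * b i) \<le> (\<Sum>i<n. f i * b i)" using b by (intro sum_mono mult_right_mono) auto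
  then show ?thesis by (simp add: sum_distrib_left)
next
  case False
  let ?F = "{M. M \<subseteq> {..<n} \<and> card M = m}"
  have "finite ?F" by (rule finite_subset[of _ "Pow {..<n}"]) auto
  moreover have "?F \<noteq> {}" using m by (auto intro: exI[of _ "{..<m}"])
  ultimately obtain M where M: "M \<in> ?F" "\<And>M'. M' \<in> ?F \<Longrightarrow> (\<Sum>i\<in>M. f i) \<le> (\<Sum>i\<in>M'. f i)"
    using ex_min_if_finite[of "(\<lambda>M. \<Sum>i\<in>M. f i) ` ?F"] by (auto simp: not_less)
  have finM: "finite M" using M by (auto intro: finite_subset)
  have swap: "f i \<le> f j" if "i \<in> M" "j < n" "j \<notin> M" for i j
  proof -
    have "insert j (M - {i}) \<in> ?F" using that M finM m by auto
    from M(2)[OF this] have "(\<Sum>i\<in>M. f i) \<le> f j + (\<Sum>i\<in>M - {i}. f i)" using that finM by simp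
    then show ?thesis using that finM by (simp add: sum.remove[of M i])
  qed
  define \<theta> where "\<theta> = Max (f ` M)"
  have Mne: "M \<noteq> {}" using M m by auto
  have th: "f i \<le> \<theta>" if "i \<in> M" for i using that finM by (simp add: \<theta>_def)
  have th': "\<theta> \<le> f j" if "j < n" "j \<notin> M" for j
    using swap that finM Mne by (simp add: \<theta>_def)
  have tau: "\<tau> * m \<le> (\<Sum>i\<in>M. f i)" using M f by blast
  also have "\<dots> \<le> (\<Sum>i\<in>M. \<theta>)" using th by (intro sum_mono)
  also have "\<dots> = \<theta> * m" using M by simp
  finally have tth: "\<tau> \<le> \<theta>" using m by simp
  have "(\<Sum>i<n. f i * b i) = (\<Sum>i<n. (f i - \<theta>) * b i) + \<theta> * (\<Sum>i<n. b i)"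
    by (simp add: left_diff_distrib sum_subtractf sum_distrib_left)
  also have "(\<Sum>i<n. (f i - \<theta>) * b i) \<ge> (\<Sum>i<n. of_bool (i \<in> M) * ((f i - \<theta>) * 4))"
  proof (intro sum_mono)
    fix i assume i: "i \<in> {..<n}"
    show "of_bool (i \<in> M) * ((f i - \<theta>) * 4) \<le> (f i - \<theta>) * b i"
    proof (cases "i \<in> M")
      case True
      then have "(f i - \<theta>) * 4 \<le> (f i - \<theta>) * b i"
        using th[of i] b[of i] i by (intro mult_left_mono_neg) auto
      then show ?thesis using True by simp
    next
      case False
      then show ?thesis using th'[of i] b[of i] i by simp
    qed
  qed
  moreover have "(\<Sum>i<n. of_bool (i \<in> M) * ((f i - \<theta>) * 4)) = (\<Sum>i\<in>M. (f i - \<theta>) * 4)"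
    using M by (intro sum.mono_neutral_cong_right) auto
  moreover have "\<dots> = 4 * (\<Sum>i\<in>M. f i) - 4 * m * \<theta>"
    using M by (simp add: sum_subtractf flip: sum_distrib_right)
  \<comment> \<open>The mass of \<open>b\<close> in excess of 4 m is charged at \<theta>, which is
    at least \<tau>.\<close>
  moreover have "0 \<le> (\<theta> - \<tau>) * ((\<Sum>i<n. b i) - 4 * m)"
    using tth mS False by (intro mult_nonneg_nonneg) auto
  moreover have "4 * (\<tau> * m) \<le> 4 * (\<Sum>i\<in>M. f i)" using tau by simp
  ultimately show ?thesis by (simp add: algebra_simps)
qed

section \<open>Top eigenvectors\<close>

lemma mult_mat_vec_sum:
  assumes "C \<in> carrier_mat n n" "x \<in> carrier_vec n" "i < n"
  shows "(C *\<^sub>v x) $ i = (\<Sum>j<n. C $$ (i, j) * x $ j)"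
  using assms by (simp add: scalar_prod_def atLeast0LessThan)

text \<open>The supremum of the Rayleigh quotient is an eigenvalue: otherwise \<open>\<rho> I - Y\<close> would be
  invertible and positive semidefinite, so the quotient would stay away from \<open>\<rho>\<close>.\<close>

lemma eigenvalue_ge_rayleigh:
  fixes Y :: "real mat"
  assumes n: "0 < n" and Y: "symmetric_mat n Y"
  obtains k where "eigenvalue Y k"
    "\<And>x. (\<Sum>i<n. \<Sum>j<n. x i * x j * Y $$ (i, j)) \<le> k * (\<Sum>i<n. (x i)\<^sup>2)"
proof -
  have Yc: "Y \<in> carrier_mat n n" and Ysym: "Y $$ (i, j) = Y $$ (j, i)" if "i < n" "j < n" for i j
    using Y that by (auto simp: symmetric_mat_def) (metis carrier_matD index_transpose_mat(1))
  then have Yc: "Y \<in> carrier_mat n n" using n by blast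
  define Q where "Q x = (\<Sum>i<n. \<Sum>j<n. x i * x j * Y $$ (i, j))" for x :: "nat \<Rightarrow> real"
  define N where "N x = (\<Sum>i<n. (x i)\<^sup>2)" for x :: "nat \<Rightarrow> real"
  define S where "S = Q ` {x. N x = 1}"
  define \<rho> where "\<rho> = Sup S"
  have "N (\<lambda>i. of_bool (i = 0)) = (\<Sum>i<n. if i = 0 then 1 else 0)"
    unfolding N_def by (intro sum.cong) auto
  then have N0: "N (\<lambda>i. of_bool (i = 0)) = 1" using n by simp
  then have Sne: "S \<noteq> {}" by (auto simp: S_def)
  have bdd: "bdd_above S"
  proof (rule bdd_aboveI)
    fix r assume "r \<in> S"
    then obtain x where x: "r = Q x" "N x = 1" by (auto simp: S_def)
    have x1: "\<bar>x i\<bar> \<le> 1" if "i < n" for i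
    proof -
      have "(x i)\<^sup>2 \<le> N x" unfolding N_def using that by (intro member_le_sum) auto
      then show ?thesis using x by (simp add: abs_square_le_1)
    qed
    have "Q x \<le> (\<Sum>i<n. \<Sum>j<n. \<bar>Y $$ (i, j)\<bar>)"
      unfolding Q_def
    proof (intro sum_mono)
      fix i j assume "i \<in> {..<n}" "j \<in> {..<n}"
      then have "\<bar>x i * x j\<bar> \<le> 1 * 1" unfolding abs_mult by (intro mult_mono x1) auto
      then have "\<bar>x i * x j\<bar> * \<bar>Y $$ (i, j)\<bar> \<le> 1 * \<bar>Y $$ (i, j)\<bar>" by (intro mult_right_mono) auto
      then show "x i * x j * Y $$ (i, j) \<le> \<bar>Y $$ (i, j)\<bar>" by (simp flip: abs_mult)
    qed
    then show "r \<le> (\<Sum>i<n. \<Sum>j<n. \<bar>Y $$ (i, j)\<bar>)" by (simp add: x)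
  qed
  have scale: "Q (\<lambda>i. c * x i) = c\<^sup>2 * Q x" "N (\<lambda>i. c * x i) = c\<^sup>2 * N x" for c x
    by (simp_all add: Q_def N_def sum_distrib_left power2_eq_square mult_ac)
  have N_nonneg: "0 \<le> N x" for x by (auto simp: N_def intro: sum_nonneg)
  have Qle: "Q x \<le> \<rho> * N x" for x
  proof (cases "N x = 0")
    case True
    then have "x i = 0" if "i < n" for i using that by (auto simp: N_def sum_nonneg_eq_0_iff)
    then have "Q x = 0" by (simp add: Q_def)
    then show ?thesis using True by simp
  next
    case False
    then have Npos: "0 < N x" using N_nonneg[of x] by linarith
    define c where "c = 1 / sqrt (N x)"
    have c2: "c\<^sup>2 = 1 / N x" using Npos by (simp add: c_def power_divide)
    have "N (\<lambda>i. c * x i) = 1" using Npos by (simp add: scale c2)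
    then have "Q (\<lambda>i. c * x i) \<in> S" by (simp add: S_def)
    then have "Q (\<lambda>i. c * x i) \<le> \<rho>" unfolding \<rho>_def using bdd by (rule cSup_upper)
    then show ?thesis using Npos by (simp add: scale c2 field_simps)
  qed
  define M where "M i j = (if i < n \<and> j < n then \<rho> * of_bool (i = j) - Y $$ (i, j) else 0)" for i j
  have Mform: "(\<Sum>i<n. \<Sum>j<n. x i * x j * M i j) = \<rho> * N x - Q x" for x
  proof -
    have "(\<Sum>i<n. \<Sum>j<n. x i * x j * M i j)
       = (\<Sum>i<n. \<Sum>j<n. (if j = i then \<rho> * (x i)\<^sup>2 else 0) - x i * x j * Y $$ (i, j))"
      by (intro sum.cong refl) (auto simp: M_def power2_eq_square algebra_simps)
    also have "\<dots> = (\<Sum>i<n. \<Sum>j<n. if j = i then \<rho> * (x i)\<^sup>2 else 0) - Q x"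
      by (simp add: sum_subtractf Q_def)
    finally show ?thesis by (simp add: N_def sum_distrib_left)
  qed
  have "\<exists>w. \<forall>i<n. \<forall>j<n. M i j = (\<Sum>k<n. w k i * w k j)"
  proof (rule psd_gram)
    show "M i j = M j i" for i j using Ysym by (auto simp: M_def)
    show "0 \<le> (\<Sum>i<n. \<Sum>j<n. x i * x j * M i j)" for x unfolding Mform using Qle[of x] by simp
  qed
  then obtain w where w: "\<And>i j. i < n \<Longrightarrow> j < n \<Longrightarrow> M i j = (\<Sum>k<n. w k i * w k j)" by blast
  \<comment> \<open>Cauchy-Schwarz for the semidefinite form of \<open>M\<close>, read off from its
    Gram factor.\<close>
  have Mx: "(\<Sum>j<n. M i j * x j)\<^sup>2 \<le> M i i * (\<rho> * N x - Q x)" if i: "i < n" for i x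
  proof -
    define z where "z k = (\<Sum>j<n. w k j * x j)" for k
    have "(\<Sum>j<n. M i j * x j) = (\<Sum>j<n. \<Sum>k<n. w k i * (w k j * x j))"
      using w[OF i] by (simp add: sum_distrib_right mult.assoc)
    also have "\<dots> = (\<Sum>k<n. \<Sum>j<n. w k i * (w k j * x j))" by (rule sum.swap)
    also have "\<dots> = (\<Sum>k<n. w k i * z k)" by (simp add: z_def sum_distrib_left)
    finally have "(\<Sum>j<n. M i j * x j)\<^sup>2 \<le> (\<Sum>k<n. (w k i)\<^sup>2) * (\<Sum>k<n. (z k)\<^sup>2)"
      using Cauchy_Schwarz_ineq_sum[of "\<lambda>k. w k i" z "{..<n}"] by simp
    also have "(\<Sum>k<n. (w k i)\<^sup>2) = M i i" using w[OF i i] by (simp add: power2_eq_square)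
    also have "(\<Sum>k<n. (z k)\<^sup>2) = \<rho> * N x - Q x"
    proof -
      have "(\<Sum>k<n. (z k)\<^sup>2) = (\<Sum>k<n. \<Sum>i<n. \<Sum>j<n. x i * x j * (w k i * w k j))"
        by (simp add: z_def power2_eq_square sum_product mult_ac)
      also have "\<dots> = (\<Sum>i<n. \<Sum>k<n. \<Sum>j<n. x i * x j * (w k i * w k j))" by (rule sum.swap)
      also have "\<dots> = (\<Sum>i<n. \<Sum>j<n. \<Sum>k<n. x i * x j * (w k i * w k j))" by (intro sum.cong refl sum.swap)
      also have "\<dots> = (\<Sum>i<n. \<Sum>j<n. x i * x j * M i j)" by (intro sum.cong refl) (simp add: w sum_distrib_left)
      finally show ?thesis unfolding Mform .
    qed
    finally show ?thesis .
  qed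
  have "eigenvalue Y \<rho>"
  proof (rule ccontr)
    assume "\<not> eigenvalue Y \<rho>"
    define C where "C = char_matrix Y \<rho>"
    have C: "C \<in> carrier_mat n n" using Yc by (simp add: C_def)
    have "det C \<noteq> 0" using \<open>\<not> eigenvalue Y \<rho>\<close> unfolding C_def eigenvalue_det[OF Yc] .
    from det_non_zero_imp_unit[OF C this, unfolded Units_def, of "()"]
    obtain B where B: "B \<in> carrier_mat n n" and BC: "B * C = 1\<^sub>m n"
      by (auto simp: ring_mat_def)
    have Cij: "C $$ (i, j) = - M i j" if "i < n" "j < n" for i j
      using that Yc by (simp add: C_def char_matrix_def M_def)
    define b where "b = (\<Sum>i<n. \<Sum>j<n. (B $$ (i, j))\<^sup>2)"
    define T where "T = (\<Sum>j<n. M j j)"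
    have b0: "0 \<le> b" by (auto simp: b_def intro!: sum_nonneg)
    have T0: "0 \<le> T" unfolding T_def
    proof (intro sum_nonneg)
      fix j assume "j \<in> {..<n}"
      then show "0 \<le> M j j" using w[of j j] by (auto intro: sum_nonneg)
    qed
    \<comment> \<open>Invertibility bounds the norm of x by that of C x, and \<open>Mx\<close>
      bounds the latter by the form. Hence every normalized quotient stays below \<rho> by at least
      1 / (b T).\<close>
    have key: "N x \<le> b * (T * (\<rho> * N x - Q x))" for x
    proof -
      define y where "y = C *\<^sub>v vec n x"
      have y: "y $ i = - (\<Sum>j<n. M i j * x j)" if "i < n" for i
        unfolding y_def mult_mat_vec_sum[OF C _ that, simplified, OF vec_carrier]
        using that by (simp add: Cij sum_negf)
      have yc: "y \<in> carrier_vec n" using C by (simp add: y_def)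
      have "B *\<^sub>v y = vec n x"
        unfolding y_def by (subst assoc_mult_mat_vec[symmetric, OF B C]) (auto simp: BC)
      then have x: "x i = (\<Sum>j<n. B $$ (i, j) * y $ j)" if "i < n" for i
        using mult_mat_vec_sum[OF B yc that] that by simp
      have "N x \<le> (\<Sum>i<n. (\<Sum>j<n. (B $$ (i, j))\<^sup>2) * (\<Sum>j<n. (y $ j)\<^sup>2))"
        unfolding N_def
      proof (intro sum_mono)
        fix i assume "i \<in> {..<n}"
        then have "(x i)\<^sup>2 = (\<Sum>j<n. B $$ (i, j) * y $ j)\<^sup>2" using x[of i] by simp
        then show "(x i)\<^sup>2 \<le> (\<Sum>j<n. (B $$ (i, j))\<^sup>2) * (\<Sum>j<n. (y $ j)\<^sup>2)"
          using Cauchy_Schwarz_ineq_sum[of "\<lambda>j. B $$ (i, j)" "\<lambda>j. y $ j" "{..<n}"] by simp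
      qed
      also have "\<dots> = b * (\<Sum>j<n. (y $ j)\<^sup>2)" by (simp only: b_def sum_distrib_right)
      also have "\<dots> \<le> b * (\<Sum>j<n. M j j * (\<rho> * N x - Q x))"
      proof (intro mult_left_mono sum_mono b0)
        fix j assume "j \<in> {..<n}"
        then show "(y $ j)\<^sup>2 \<le> M j j * (\<rho> * N x - Q x)" using Mx[of j x] y[of j] by simp
      qed
      also have "\<dots> = b * (T * (\<rho> * N x - Q x))" by (simp only: T_def sum_distrib_right)
      finally show ?thesis .
    qed
    have "b * T \<noteq> 0"
    proof
      assume "b * T = 0"
      then have "N (\<lambda>i. of_bool (i = 0)) \<le> 0"
        using key[of "\<lambda>i. of_bool (i = 0)"] by (simp only: mult.assoc[symmetric] mult_zero_left)
      then show False using N0 by simp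
    qed
    then have bT: "0 < b * T" using b0 T0 by (simp add: less_le)
    have "\<rho> \<le> \<rho> - 1 / (b * T)"
      unfolding \<rho>_def
    proof (rule cSup_least[OF Sne], unfold \<rho>_def[symmetric])
      fix r assume "r \<in> S"
      then obtain x where x: "r = Q x" "N x = 1" by (auto simp: S_def)
      have "1 \<le> (b * T) * (\<rho> - r)" using key[of x] x by (simp add: mult.assoc)
      then have "1 / (b * T) \<le> \<rho> - r" using bT by (simp add: divide_le_eq mult.commute)
      then show "r \<le> \<rho> - 1 / (b * T)" by linarith
    qed
    then show False using bT by simp
  qed
  then show ?thesis using Qle that unfolding Q_def N_def by blast
qed

text \<open>Write v = \<alpha> s + w with w orthogonal to s, and let W, N be the squared norms of w
  and v. Then k W is the form of y - s s^T at (w, v), whose squared Frobenius norm is at most 2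
  \<gamma> because its entries are at most 2. With k \<ge> 7 n / 8 this bounds W by a multiple of
  \<gamma> N / n^2, and each wrong sign costs \<alpha>^2 in W. The constant obtained is 256 / 49
  \<le> 8.\<close>

lemma sign_error_le:
  fixes y :: "nat \<Rightarrow> nat \<Rightarrow> real" and s v :: "nat \<Rightarrow> real"
  assumes n: "0 < n" and s: "\<And>i. i < n \<Longrightarrow> s i \<in> {- 1, 1}"
    and y1: "\<And>i j. i < n \<Longrightarrow> j < n \<Longrightarrow> \<bar>y i j\<bar> \<le> 1" and sym: "\<And>i j. i < n \<Longrightarrow> j < n \<Longrightarrow> y i j = y j i"
    and \<gamma>: "\<gamma> = (\<Sum>i<n. \<Sum>j<n. \<bar>y i j - s i * s j\<bar>)" "\<gamma> \<le> (real n)\<^sup>2 / 8"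
    and v: "\<exists>i<n. v i \<noteq> 0" and ev: "\<And>i. i < n \<Longrightarrow> (\<Sum>j<n. y i j * v j) = k * v i"
    and k: "(\<Sum>i<n. \<Sum>j<n. s i * s j * y i j) \<le> k * n"
  obtains g :: real where "g \<in> {- 1, 1}"
    "(\<Sum>i<n. of_bool (g * (if 0 \<le> v i then 1 else - 1) \<noteq> s i)) \<le> 8 * \<gamma> / n"
proof -
  have ss: "s i * s i = 1" if "i < n" for i using s[OF that] by auto
  have \<gamma>0: "0 \<le> \<gamma>" unfolding \<gamma>(1) by (auto intro!: sum_nonneg)
  define \<alpha> where "\<alpha> = (\<Sum>i<n. s i * v i) / n"
  define w where "w i = v i - \<alpha> * s i" for i
  define N where "N = (\<Sum>i<n. (v i)\<^sup>2)"
  define W where "W = (\<Sum>i<n. (w i)\<^sup>2)"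
  define D where "D i j = y i j - s i * s j" for i j
  have sv: "(\<Sum>i<n. s i * v i) = \<alpha> * n" using n by (simp add: \<alpha>_def)
  have sw: "(\<Sum>i<n. s i * w i) = 0"
  proof -
    have "(\<Sum>i<n. s i * w i) = (\<Sum>i<n. s i * v i - \<alpha>)"
      by (intro sum.cong refl) (simp add: w_def right_diff_distrib mult.left_commute ss)
    then show ?thesis using sv by (simp add: sum_subtractf)
  qed
  have N: "0 < N"
  proof -
    obtain i where "i < n" "v i \<noteq> 0" using v by blast
    then have "0 < (v i)\<^sup>2" "(v i)\<^sup>2 \<le> N" unfolding N_def by (auto intro!: member_le_sum)
    then show ?thesis by linarith
  qed
  have W0: "0 \<le> W" unfolding W_def by (auto intro: sum_nonneg)
  have wv: "(\<Sum>i<n. w i * v i) = W"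
  proof -
    have "(\<Sum>i<n. w i * v i) = (\<Sum>i<n. (w i)\<^sup>2 + \<alpha> * (s i * w i))"
      by (intro sum.cong refl) (simp add: w_def power2_eq_square algebra_simps)
    also have "\<dots> = W + \<alpha> * (\<Sum>i<n. s i * w i)" by (simp add: W_def sum.distrib sum_distrib_left)
    finally show ?thesis using sw by simp
  qed
  have NW: "N = W + \<alpha>\<^sup>2 * n"
  proof -
    have "N = (\<Sum>i<n. (w i)\<^sup>2 + 2 * \<alpha> * (s i * w i) + \<alpha>\<^sup>2)"
      unfolding N_def
    proof (intro sum.cong refl)
      fix i assume "i \<in> {..<n}"
      then have "(\<alpha> * s i)\<^sup>2 = \<alpha>\<^sup>2" using ss by (simp add: power_mult_distrib power2_eq_square)
      moreover have "v i = w i + \<alpha> * s i" by (simp add: w_def)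
      ultimately show "(v i)\<^sup>2 = (w i)\<^sup>2 + 2 * \<alpha> * (s i * w i) + \<alpha>\<^sup>2" by (simp add: power2_sum mult_ac)
    qed
    also have "\<dots> = W + 2 * \<alpha> * (\<Sum>i<n. s i * w i) + \<alpha>\<^sup>2 * n"
      by (simp add: W_def sum.distrib sum_distrib_left)
    finally show ?thesis using sw by simp
  qed
  have kn: "n - \<gamma> / n \<le> k"
  proof -
    have "s i * s j * y i j = 1 - \<bar>D i j\<bar>" if "i < n" "j < n" for i j
      using s[OF that(1)] s[OF that(2)] y1[OF that] by (auto simp: D_def abs_if)
    then have "(\<Sum>i<n. \<Sum>j<n. s i * s j * y i j) = (\<Sum>i<n. \<Sum>j<n. 1 - \<bar>D i j\<bar>)" by (intro sum.cong) auto
    also have "\<dots> = real n * n - \<gamma>" by (simp add: \<gamma>(1) D_def sum_subtractf)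
    finally have "real n * n - \<gamma> \<le> k * n" using k by simp
    then show ?thesis using n by (simp add: field_simps)
  qed
  have "\<gamma> / n \<le> n / 8" using \<gamma>(2) n by (simp add: field_simps power2_eq_square)
  then have k78: "7 / 8 * n \<le> k" using kn by linarith
  have kW: "k * W = (\<Sum>i<n. \<Sum>j<n. (w i * v j) * D i j)"
  proof -
    have "k * W = (\<Sum>i<n. w i * (k * v i))" unfolding wv[symmetric] by (simp add: sum_distrib_left mult_ac)
    also have "\<dots> = (\<Sum>i<n. w i * (\<Sum>j<n. y i j * v j))" using ev by (intro sum.cong) auto
    also have "\<dots> = (\<Sum>i<n. \<Sum>j<n. (w i * v j) * D i j + (s i * w i) * (s j * v j))"
      unfolding sum_distrib_left by (intro sum.cong refl) (simp add: D_def algebra_simps)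
    also have "\<dots> = (\<Sum>i<n. \<Sum>j<n. (w i * v j) * D i j) + (\<Sum>i<n. s i * w i) * (\<Sum>j<n. s j * v j)"
      by (simp only: sum.distrib sum_product)
    finally show ?thesis using sw by simp
  qed
  have "(k * W)\<^sup>2 \<le> (W * N) * (2 * \<gamma>)"
  proof -
    let ?I = "{..<n} \<times> {..<n}"
    have "(k * W)\<^sup>2 = (\<Sum>(i, j)\<in>?I. (w i * v j) * D i j)\<^sup>2"
      unfolding kW by (simp add: sum.cartesian_product)
    also have "\<dots> \<le> (\<Sum>(i, j)\<in>?I. (w i * v j)\<^sup>2) * (\<Sum>(i, j)\<in>?I. (D i j)\<^sup>2)"
      using Cauchy_Schwarz_ineq_sum[of "\<lambda>(i, j). w i * v j" "\<lambda>(i, j). D i j" ?I]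
      by (simp add: case_prod_unfold)
    also have "(\<Sum>(i, j)\<in>?I. (w i * v j)\<^sup>2) = W * N"
      by (simp add: W_def N_def sum_product power_mult_distrib flip: sum.cartesian_product)
    also have "(\<Sum>(i, j)\<in>?I. (D i j)\<^sup>2) \<le> (\<Sum>(i, j)\<in>?I. 2 * \<bar>D i j\<bar>)"
    proof (intro sum_mono)
      fix e assume "e \<in> ?I"
      then obtain i j where e: "e = (i, j)" "i < n" "j < n" by auto
      have "\<bar>D i j\<bar> \<le> 2" using s[OF e(2)] s[OF e(3)] y1[OF e(2,3)] by (auto simp: D_def abs_if split: if_splits)
      then have "\<bar>D i j\<bar> * \<bar>D i j\<bar> \<le> 2 * \<bar>D i j\<bar>" by (intro mult_right_mono) auto
      then show "(case e of (i, j) \<Rightarrow> (D i j)\<^sup>2) \<le> (case e of (i, j) \<Rightarrow> 2 * \<bar>D i j\<bar>)"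
        by (simp add: e power2_eq_square)
    qed
    also have "(\<Sum>(i, j)\<in>?I. 2 * \<bar>D i j\<bar>) = 2 * \<gamma>"
      by (simp add: \<gamma>(1) D_def sum_distrib_left flip: sum.cartesian_product)
    finally show ?thesis using W0 N by (simp add: mult_left_mono)
  qed
  then have "W * (k\<^sup>2 * W) \<le> W * (2 * \<gamma> * N)" by (simp add: power_mult_distrib power2_eq_square mult_ac)
  then have kkW: "k\<^sup>2 * W \<le> 2 * \<gamma> * N"
    using W0 \<gamma>0 N by (cases "W = 0") (auto simp: mult_le_cancel_left)
  have "49 / 64 * (real n)\<^sup>2 * W \<le> k\<^sup>2 * W"
  proof (intro mult_right_mono W0)
    have "(7 / 8 * real n)\<^sup>2 \<le> k\<^sup>2" using k78 by (intro power_mono) auto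
    then show "49 / 64 * (real n)\<^sup>2 \<le> k\<^sup>2" by (simp add: power_mult_distrib power_divide)
  qed
  then have W1: "49 / 64 * (real n)\<^sup>2 * W \<le> 2 * \<gamma> * N" using kkW by linarith
  have "2 * \<gamma> * N \<le> 2 * ((real n)\<^sup>2 / 8) * N" using \<gamma>(2) N by (intro mult_right_mono mult_left_mono) auto
  with W1 have "(real n)\<^sup>2 * (49 / 64 * W) \<le> (real n)\<^sup>2 * (N / 4)" by (simp add: mult_ac)
  then have "49 / 64 * W \<le> N / 4" using n by (simp add: mult_le_cancel_left_pos)
  moreover have "0 \<le> \<alpha>\<^sup>2 * n" by simp
  ultimately have aN: "N \<le> 2 * (\<alpha>\<^sup>2 * n)" using NW by linarith
  then have a0: "0 < \<alpha>\<^sup>2" using N n by (auto simp: zero_less_mult_iff intro!: gr0I)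
  define g where "g = (if 0 \<le> \<alpha> then 1 else - 1 :: real)"
  define E where "E = (\<Sum>i<n. of_bool (g * (if 0 \<le> v i then 1 else - 1) \<noteq> s i) :: real)"
  have "E * \<alpha>\<^sup>2 \<le> W"
    unfolding E_def W_def sum_distrib_right
  proof (intro sum_mono)
    fix i assume "i \<in> {..<n}"
    then have si: "s i \<in> {- 1, 1}" using s by simp
    \<comment> \<open>At a wrong sign v_i and \<alpha> s_i never share a strict sign, so they differ
      by at least |\<alpha>|. This covers v_i = 0, whatever sign it receives.\<close>
    have "\<bar>\<alpha>\<bar> \<le> \<bar>w i\<bar>" if "g * (if 0 \<le> v i then 1 else - 1) \<noteq> s i"
      using that si unfolding w_def g_def by (auto simp: abs_if split: if_splits)
    then show "of_bool (g * (if 0 \<le> v i then 1 else - 1) \<noteq> s i) * \<alpha>\<^sup>2 \<le> (w i)\<^sup>2"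
      by (simp add: abs_le_square_iff)
  qed
  then have "49 / 64 * (real n)\<^sup>2 * (E * \<alpha>\<^sup>2) \<le> 49 / 64 * (real n)\<^sup>2 * W" by (intro mult_left_mono) auto
  also have "\<dots> \<le> 2 * \<gamma> * N" by (rule W1)
  also have "\<dots> \<le> 2 * \<gamma> * (2 * (\<alpha>\<^sup>2 * n))" using aN \<gamma>0 by (intro mult_left_mono) auto
  finally have "(\<alpha>\<^sup>2 * n) * (49 / 64 * (n * E)) \<le> (\<alpha>\<^sup>2 * n) * (4 * \<gamma>)"
    by (simp add: power2_eq_square mult_ac)
  then have "49 / 64 * (n * E) \<le> 4 * \<gamma>" using a0 n by (simp add: mult_le_cancel_left_pos)
  then have "n * E \<le> 8 * \<gamma>" using \<gamma>0 by linarith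
  then have "E \<le> 8 * \<gamma> / n" using n by (simp add: field_simps)
  then show ?thesis by (intro that[of g]) (auto simp: g_def E_def)
qed

section \<open>Translation to the matrix notions of the statement\<close>

lemma psd_mat_form:
  assumes "psd_mat n Y"
  shows "0 \<le> (\<Sum>i<n. \<Sum>j<n. x i * x j * Y $$ (i, j))"
proof -
  have Y: "Y \<in> carrier_mat n n" using assms by (simp add: psd_mat_def symmetric_mat_def)
  have "0 \<le> scalar_prod (vec n x) (Y *\<^sub>v vec n x)" using assms by (auto simp: psd_mat_def)
  also have "\<dots> = (\<Sum>i<n. x i * (Y *\<^sub>v vec n x) $ i)"
    using Y by (simp add: scalar_prod_def atLeast0LessThan)
  also have "\<dots> = (\<Sum>i<n. x i * (\<Sum>j<n. Y $$ (i, j) * x j))"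
    using Y by (intro sum.cong refl) (simp add: scalar_prod_def atLeast0LessThan)
  finally show ?thesis by (simp add: sum_distrib_left mult_ac)
qed

lemma mat_norm1_diff_outer_square:
  assumes "Y \<in> carrier_mat n n" "\<sigma> \<in> carrier_vec n"
  shows "mat_norm1 (Y - outer_square \<sigma>) = (\<Sum>i<n. \<Sum>j<n. \<bar>Y $$ (i, j) - \<sigma> $ i * \<sigma> $ j\<bar>)"
  using assms by (simp add: mat_norm1_def outer_square_def)

lemma symmetric_mat_nth: "symmetric_mat n Y \<Longrightarrow> i < n \<Longrightarrow> j < n \<Longrightarrow> Y $$ (i, j) = Y $$ (j, i)"
  unfolding symmetric_mat_def by (metis carrier_matD index_transpose_mat(1))

text \<open>A top eigenvector is defined by comparison with eigenvalues only;
  \<open>eigenvalue_ge_rayleigh\<close> is what bounds its eigenvalue below by the Rayleigh quotient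
  of the labels.\<close>

lemma top_eigenvector_label_err:
  assumes n: "0 < n" and \<sigma>: "sign_vector n \<sigma>" and Y: "symmetric_mat n Y"
    and Y1: "\<And>i j. i < n \<Longrightarrow> j < n \<Longrightarrow> \<bar>Y $$ (i, j)\<bar> \<le> 1"
    and \<gamma>: "mat_norm1 (Y - outer_square \<sigma>) \<le> (real n)\<^sup>2 / 8" and v: "top_eigenvector Y v"
  shows "label_err n (entrywise_sign v) \<sigma> \<le> 8 * mat_norm1 (Y - outer_square \<sigma>) / (real n)\<^sup>2"
proof -
  have Yc: "Y \<in> carrier_mat n n" using Y by (simp add: symmetric_mat_def)
  have \<sigma>c: "\<sigma> \<in> carrier_vec n" using \<sigma> by (simp add: sign_vector_def)
  define \<Gamma> where "\<Gamma> = mat_norm1 (Y - outer_square \<sigma>)"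
  obtain k where k: "eigenvector Y v k" "\<And>k'. eigenvalue Y k' \<Longrightarrow> k' \<le> k"
    using v by (auto simp: top_eigenvector_def)
  have vc: "v \<in> carrier_vec n" and v0: "v \<noteq> 0\<^sub>v n" and Yv: "Y *\<^sub>v v = k \<cdot>\<^sub>v v"
    using k(1) Yc by (auto simp: eigenvector_def)
  have vnz: "\<exists>i<n. v $ i \<noteq> 0"
  proof (rule ccontr)
    assume "\<not> (\<exists>i<n. v $ i \<noteq> 0)"
    then have "v = 0\<^sub>v n" using vc by (intro eq_vecI) auto
    then show False using v0 by simp
  qed
  obtain k' where k': "eigenvalue Y k'" "\<And>x. (\<Sum>i<n. \<Sum>j<n. x i * x j * Y $$ (i, j)) \<le> k' * (\<Sum>i<n. (x i)\<^sup>2)"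
    by (rule eigenvalue_ge_rayleigh[OF n Y]) (rule that)
  have s: "\<sigma> $ i \<in> {- 1, 1}" if "i < n" for i using \<sigma> that by (auto simp: sign_vector_def)
  have ssum: "(\<Sum>i<n. (\<sigma> $ i)\<^sup>2) = n"
  proof -
    have "(\<Sum>i<n. (\<sigma> $ i)\<^sup>2) = (\<Sum>i<n. 1)" by (intro sum.cong refl) (use s in fastforce)
    then show ?thesis by simp
  qed
  have kn: "(\<Sum>i<n. \<Sum>j<n. \<sigma> $ i * \<sigma> $ j * Y $$ (i, j)) \<le> k * n"
  proof -
    have "(\<Sum>i<n. \<Sum>j<n. \<sigma> $ i * \<sigma> $ j * Y $$ (i, j)) \<le> k' * n" using k'(2)[of "\<lambda>i. \<sigma> $ i"] ssum by simp
    also have "\<dots> \<le> k * n" using k(2)[OF k'(1)] by (intro mult_right_mono) auto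
    finally show ?thesis .
  qed
  obtain g :: real where g: "g \<in> {- 1, 1}"
    "(\<Sum>i<n. of_bool (g * (if 0 \<le> v $ i then 1 else - 1) \<noteq> \<sigma> $ i)) \<le> 8 * \<Gamma> / n"
  proof (rule sign_error_le[OF n s Y1 _ _ _ vnz _ kn, of \<Gamma>])
    show "\<Gamma> = (\<Sum>i<n. \<Sum>j<n. \<bar>Y $$ (i, j) - \<sigma> $ i * \<sigma> $ j\<bar>)"
      unfolding \<Gamma>_def by (rule mat_norm1_diff_outer_square[OF Yc \<sigma>c])
    show "\<Gamma> \<le> (real n)\<^sup>2 / 8" using \<gamma> by (simp add: \<Gamma>_def)
    show "Y $$ (i, j) = Y $$ (j, i)" if "i < n" "j < n" for i j using symmetric_mat_nth[OF Y that] .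
    show "(\<Sum>j<n. Y $$ (i, j) * v $ j) = k * v $ i" if "i < n" for i
      using mult_mat_vec_sum[OF Yc vc that] Yv that vc by simp
  qed (use that in auto)
  have "label_err n (entrywise_sign v) \<sigma> \<le> 1 / real n * (\<Sum>i<n. of_bool (g * entrywise_sign v $ i \<noteq> \<sigma> $ i))"
    unfolding label_err_def using g(1) by (intro Min_le) auto
  also have "(\<Sum>i<n. of_bool (g * entrywise_sign v $ i \<noteq> \<sigma> $ i)) = (\<Sum>i<n. of_bool (g * (if 0 \<le> v $ i then 1 else - 1) \<noteq> \<sigma> $ i) :: real)"
    using vc by (intro sum.cong refl) (auto simp: entrywise_sign_def)
  also have "1 / real n * \<dots> \<le> 1 / real n * (8 * \<Gamma> / n)" using g(2) by (intro mult_left_mono) auto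
  finally show ?thesis by (simp add: \<Gamma>_def power2_eq_square)
qed

section \<open>Deterministic recovery on the good event\<close>

lemma sym_entry_nonneg: "0 \<le> sym_entry a i j"
  by (simp add: sym_entry_def)

lemma sym_entry_commute: "sym_entry a i j = sym_entry a j i"
  by (simp add: sym_entry_def min.commute max.commute)

text \<open>The coefficient of the signed degrees is 8 c + 20026 from
  \<open>quadratic_form_le\<close> plus 12 c + 5, which beats the cost 12 c + 4 of the removed
  vertices when n p \<ge> 1. The error is measured in units of \<open>m0\<close>; fewer than
  \<open>m1\<close> vertices are removed.\<close>

definition sbm_regular ::
  "nat \<Rightarrow> real vec \<Rightarrow> real \<Rightarrow> real \<Rightarrow> real \<Rightarrow> nat \<Rightarrow> nat \<Rightarrow> (nat \<Rightarrow> nat \<Rightarrow> real) \<Rightarrow> bool" where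
  "sbm_regular n \<sigma> p q c m0 m1 A \<longleftrightarrow>
     light_bound n (\<lambda>i j. if \<sigma> $ i * \<sigma> $ j = 1 then p else q) p A \<and> discrepancy_bound n p A \<and>
     degree_bound n (c * (n * p)) m1 A \<and>
     signed_degree_bound n (\<lambda>i. \<sigma> $ i) ((20 * c + 20031) * sqrt (n * p)) m0 A"

text \<open>Let S be the normalized error. If S > 0 and either 4 m0 \<le> S or m0 = 1, the lower
  bound (20 c + 20031) D S for the weighted degree sum contradicts the upper bound (\<kappa> + 12 c
  + 4) S. The case m0 = 1 is exact recovery, which the floor in the rate demands.\<close>

lemma sdp_error_le:
  fixes p q c :: real
  assumes n: "0 < n" and \<sigma>: "balanced_labels n \<sigma>" and pq: "0 < q" "q < p" and np: "1 \<le> n * p" and c: "0 \<le> c"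
    and A: "\<And>i j. 0 \<le> A i j" "\<And>i j. A i j = A j i"
    and B: "B \<in> carrier_mat n n"
      "\<And>i j. i < n \<Longrightarrow> j < n \<Longrightarrow> i \<noteq> j \<Longrightarrow> A i j * (\<sigma> $ i * \<sigma> $ j) \<le> B $$ (i, j) * (\<sigma> $ i * \<sigma> $ j)"
    and reg: "sbm_regular n \<sigma> p q c m0 m1 A"
    and m1: "m1 \<le> n" "m1 = 1 \<or> m1 * (n * p) \<le> m0" and m0: "0 < m0" "m0 \<le> n"
    and Y: "Y \<in> sdp_set n \<sigma> B"
  shows "(\<forall>i<n. \<forall>j<n. \<bar>Y $$ (i, j)\<bar> \<le> 1) \<and>
    (mat_norm1 (Y - outer_square \<sigma>) = 0 \<or> m0 \<noteq> 1 \<and> mat_norm1 (Y - outer_square \<sigma>) / n < 4 * real m0)"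
proof -
  note light = reg[unfolded sbm_regular_def, THEN conjunct1]
    and disc = reg[unfolded sbm_regular_def, THEN conjunct2, THEN conjunct1]
    and deg = reg[unfolded sbm_regular_def, THEN conjunct2, THEN conjunct2, THEN conjunct1]
    and sdeg = reg[unfolded sbm_regular_def, THEN conjunct2, THEN conjunct2, THEN conjunct2]
  define s where "s i = \<sigma> $ i" for i
  define D where "D = sqrt (n * p)"
  define y where "y i j = (if i < n \<and> j < n then Y $$ (i, j) else 0)" for i j
  define R where "R i j = s i * s j * y i j" for i j
  define S where "S = mat_norm1 (Y - outer_square \<sigma>) / n"
  define \<kappa> where "\<kappa> = (8 * c + 20026) * D"
  define H where "H = {i. i < n \<and> c * (n * p) < (\<Sum>j<n. A i j)}"
  have sgn: "s i \<in> {- 1, 1}" if "i < n" for i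
    using \<sigma> that by (auto simp: s_def balanced_labels_def sign_vector_def)
  have \<sigma>c: "\<sigma> \<in> carrier_vec n" and bal: "(\<Sum>i<n. s i) = 0"
    using \<sigma> by (auto simp: s_def balanced_labels_def sign_vector_def)
  have ss: "s i * s i = 1" if "i < n" for i using sgn[OF that] by auto
  have D1: "1 \<le> D" using np by (simp add: D_def)
  have p0: "0 < p" using pq by linarith
  have psd: "psd_mat n Y" and diag: "\<And>i. i < n \<Longrightarrow> Y $$ (i, i) = 1"
    and tot: "(\<Sum>i<n. \<Sum>j<n. Y $$ (i, j)) = 0" and inner: "mat_inner B (outer_square \<sigma>) \<le> mat_inner B Y"
    using Y by (auto simp: sdp_set_def)
  have symY: "symmetric_mat n Y" and Yc: "Y \<in> carrier_mat n n" using psd by (auto simp: psd_mat_def symmetric_mat_def)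
  have yform: "(\<Sum>i<n. \<Sum>j<n. f i j (y i j)) = (\<Sum>i<n. \<Sum>j<n. f i j (Y $$ (i, j)))" for f :: "nat \<Rightarrow> nat \<Rightarrow> real \<Rightarrow> real"
    by (intro sum.cong refl) (simp add: y_def)
  obtain x :: "nat \<Rightarrow> nat \<Rightarrow> real" where
    x: "\<And>i j. i < n \<Longrightarrow> j < n \<Longrightarrow> (\<Sum>k<n. (x k i - x k j)\<^sup>2) = 2 - 2 * R i j"
    and b4: "\<And>i. i < n \<Longrightarrow> (\<Sum>k<n. (x k i)\<^sup>2) \<le> 4"
    and bsum: "(\<Sum>i<n. \<Sum>k<n. (x k i)\<^sup>2) = (\<Sum>i<n. \<Sum>j<n. 1 - R i j) / n"
    and x0: "\<And>k. k < n \<Longrightarrow> (\<Sum>i<n. x k i) = 0" "\<And>k. k < n \<Longrightarrow> (\<Sum>i<n. s i * x k i) = 0"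
    and R1: "\<And>i j. i < n \<Longrightarrow> j < n \<Longrightarrow> \<bar>R i j\<bar> \<le> 1"
  proof (rule sdp_centered_gram[OF n ss bal, of y, folded R_def])
    show "y i j = y j i" for i j using symmetric_mat_nth[OF symY] by (auto simp: y_def)
    show "0 \<le> (\<Sum>i<n. \<Sum>j<n. z i * z j * y i j)" for z
      using psd_mat_form[OF psd, of z] yform[of "\<lambda>i j t. z i * z j * t"] by simp
    show "y i i = 1" if "i < n" for i using diag that by (simp add: y_def)
    show "(\<Sum>i<n. \<Sum>j<n. y i j) = 0" using tot yform[of "\<lambda>i j t. t"] by simp
  qed (assumption, rule that)
  have Y1: "\<bar>Y $$ (i, j)\<bar> \<le> 1" if "i < n" "j < n" for i j
    using R1[OF that] sgn[OF that(1)] sgn[OF that(2)] that by (auto simp: R_def y_def abs_mult)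
  have err: "\<bar>Y $$ (i, j) - s i * s j\<bar> = 1 - R i j" if "i < n" "j < n" for i j
    using R1[OF that] sgn[OF that(1)] sgn[OF that(2)] that by (auto simp: R_def y_def)
  have norm1: "mat_norm1 (Y - outer_square \<sigma>) = (\<Sum>i<n. \<Sum>j<n. 1 - R i j)"
    unfolding mat_norm1_diff_outer_square[OF Yc \<sigma>c] using err by (intro sum.cong refl) (simp add: s_def)
  have bS: "(\<Sum>i<n. \<Sum>k<n. (x k i)\<^sup>2) = S" unfolding bsum S_def norm1 ..
  have opt: "(\<Sum>i<n. \<Sum>j<n. A i j * (s i * s j) * (1 - R i j)) \<le> 0"
  proof -
    have "(\<Sum>i<n. \<Sum>j<n. A i j * (s i * s j) * (1 - R i j)) \<le> (\<Sum>i<n. \<Sum>j<n. B $$ (i, j) * (s i * s j) * (1 - R i j))"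
    proof (intro sum_mono)
      fix i j assume "i \<in> {..<n}" "j \<in> {..<n}"
      then have ij: "i < n" "j < n" by auto
      show "A i j * (s i * s j) * (1 - R i j) \<le> B $$ (i, j) * (s i * s j) * (1 - R i j)"
      proof (cases "i = j")
        case True
        \<comment> \<open>Diagonal terms vanish, whatever diagonal the adversary chose.\<close>
        then have "R i j = 1" using ij diag ss by (simp add: R_def y_def)
        then show ?thesis by simp
      next
        case False
        then have "A i j * (s i * s j) \<le> B $$ (i, j) * (s i * s j)" using B(2)[OF ij] by (simp add: s_def)
        then show ?thesis by (rule mult_right_mono) (use R1[OF ij] in simp)
      qed
    qed
    also have "\<dots> = (\<Sum>i<n. \<Sum>j<n. B $$ (i, j) * (s i * s j) - B $$ (i, j) * Y $$ (i, j))"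
    proof (intro sum.cong refl)
      fix i j assume "i \<in> {..<n}" "j \<in> {..<n}"
      then have ij: "i < n" "j < n" by auto
      have "(s i * s j) * R i j = (s i * s i) * (s j * s j) * y i j" by (simp add: R_def mult_ac)
      also have "\<dots> = Y $$ (i, j)" using ij ss by (simp add: y_def)
      finally have "(s i * s j) * R i j = Y $$ (i, j)" .
      then show "B $$ (i, j) * (s i * s j) * (1 - R i j) = B $$ (i, j) * (s i * s j) - B $$ (i, j) * Y $$ (i, j)"
        by (simp add: right_diff_distrib mult.assoc)
    qed
    also have "\<dots> = mat_inner B (outer_square \<sigma>) - mat_inner B Y"
      using B(1) \<sigma>c by (simp add: mat_inner_def outer_square_def s_def sum_subtractf)
    finally show ?thesis using inner by linarith
  qed
  have Hsub: "H \<subseteq> {..<n}" by (auto simp: H_def)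
  then have finH: "finite H" by (rule finite_subset) simp
  have Hle: "card H < m1"
  proof (rule ccontr)
    assume "\<not> card H < m1"
    then obtain M where M: "M \<subseteq> H" "card M = m1" using obtain_subset_with_card_n[of m1 H] by auto
    have "c * (n * p) * m1 = (\<Sum>i\<in>M. c * (n * p))" using M by simp
    also have "\<dots> \<le> (\<Sum>i\<in>M. \<Sum>j<n. A i j)" using M by (intro sum_mono) (auto simp: H_def)
    also have "\<dots> < c * (n * p) * m1" using deg M Hsub unfolding degree_bound_def by blast
    finally show False by simp
  qed
  \<comment> \<open>If m1 = 1, nothing is removed. Otherwise \<open>H\<close> is padded to an
    m1-set, whose degree sum is at most c m1 n p \<le> c m0 \<le> c S.\<close>
  have excess: "12 * (\<Sum>i\<in>H. \<Sum>j<n. A i j) + 4 * p * (real (card H))\<^sup>2 \<le> (12 * c + 4) * S"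
    if S0: "0 < S" and mS: "m0 = 1 \<or> 4 * real m0 \<le> S"
  proof (cases "H = {}")
    case True
    then show ?thesis using c S0 by simp
  next
    case False
    then have "0 < card H" using finH by (simp add: card_gt_0_iff)
    then have "m1 \<noteq> 1" using Hle by linarith
    then have m1': "m1 * (n * p) \<le> m0" "2 \<le> m1" using m1 Hle by auto
    have "real 2 * 1 \<le> m1 * (n * p)" using m1'(2) np by (intro mult_mono) auto
    then have "m0 \<noteq> 1" using m1' by linarith
    then have m0S: "real m0 \<le> S" using mS by linarith
    obtain M where M: "H \<subseteq> M" "M \<subseteq> {..<n}" "card M = m1"
      using exists_subset_between[of H m1 "{..<n}"] Hle m1(1) Hsub by auto
    have "(\<Sum>i\<in>H. \<Sum>j<n. A i j) \<le> (\<Sum>i\<in>M. \<Sum>j<n. A i j)"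
      using M A finite_subset[OF M(2)] by (intro sum_mono2) (auto intro: sum_nonneg)
    also have "\<dots> < c * (n * p) * m1" using deg M unfolding degree_bound_def by blast
    also have "\<dots> = c * (m1 * (n * p))" by simp
    also have "\<dots> \<le> c * S" using m1'(1) m0S c by (intro mult_left_mono) auto
    finally have 1: "(\<Sum>i\<in>H. \<Sum>j<n. A i j) \<le> c * S" by simp
    have "p * (real (card H))\<^sup>2 \<le> p * (real m1 * real n)"
      unfolding power2_eq_square using Hle m1 p0 by (intro mult_left_mono mult_mono) auto
    also have "\<dots> = m1 * (n * p)" by simp
    also have "\<dots> \<le> S" using m1'(1) m0S by linarith
    finally have "p * (real (card H))\<^sup>2 \<le> S" .
    then show ?thesis using 1 by (simp add: distrib_right)
  qed
  have main: "(\<Sum>i<n. (\<Sum>j<n. A i j * (s i * s j)) * (\<Sum>k<n. (x k i)\<^sup>2))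
    \<le> \<kappa> * S + 12 * (\<Sum>i\<in>H. \<Sum>j<n. A i j) + 4 * p * (real (card H))\<^sup>2"
    unfolding bS[symmetric]
  proof (rule weighted_degree_sum_le[OF ss A _ _ x b4 x0 R1 opt Hsub, where q = q])
    fix u :: "nat \<Rightarrow> real" assume u: "\<And>i. i \<in> H \<Longrightarrow> u i = 0"
    have "(\<Sum>i<n. \<Sum>j<n. u i * u j * (A i j - ((p + q) / 2 + (p - q) / 2 * (s i * s j))))
      = (\<Sum>i<n. \<Sum>j<n. u i * u j * (A i j - (if \<sigma> $ i * \<sigma> $ j = 1 then p else q)))"
    proof (intro sum.cong refl)
      fix i j assume "i \<in> {..<n}" "j \<in> {..<n}"
      then have "(p + q) / 2 + (p - q) / 2 * (s i * s j) = (if \<sigma> $ i * \<sigma> $ j = 1 then p else q)"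
        using sgn[of i] sgn[of j] by (auto simp: s_def field_simps)
      then show "u i * u j * (A i j - ((p + q) / 2 + (p - q) / 2 * (s i * s j))) = u i * u j * (A i j - (if \<sigma> $ i * \<sigma> $ j = 1 then p else q))"
        by simp
    qed
    also have "\<dots> \<le> (8 * c + 20026) * sqrt (n * p) * (\<Sum>i<n. (u i)\<^sup>2)"
    proof (rule quadratic_form_le[OF A _ n p0 c light disc])
      fix i assume "i < n" "u i \<noteq> 0"
      then have "i \<notin> H" using u by blast
      then show "(\<Sum>j<n. A i j) \<le> c * (n * p)" using \<open>i < n\<close> by (simp add: H_def)
    qed (use pq in auto)
    finally show "(\<Sum>i<n. \<Sum>j<n. u i * u j * (A i j - ((p + q) / 2 + (p - q) / 2 * (s i * s j)))) \<le> \<kappa> * (\<Sum>i<n. (u i)\<^sup>2)"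
      by (simp add: \<kappa>_def D_def)
  qed (use pq c D1 in \<open>auto simp: \<kappa>_def\<close>)
  have "\<not> (0 < S \<and> (m0 = 1 \<or> 4 * real m0 \<le> S))"
  proof
    assume asm: "0 < S \<and> (m0 = 1 \<or> 4 * real m0 \<le> S)"
    have "(20 * c + 20031) * D * (\<Sum>i<n. \<Sum>k<n. (x k i)\<^sup>2)
       \<le> (\<Sum>i<n. (\<Sum>j<n. A i j * (s i * s j)) * (\<Sum>k<n. (x k i)\<^sup>2))"
    proof (rule weighted_sum_ge[OF m0])
      show "m0 = 1 \<or> 4 * real m0 \<le> (\<Sum>i<n. \<Sum>k<n. (x k i)\<^sup>2)" unfolding bS using asm by blast
      show "(20 * c + 20031) * D * m0 \<le> (\<Sum>i\<in>M. \<Sum>j<n. A i j * (s i * s j))"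
        if "M \<subseteq> {..<n}" "card M = m0" for M
        using sdeg that unfolding signed_degree_bound_def D_def s_def by (blast intro: less_imp_le)
    qed (use b4 in \<open>auto intro: sum_nonneg\<close>)
    then have "(20 * c + 20031) * D * S \<le> \<kappa> * S + (12 * c + 4) * S"
      using main excess asm unfolding bS by linarith
    then have "(20 * c + 20031) * D * S \<le> (\<kappa> + (12 * c + 4)) * S" by (simp add: distrib_right)
    then have "(20 * c + 20031) * D \<le> \<kappa> + (12 * c + 4)" using asm by (simp add: mult_le_cancel_right)
    moreover have "12 * c + 4 < (12 * c + 5) * D"
    proof -
      have "12 * c + 4 < (12 * c + 5) * 1" by simp
      also have "\<dots> \<le> (12 * c + 5) * D" using D1 c by (intro mult_left_mono) auto
      finally show ?thesis .
    qed
    ultimately show False by (simp add: \<kappa>_def algebra_simps)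
  qed
  moreover have "0 \<le> S"
    unfolding bS[symmetric] by (auto intro!: sum_nonneg)
  moreover have "S = 0 \<longleftrightarrow> mat_norm1 (Y - outer_square \<sigma>) = 0" using n by (simp add: S_def)
  ultimately show ?thesis using Y1 unfolding S_def[symmetric] by force
qed

section \<open>The error rate\<close>

text \<open>Edges are added only where the label product is 1 and deleted only where it is -1, so
  signed entries can only grow. The lower triangle follows by symmetry.\<close>

lemma adversary_output_le:
  assumes adv: "adversary_output n \<sigma> A L B" and A: "\<And>i j. i < n \<Longrightarrow> j < n \<Longrightarrow> A $$ (i, j) = a i j"
    and a: "\<And>i j. a i j \<in> {0, 1 :: real}" "\<And>i j. a i j = a j i"
    and \<sigma>: "\<And>i. i < n \<Longrightarrow> \<sigma> $ i \<in> {- 1, 1}"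
    and ij: "i < n" "j < n" "i \<noteq> j"
  shows "a i j * (\<sigma> $ i * \<sigma> $ j) \<le> B $$ (i, j) * (\<sigma> $ i * \<sigma> $ j)"
proof -
  have Bsym: "symmetric_mat n B" and B01: "\<And>i j. i < n \<Longrightarrow> j < n \<Longrightarrow> B $$ (i, j) \<in> {0, 1}"
    using adv by (auto simp: adversary_output_def symmetric_binary_mats_def)
  have *: "a i j * (\<sigma> $ i * \<sigma> $ j) \<le> B $$ (i, j) * (\<sigma> $ i * \<sigma> $ j)" if "i < j" "j < n" for i j
  proof -
    have ijn: "i < n" using that by simp
    have "((i, j) \<in> L \<longrightarrow> \<sigma> $ i * \<sigma> $ j = 1 \<longrightarrow> B $$ (i, j) = 1)"
      "((i, j) \<in> L \<longrightarrow> \<sigma> $ i * \<sigma> $ j = - 1 \<longrightarrow> B $$ (i, j) = 0)"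
      "(i, j) \<notin> L \<longrightarrow> B $$ (i, j) = a i j"
      using adv that A[OF ijn that(2)] unfolding adversary_output_def by auto
    then show ?thesis
      using \<sigma>[OF ijn] \<sigma>[OF that(2)] a(1)[of i j] by (cases "(i, j) \<in> L") auto
  qed
  show ?thesis
  proof (cases "i < j")
    case True
    then show ?thesis using * ij by blast
  next
    case False
    then have "j < i" using ij by simp
    from *[OF this ij(1)] show ?thesis
      using symmetric_mat_nth[OF Bsym ij(1,2)] a(2)[of i j] by (simp add: mult.commute)
  qed
qed

lemma sbm_pmf_eq:
  "sbm_pmf n \<sigma> p q = map_pmf (\<lambda>a. mat n n (\<lambda>(i, j). sym_entry a i j))
     (edge_pmf n (\<lambda>i j. if \<sigma> $ i * \<sigma> $ j = 1 then p else q))"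
  unfolding sbm_pmf_def edge_pmf_def upper_pairs_def sym_entry_def ..

lemma sym_entry_mat_binary: "mat n n (\<lambda>(i, j). sym_entry a i j) \<in> symmetric_binary_mats n"
  by (auto simp: symmetric_binary_mats_def symmetric_mat_def sym_entry_commute intro!: eq_matI)
     (auto simp: sym_entry_def)

text \<open>With \<open>x = n I\<close>, the random events fail with probability \<open>exp (- sqrt (ln n))\<close> each: the exponent
  of a union bound over \<open>m\<close>-sets is at most \<open>- C m sqrt x\<close> or \<open>- C m n p\<close>, and either \<open>x \<ge> ln n\<close> or
  the relevant sets have at least about \<open>sqrt n\<close> elements.\<close>

lemma sbm_good_event:
  fixes c0 c1 p q :: real
  assumes c: "0 < c0" "0 < c1"
    and pq: "0 < p" "c0 * p \<le> q" "q < p" "p \<le> 1 - c1"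
    and \<sigma>: "balanced_labels n \<sigma>"
    and x_def: "x = n * sbm_snr p q"
    and d_def: "d = 25 + 3 / c1"
    and C4_def: "C4 = 2 * (20 * d + 20031) / (c0 * c1) + 4 / (c0\<^sup>2 * c1 ^ 4)"
    and Ce_def: "Ce = 2 * C4 + 24"
    and E_def: "E = exp (Ce * sqrt x / 2 - x / 2)"
    and x_ge: "12 + 6 / c1 + 4 / c1\<^sup>2 + 4 * Ce\<^sup>2 \<le> x"
    and K_def: "K = nat \<lfloor>n * E\<rfloor>"
    and m0_def: "m0 = max 1 (K div 4)"
  shows "1 \<le> n * p" "E \<le> 1 / 8" "m0 \<le> n"
    "\<exists>m1. m1 \<le> n \<and> (m1 = 1 \<or> m1 * (n * p) \<le> m0) \<and>
     1 - 10 * exp (- sqrt (ln n)) \<le>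
     edge_prob n (\<lambda>i j. if \<sigma> $ i * \<sigma> $ j = 1 then p else q)
      {a. sbm_regular n \<sigma> p q d m0 m1 (sym_entry a)}"
proof -
  define P where "P i j = (if \<sigma> $ i * \<sigma> $ j = 1 then p else q)" for i j
  define I where "I = sbm_snr p q"
  have q: "0 < q" using c pq mult_pos_pos[of c0 p] by linarith
  have c1: "c1 < 1" using pq q by linarith
  have p1: "p < 1" using c pq by linarith
  have d0: "28 \<le> d" using c c1 by (simp add: d_def field_simps)
  have C40: "0 \<le> C4" using c d0 by (auto simp: C4_def intro!: add_nonneg_nonneg divide_nonneg_pos)
  have xs: "12 \<le> x" "6 / c1 \<le> x" "4 / c1\<^sup>2 \<le> x" "4 * Ce\<^sup>2 \<le> x"
  proof -
    have "0 \<le> 6 / c1" "0 \<le> 4 / c1\<^sup>2" "0 \<le> 4 * Ce\<^sup>2" using c by auto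
    then show "12 \<le> x" "6 / c1 \<le> x" "4 / c1\<^sup>2 \<le> x" "4 * Ce\<^sup>2 \<le> x" using x_ge by linarith+
  qed
  have Ile: "(p - q)\<^sup>2 / (4 * p) \<le> I" "I \<le> 2 * p / c1"
    unfolding I_def by (rule sbm_snr_bounds[OF q pq(3,4) c(2)])+
  have n0: "0 < n" using xs(1) by (auto simp: x_def intro: gr0I)
  have xnp: "x \<le> 2 * (n * p) / c1"
    using mult_left_mono[OF Ile(2), of n] by (simp add: x_def I_def mult_ac)
  have np_x: "c1 * x / 2 \<le> n * p" using xnp c by (simp add: field_simps)
  have np3: "3 \<le> n * p"
  proof -
    have "6 \<le> c1 * x" using xs(2) c by (simp add: field_simps)
    then show ?thesis using np_x by linarith
  qed
  then show np1: "1 \<le> n * p" by linarith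
  have npn: "n * p \<le> n" using p1 n0 by simp
  then have n3: "3 \<le> real n" using np3 by linarith
  have ln1: "1 \<le> ln (real n)"
  proof -
    have "exp 1 \<le> real n" using n3 exp_le by linarith
    then show ?thesis using n0 by (simp add: ln_ge_iff)
  qed
  have lnn: "ln (real n) \<le> real n" using ln_le_minus_one[of "real n"] n0 by simp
  have sl: "sqrt (ln (real n)) \<le> ln (real n)"
    using real_sqrt_le_mono[of "ln (real n)" "(ln (real n))\<^sup>2"] ln1 by (simp add: power2_eq_square)
  have sx1: "1 \<le> sqrt x" using xs by simp
  have sxx: "sqrt x \<le> x" using real_sqrt_le_mono[of x "x\<^sup>2"] xs by (simp add: power2_eq_square)
  \<comment> \<open>The threshold for x makes the loss at most half of the main exponent x /
    2.\<close>
  have Cex: "Ce * sqrt x / 2 \<le> x / 4"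
  proof -
    have "0 \<le> Ce" using C40 by (simp add: Ce_def)
    have "2 * Ce = sqrt (4 * Ce\<^sup>2)" using \<open>0 \<le> Ce\<close> by (simp add: real_sqrt_mult)
    also have "\<dots> \<le> sqrt x" using xs(4) by (rule real_sqrt_le_mono)
    finally have "2 * Ce * sqrt x \<le> sqrt x * sqrt x" using sx1 by (intro mult_right_mono) auto
    then show ?thesis using xs by simp
  qed
  have E4: "E \<le> exp (- x / 4)" unfolding E_def using Cex by simp
  have E0: "0 < E" by (simp add: E_def)
  show E8: "E \<le> 1 / 8"
  proof -
    have "exp (- x / 4) \<le> exp (- 3)" using xs(1) by simp
    then have "E \<le> exp (- 3)" using E4 by linarith
    also have "exp (- 3 :: real) = exp (- 1) ^ 3" using exp_of_nat_mult[of 3 "- 1 :: real"] by simp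
    also have "\<dots> \<le> (1 / 2) ^ 3"
      using exp_ge_add_one_self[of 1] by (intro power_mono) (auto simp: exp_minus field_simps)
    finally show ?thesis by (simp add: power_divide)
  qed
  have nE: "0 \<le> n * E" using E0 by simp
  have K1: "real K \<le> n * E" "n * E < real K + 1"
    unfolding K_def using nE by (simp_all add: of_nat_nat)
  have Kn: "K \<le> n"
  proof -
    have "n * E \<le> real n * 1" using E8 by (intro mult_left_mono) auto
    then have "real K \<le> real n" using K1 by linarith
    then show ?thesis by simp
  qed
  have m0pos: "0 < m0" by (simp add: m0_def)
  show m0n: "m0 \<le> n" using Kn n0 by (simp add: m0_def)
  \<comment> \<open>K + 1 \<le> 4 (K div 4) + 4 and both K div 4 and 1 are at most m0. Thus n E
    \<le> 8 m0 even if K < 4.\<close>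
  have "K + 1 \<le> 8 * m0" unfolding m0_def by linarith
  then have "real (K + 1) \<le> real (8 * m0)" unfolding of_nat_le_iff .
  then have "real K + 1 \<le> 8 * real m0" by simp
  then have m0E: "n * E \<le> 8 * real m0" using K1 by linarith
  \<comment> \<open>Controls I m0, the correction for pairs counted twice. For m0 = 1 it suffices
    that n \<ge> 2 / c1; otherwise m0 / n \<le> E / 4 is exponentially small in x.\<close>
  have m0x: "m0 * x / n \<le> sqrt x"
  proof (cases "m0 = 1")
    case True
    have "2 / c1 \<le> n"
    proof -
      have "4 / c1\<^sup>2 \<le> 2 * (n * p) / c1" using xs(3) xnp by linarith
      also have "\<dots> \<le> 2 * n / c1" using npn c by (intro divide_right_mono) auto
      finally show ?thesis using c by (simp add: field_simps power2_eq_square)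
    qed
    have "x \<le> 2 * n / c1"
      using xnp npn c by (elim order_trans) (intro divide_right_mono, auto)
    also have "\<dots> = 2 / c1 * n" by simp
    also have "\<dots> \<le> real n * real n" using \<open>2 / c1 \<le> n\<close> by (intro mult_right_mono) auto
    finally have "sqrt x \<le> sqrt (real n * real n)" by (intro real_sqrt_le_mono) simp
    then have "sqrt x \<le> n" by simp
    then have "sqrt x * sqrt x \<le> n * sqrt x" using sx1 by (intro mult_right_mono) auto
    then have "x \<le> n * sqrt x" using xs by simp
    then show ?thesis using True n0 by (simp add: field_simps)
  next
    case False
    then have "m0 = K div 4" by (simp add: m0_def max_def split: if_splits)
    then have "4 * m0 \<le> K" by linarith
    then have "real (4 * m0) \<le> real K" unfolding of_nat_le_iff .
    then have "4 * real m0 \<le> real K" by simp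
    then have "real m0 / n \<le> E / 4" using K1 n0 by (simp add: field_simps)
    then have "real m0 / n * x \<le> E / 4 * x" using xs by (intro mult_right_mono) auto
    also have "\<dots> \<le> exp (- x / 4) / 4 * x" using E4 xs by (intro mult_right_mono divide_right_mono) auto
    also have "\<dots> = exp (- (x / 4)) * (x / 4)" by simp
    also have "\<dots> \<le> exp (- (x / 4)) * exp (x / 4)"
    proof (rule mult_left_mono)
      show "x / 4 \<le> exp (x / 4)" using exp_ge_add_one_self[of "x / 4"] by linarith
    qed simp
    also have "\<dots> = 1" by (simp add: exp_add[symmetric])
    finally have "m0 * x / n \<le> 1" by simp
    then show ?thesis using sx1 by linarith
  qed
  \<comment> \<open>If n I < ln n, then n E is at least n exp (- x / 2) > sqrt n.\<close>
  have small_x: "sqrt (real n) \<le> 8 * real m0" if "x < ln (real n)"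
  proof -
    have "n * exp (- x / 2) \<le> n * E"
      unfolding E_def using C40 sx1 by (intro mult_left_mono) (auto simp: Ce_def)
    moreover have "n * exp (- (ln (real n)) / 2) \<le> n * exp (- x / 2)" using that by (intro mult_left_mono) auto
    moreover have "exp (- (ln (real n)) / 2) = 1 / sqrt (real n)"
    proof -
      have "ln (sqrt (real n)) = ln (real n) / 2" by (rule ln_sqrt) (use n0 in simp)
      then have "- (ln (real n)) / 2 = - ln (sqrt (real n))" by linarith
      then have "exp (- (ln (real n)) / 2) = exp (- ln (sqrt (real n)))" by (rule arg_cong)
      also have "\<dots> = 1 / sqrt (real n)" using n0 by (simp only: exp_minus divide_inverse) simp
      finally show ?thesis .
    qed
    ultimately have "n * (1 / sqrt (real n)) \<le> 8 * real m0" using m0E by (simp only:)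
    then show ?thesis using n0 by (simp add: real_div_sqrt)
  qed
  have lnnE: "ln (real n / real m0) \<le> ln 8 + x / 2 - Ce * sqrt x / 2"
  proof -
    have "real n / real m0 \<le> 8 / E" using m0E E0 m0pos by (simp add: field_simps)
    then have "ln (real n / real m0) \<le> ln (8 / E)" using n0 m0pos E0 by simp
    also have "\<dots> = ln 8 + x / 2 - Ce * sqrt x / 2" using E0 by (simp add: ln_div) (simp add: E_def)
    finally show ?thesis .
  qed
  have ln8: "ln (8 :: real) \<le> 3" and ln16: "ln (16 :: real) \<le> 4"
  proof -
    have l2: "ln (2 :: real) \<le> 1" using ln_le_minus_one[of "2 :: real"] by simp
    have "ln (8 :: real) = 3 * ln 2" using ln_realpow[of 2 3] by simp
    then show "ln (8 :: real) \<le> 3" using l2 by simp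
    have "ln (16 :: real) = 4 * ln 2" using ln_realpow[of 2 4] by simp
    then show "ln (16 :: real) \<le> 4" using l2 by simp
  qed

  have bound_sdeg: "edge_prob n P
      {a. \<not> signed_degree_bound n (\<lambda>i. \<sigma> $ i) ((20 * d + 20031) * sqrt (n * p)) m0 (sym_entry a)} \<le> exp (- sqrt (ln n))"
  proof -
    have sgn: "\<sigma> $ i \<in> {- 1, 1}" if "i < n" for i using \<sigma> that by (auto simp: balanced_labels_def sign_vector_def)
    have bal: "(\<Sum>i<n. \<sigma> $ i) = 0" using \<sigma> by (simp add: balanced_labels_def)
    let ?C2 = "20 * d + 20031"
    let ?K3 = "4 / (c0\<^sup>2 * c1 ^ 4)"
    have "edge_prob n P
      {a. \<not> signed_degree_bound n (\<lambda>i. \<sigma> $ i) (?C2 * sqrt (n * p)) m0 (sym_entry a)}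
      \<le> exp (entropy n m0 + m0 * (chernoff_tilt p q * (?C2 * sqrt (n * p)) - n / 2 * I + ?K3 * I * m0))"
      unfolding P_def I_def by (rule prob_not_signed_degree_bound[OF c pq m0pos m0n sgn bal])
    also have "entropy n m0 + m0 * (chernoff_tilt p q * (?C2 * sqrt (n * p)) - n / 2 * I + ?K3 * I * m0)
      = m0 * (1 + ln (real n / real m0) + chernoff_tilt p q * (?C2 * sqrt (n * p)) - x / 2 + ?K3 * I * m0)"
      by (simp add: entropy_def x_def I_def algebra_simps)
    \<comment> \<open>Ce / 2 = C4 + 12: C4 pays for the tilted threshold and for the double
      counting, and 12 sqrt x - (1 + ln 8) \<ge> 8 sqrt x.\<close>
    also have "\<dots> \<le> m0 * (- 8 * sqrt x)"
    proof (intro mult_left_mono)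
      have tilt: "chernoff_tilt p q * (?C2 * sqrt (n * p)) \<le> 2 * ?C2 / (c0 * c1) * sqrt x"
      proof -
        have "((p - q) / p * sqrt (n * p))\<^sup>2 = 4 * (n * ((p - q)\<^sup>2 / (4 * p)))"
          using pq n0 by (simp add: power_mult_distrib power_divide field_simps power2_eq_square)
        also have "\<dots> \<le> 4 * x"
          unfolding x_def using Ile(1) by (intro mult_left_mono) (auto simp: I_def)
        also have "\<dots> = (2 * sqrt x)\<^sup>2" using xs by (simp add: power_mult_distrib)
        finally have "(p - q) / p * sqrt (n * p) \<le> 2 * sqrt x"
          by (rule power2_le_imp_le) (use xs in simp)
        then have "?C2 / (c0 * c1) * ((p - q) / p * sqrt (n * p)) \<le> ?C2 / (c0 * c1) * (2 * sqrt x)"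
          using c d0 by (intro mult_left_mono divide_nonneg_pos) auto
        moreover have "chernoff_tilt p q * (?C2 * sqrt (n * p)) \<le> (p - q) / (c0 * c1 * p) * (?C2 * sqrt (n * p))"
          using chernoff_tilt_bounds(2)[OF c pq] d0 pq by (intro mult_right_mono) auto
        ultimately show ?thesis by (simp add: mult_ac)
      qed
      have "?K3 * I * m0 = ?K3 * (m0 * x / n)" using n0 by (simp add: x_def I_def)
      also have "\<dots> \<le> ?K3 * sqrt x" using m0x c by (intro mult_left_mono) auto
      finally have K3: "?K3 * I * m0 \<le> ?K3 * sqrt x" .
      have C4x: "C4 * sqrt x = 2 * ?C2 / (c0 * c1) * sqrt x + ?K3 * sqrt x" unfolding C4_def by (rule distrib_right)
      have Cex2: "Ce * sqrt x / 2 = C4 * sqrt x + 12 * sqrt x" by (simp add: Ce_def algebra_simps)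
      show "1 + ln (real n / real m0) + chernoff_tilt p q * (?C2 * sqrt (n * p)) - x / 2 + ?K3 * I * m0 \<le> - 8 * sqrt x"
        using lnnE tilt K3 C4x Cex2 ln8 sx1 by linarith
    qed simp
    also have "\<dots> \<le> - sqrt (ln n)"
    proof (cases "x < ln (real n)")
      case True
      have "sqrt (ln (real n)) \<le> sqrt (real n)" using lnn by simp
      also have "\<dots> \<le> 8 * real m0" by (rule small_x[OF True])
      also have "\<dots> \<le> 8 * real m0 * sqrt x" using sx1 mult_left_mono[OF sx1, of "8 * real m0"] by simp
      finally show ?thesis by simp
    next
      case False
      then have "sqrt (ln (real n)) \<le> sqrt x" by simp
      also have "\<dots> \<le> 8 * real m0 * sqrt x"
        using mult_right_mono[of 1 "8 * real m0" "sqrt x"] m0pos sx1 by simp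
      finally show ?thesis by simp
    qed
    finally show ?thesis by simp
  qed

  \<comment> \<open>If positive, the largest m1 with m1 n p \<le> m0: the removed edges then number
    O(m0), the scale of the error.\<close>
  define m1 where "m1 = max 1 (nat \<lfloor>m0 / (n * p)\<rfloor>)"
  have m1pos: "0 < m1" by (simp add: m1_def)
  have m1cond: "m1 = 1 \<or> m1 * (n * p) \<le> m0"
  proof (cases "m1 = 1")
    case False
    then have "m1 = nat \<lfloor>m0 / (n * p)\<rfloor>" by (simp add: m1_def max_def split: if_splits)
    moreover have "0 \<le> m0 / (n * p)" using np1 by simp
    ultimately have "real m1 \<le> m0 / (n * p)" by (simp add: of_nat_nat)
    then show ?thesis using np1 by (simp add: field_simps)
  qed simp
  have m1m0: "m1 \<le> m0"
  proof (cases "m1 = 1")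
    case False
    then have "m1 * (n * p) \<le> m0" using m1cond by simp
    moreover have "real m1 * 1 \<le> m1 * (n * p)" using np1 by (intro mult_left_mono) auto
    ultimately have "real m1 \<le> real m0" by linarith
    then show ?thesis by simp
  qed (use m0pos in simp)
  then have m1n: "m1 \<le> n" using m0n by simp
  have m0m1: "real m0 \<le> 2 * (m1 * (n * p))"
  proof -
    have 0: "0 \<le> m0 / (n * p)" using np1 by simp
    have "m0 / (n * p) < real (nat \<lfloor>m0 / (n * p)\<rfloor>) + 1" using 0 by (simp add: of_nat_nat)
    also have "\<dots> \<le> real m1 + real m1" using m1pos by (intro add_mono) (auto simp: m1_def)
    finally have "m0 / (n * p) \<le> 2 * m1" by simp
    then show ?thesis using np1 by (simp add: field_simps)
  qed
  \<comment> \<open>The summands serve the two ranges of x: sqrt n \<le> 8 m0 \<le> 16 m1 n p in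
    one, x \<le> (2 / c1) n p in the other.\<close>
  define \<eta> where "\<eta> = 16 + 2 / c1"
  have eta: "16 \<le> \<eta>" "2 / c1 \<le> \<eta>" using c by (auto simp: \<eta>_def)
  have bound_deg: "edge_prob n P {a. \<not> degree_bound n (d * (n * p)) m1 (sym_entry a)} \<le> exp (- sqrt (ln n))"
  proof -
    have "edge_prob n P {a. \<not> degree_bound n (d * (n * p)) m1 (sym_entry a)}
       \<le> exp (entropy n m1 - (d - 4) * (n * p) * m1)"
      using pq q p1 by (intro prob_not_degree_bound m1pos m1n) (auto simp: P_def)
    also have "entropy n m1 - (d - 4) * (n * p) * m1 = m1 * (1 + ln (real n / real m1) - (d - 4) * (n * p))"
      by (simp add: entropy_def algebra_simps)
    \<comment> \<open>d - 4 = 21 + 3 / c1 absorbs ln (n p) \<le> n p, x / 2 \<le> n p / c1 and 1 +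
      ln 16 \<le> 5, and leaves \<eta>.\<close>
    also have "\<dots> \<le> m1 * (- (\<eta> * (n * p)))"
    proof (intro mult_left_mono)
      have "real n / real m1 \<le> (n * p) * (16 * exp (x / 2))"
      proof -
        have "n * exp (- x / 2) \<le> n * E"
          unfolding E_def using C40 sx1 by (intro mult_left_mono) (auto simp: Ce_def)
        also have "\<dots> \<le> 16 * (m1 * (n * p))" using m0E m0m1 by linarith
        finally have "n * exp (- x / 2) * exp (x / 2) \<le> 16 * (m1 * (n * p)) * exp (x / 2)"
          by (intro mult_right_mono) auto
        moreover have "exp (- x / 2) * exp (x / 2) = 1" by (simp add: exp_add[symmetric])
        ultimately have "real n \<le> 16 * (m1 * (n * p)) * exp (x / 2)" by (simp add: mult.assoc)
        then show ?thesis using m1pos by (simp add: field_simps)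
      qed
      then have "ln (real n / real m1) \<le> ln ((n * p) * (16 * exp (x / 2)))" using n0 m1pos np1 by simp
      also have "\<dots> = ln (n * p) + (ln 16 + x / 2)"
        using n0 pq by (simp add: ln_mult)
      finally have l: "ln (real n / real m1) \<le> ln (n * p) + (ln 16 + x / 2)" .
      define w where "w = 1 / c1 * (n * p)"
      define r where "r = n * p"
      have "ln r \<le> r" using ln_le_minus_one[of r] np1 by (simp add: r_def)
      moreover have "2 * (n * p) / c1 = 2 * w" by (simp add: w_def)
      then have "x / 2 \<le> w" using xnp by linarith
      moreover have "(d - 4) * r = 21 * r + 3 * w"
        by (simp add: d_def w_def r_def algebra_simps)
      moreover have "\<eta> * r = 16 * r + 2 * w"
        by (simp add: \<eta>_def w_def r_def algebra_simps)
      ultimately show "1 + ln (real n / real m1) - (d - 4) * (n * p) \<le> - (\<eta> * (n * p))"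
        using l ln16 np3 unfolding r_def[symmetric] by linarith
    qed simp
    also have "\<dots> \<le> - sqrt (ln n)"
    proof (cases "x < ln (real n)")
      case True
      have "sqrt (ln (real n)) \<le> sqrt (real n)" using lnn by simp
      also have "\<dots> \<le> 16 * (m1 * (n * p))" using small_x[OF True] m0m1 by linarith
      also have "\<dots> \<le> \<eta> * (m1 * (n * p))" using eta pq by (intro mult_right_mono) auto
      finally show ?thesis by (simp add: mult_ac)
    next
      case False
      then have "sqrt (ln (real n)) \<le> x" using sl by linarith
      also have "\<dots> \<le> 2 / c1 * (n * p)" using xnp by simp
      also have "\<dots> \<le> \<eta> * (m1 * (n * p))"
      proof (rule mult_mono)
        have "1 * (n * p) \<le> m1 * (n * p)" using m1pos pq by (intro mult_right_mono) auto
        then show "n * p \<le> real m1 * (n * p)" by simp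
      qed (use eta pq in auto)
      finally show ?thesis by (simp add: mult_ac)
    qed
    finally show ?thesis by simp
  qed

  have P01: "P i j \<in> {0..p}" for i j using pq q by (auto simp: P_def)
  have Psym: "P i j = P j i" for i j by (simp add: P_def mult.commute)
  have bound_light: "edge_prob n P {a. \<not> light_bound n P p (sym_entry a)} \<le> exp (- sqrt (ln n))"
  proof -
    have "edge_prob n P {a. \<not> light_bound n P p (sym_entry a)} \<le> exp (- real n)"
      using p1 n0 pq by (intro prob_not_light_bound P01 Psym) auto
    also have "\<dots> \<le> exp (- sqrt (ln n))" using sl lnn by simp
    finally show ?thesis .
  qed
  have bound_disc: "edge_prob n P {a. \<not> discrepancy_bound n p (sym_entry a)} \<le> exp (- sqrt (ln n))"
  proof -
    have "edge_prob n P {a. \<not> discrepancy_bound n p (sym_entry a)} \<le> 1 / real n"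
      using p1 n3 pq by (intro prob_not_discrepancy_bound P01) auto
    also have "\<dots> = exp (- ln n)" using n0 by (simp add: exp_minus divide_inverse)
    also have "\<dots> \<le> exp (- sqrt (ln n))" using sl by simp
    finally show ?thesis .
  qed
  have P_eq: "(\<lambda>i j. if \<sigma> $ i * \<sigma> $ j = 1 then p else q) = P" by (intro ext) (simp add: P_def)
  let ?G = "{a. sbm_regular n \<sigma> p q d m0 m1 (sym_entry a)}"
  define X where "X = (\<lambda>i::nat. if i = 0 then {a. \<not> light_bound n P p (sym_entry a)}
     else if i = 1 then {a. \<not> discrepancy_bound n p (sym_entry a)}
     else if i = 2 then {a. \<not> degree_bound n (d * (n * p)) m1 (sym_entry a)}
     else {a. \<not> signed_degree_bound n (\<lambda>i. \<sigma> $ i) ((20 * d + 20031) * sqrt (n * p)) m0 (sym_entry a)})"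
  have "- ?G \<subseteq> (\<Union>i\<in>{..<4}. X i)"
  proof
    fix a assume "a \<in> - ?G"
    then have "a \<in> X 0 \<or> a \<in> X 1 \<or> a \<in> X 2 \<or> a \<in> X 3"
      unfolding sbm_regular_def P_eq by (auto simp: X_def)
    then show "a \<in> (\<Union>i\<in>{..<4}. X i)" by (elim disjE) (auto intro: UN_I[of 0] UN_I[of 1] UN_I[of 2] UN_I[of 3])
  qed
  then have "edge_prob n P (- ?G) \<le> edge_prob n P (\<Union>i\<in>{..<4}. X i)"
    by (intro measure_pmf.finite_measure_mono) auto
  also have "\<dots> \<le> (\<Sum>i\<in>{..<4::nat}. exp (- sqrt (ln n)))"
    using bound_sdeg bound_deg bound_light bound_disc by (intro prob_UN_le) (auto simp: X_def)
  also have "\<dots> \<le> 10 * exp (- sqrt (ln n))" by simp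
  finally have "1 - 10 * exp (- sqrt (ln n)) \<le> edge_prob n P ?G"
    using measure_pmf.prob_compl[of ?G "edge_pmf n P"] by (simp add: Compl_eq_Diff_UNIV)
  then show "\<exists>m1. m1 \<le> n \<and> (m1 = 1 \<or> m1 * (n * p) \<le> m0) \<and> 1 - 10 * exp (- sqrt (ln n)) \<le>
     edge_prob n (\<lambda>i j. if \<sigma> $ i * \<sigma> $ j = 1 then p else q) {a. sbm_regular n \<sigma> p q d m0 m1 (sym_entry a)}"
    using m1n m1cond unfolding P_eq by blast
qed

text \<open>The rates are parameters, so that both parts of the theorem share one event.\<close>

definition recovers :: "nat \<Rightarrow> real vec \<Rightarrow> real \<Rightarrow> real \<Rightarrow> real mat \<Rightarrow> bool" where
  "recovers n \<sigma> r e B \<longleftrightarrow> (\<forall>Y \<in> sdp_set n \<sigma> B.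
     1 / real n * mat_norm1 (Y - outer_square \<sigma>) \<le> real_of_int \<lfloor>real n * r\<rfloor> \<and>
     (\<forall>v. top_eigenvector Y v \<longrightarrow> label_err n (entrywise_sign v) \<sigma> \<le> e))"

text \<open>On the good event the normalized error is zero or less than 4 m0 \<le> K, the floor of n
  E, so the integer part in the rate costs nothing.\<close>

lemma sbm_error_bound:
  fixes c0 c1 :: real
  assumes c: "0 < c0" "0 < c1"
  obtains C_I C_e C_e' :: real where "0 < C_I" "0 < C_e" "0 < C_e'"
    "\<And>n \<sigma> p q adv. balanced_labels n \<sigma> \<Longrightarrow>
      0 < c0 * p \<and> c0 * p \<le> q \<and> q < p \<and> p \<le> 1 - c1 \<Longrightarrow>
      C_I \<le> real n * sbm_snr p q \<Longrightarrow> monotone_adversary n \<sigma> adv \<Longrightarrow>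
      1 - 10 * exp (- sqrt (ln (real n))) \<le> measure_pmf.prob (semirandom_sbm_pmf n \<sigma> p q adv)
        {B. recovers n \<sigma> (exp (- ((1 - C_e * sqrt (1 / (real n * sbm_snr p q))) * (real n / 2) * sbm_snr p q)))
           (exp (- ((1 - C_e' * sqrt (1 / (real n * sbm_snr p q))) * (real n / 2) * sbm_snr p q))) B}"
proof -
  define d where "d = 25 + 3 / c1"
  define C4 where "C4 = 2 * (20 * d + 20031) / (c0 * c1) + 4 / (c0\<^sup>2 * c1 ^ 4)"
  define Ce where "Ce = 2 * C4 + 24"
  \<comment> \<open>The eigenvector step loses a factor 8 \<le> exp 3, and 3 \<le> 6 sqrt x /
    2.\<close>
  define Ce' where "Ce' = Ce + 6"
  \<comment> \<open>6 / c1 yields n p \<ge> 3, 4 / c1^2 yields n \<ge> 2 / c1, and the last term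
    yields E \<le> exp (- x / 4), which is at most 1/8 thanks to 12.\<close>
  define CI where "CI = 12 + 6 / c1 + 4 / c1\<^sup>2 + 4 * Ce\<^sup>2"
  have d0: "0 < d" using c by (simp add: d_def add_pos_pos)
  have C40: "0 < C4" using c d0 by (auto simp: C4_def intro!: add_pos_pos divide_pos_pos)
  have Ce0: "0 < Ce" "0 < Ce'" using C40 by (auto simp: Ce_def Ce'_def)
  have CI12: "12 \<le> CI" using c by (simp add: CI_def)
  show ?thesis
  proof (rule that[of CI Ce Ce'])
    show "0 < CI" using CI12 by linarith
    fix n :: nat and \<sigma> :: "real vec" and p q :: real and adv :: "real mat \<Rightarrow> real mat"
    assume \<sigma>: "balanced_labels n \<sigma>" and pq: "0 < c0 * p \<and> c0 * p \<le> q \<and> q < p \<and> p \<le> 1 - c1"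
      and xge: "CI \<le> real n * sbm_snr p q" and adv: "monotone_adversary n \<sigma> adv"
    define x where "x = real n * sbm_snr p q"
    define E where "E = exp (Ce * sqrt x / 2 - x / 2)"
    define K where "K = nat \<lfloor>n * E\<rfloor>"
    define m0 where "m0 = max 1 (K div 4)"
    have x12: "12 \<le> x" using xge CI12 by (simp add: x_def)
    have n0: "0 < n" using x12 by (auto simp: x_def intro: gr0I)
    have p: "0 < p" "c0 * p \<le> q" "q < p" "p \<le> 1 - c1" using pq c by (auto simp: zero_less_mult_iff)
    have q0: "0 < q" using pq by linarith
    have expo: "exp (- ((1 - C * sqrt (1 / (real n * sbm_snr p q))) * (real n / 2) * sbm_snr p q)) = exp (C * sqrt x / 2 - x / 2)" for C
    proof -
      have "sqrt (1 / x) * x = sqrt x" using x12 by (simp add: real_sqrt_divide real_div_sqrt)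
      moreover have "- ((1 - C * t) * (x / 2)) = C * (t * x) / 2 - x / 2" for t
        by (simp add: field_simps)
      ultimately have "- ((1 - C * sqrt (1 / x)) * (x / 2)) = C * sqrt x / 2 - x / 2" by (simp only:)
      then show ?thesis by (simp add: x_def mult.assoc)
    qed
    note good = sbm_good_event[OF c p \<sigma> x_def d_def C4_def Ce_def E_def xge[folded x_def, unfolded CI_def] K_def m0_def]
    let ?P = "\<lambda>i j. if \<sigma> $ i * \<sigma> $ j = 1 then p else q"
    obtain m1 where m1: "m1 \<le> n" "m1 = 1 \<or> m1 * (n * p) \<le> m0"
      and prob: "1 - 10 * exp (- sqrt (ln n)) \<le> edge_prob n ?P
      {a. sbm_regular n \<sigma> p q d m0 m1 (sym_entry a)}"
      using good(4) by blast
    define G where "G = {B. recovers n \<sigma> E (exp (Ce' * sqrt x / 2 - x / 2)) B}"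
    let ?f = "\<lambda>a. adv (mat n n (\<lambda>(i, j). sym_entry a i j))"
    have sgn: "\<sigma> $ i \<in> {- 1, 1}" if "i < n" for i using \<sigma> that by (auto simp: balanced_labels_def sign_vector_def)
    have "?f a \<in> G"
      if a: "sbm_regular n \<sigma> p q d m0 m1 (sym_entry a)" for a
    proof -
      define A where "A = mat n n (\<lambda>(i, j). sym_entry a i j)"
      obtain L where L: "adversary_output n \<sigma> A L (adv A)"
        using adv sym_entry_mat_binary[of n a] unfolding monotone_adversary_def A_def by blast
      have Bc: "adv A \<in> carrier_mat n n"
        using L by (simp add: adversary_output_def symmetric_binary_mats_def symmetric_mat_def)
      have mono: "sym_entry a i j * (\<sigma> $ i * \<sigma> $ j) \<le> adv A $$ (i, j) * (\<sigma> $ i * \<sigma> $ j)"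
        if "i < n" "j < n" "i \<noteq> j" for i j
        using L _ _ _ _ that
      proof (rule adversary_output_le)
        show "sym_entry a i j \<in> {0, 1}" for i j by (simp add: sym_entry_def)
        show "sym_entry a i j = sym_entry a j i" for i j by (rule sym_entry_commute)
      qed (use sgn in \<open>auto simp: A_def\<close>)
      show ?thesis
        unfolding G_def recovers_def A_def[symmetric]
      proof (intro CollectI ballI)
        fix Y assume Y: "Y \<in> sdp_set n \<sigma> (adv A)"
        define S where "S = mat_norm1 (Y - outer_square \<sigma>) / n"
        from sdp_error_le[OF n0 \<sigma> q0 p(3) good(1) _ sym_entry_nonneg sym_entry_commute Bc mono a m1 _ good(3) Y] d0
        have Y1: "\<And>i j. i < n \<Longrightarrow> j < n \<Longrightarrow> \<bar>Y $$ (i, j)\<bar> \<le> 1"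
          and alt: "S = 0 \<or> m0 \<noteq> 1 \<and> S < 4 * real m0"
          by (auto simp: S_def m0_def)
        have symY: "symmetric_mat n Y" using Y by (simp add: sdp_set_def psd_mat_def)
        have nE: "0 \<le> n * E" by (simp add: E_def)
        have SK: "S \<le> K"
        proof (cases "S = 0")
          case False
          then have "m0 \<noteq> 1" "S < 4 * real m0" using alt by auto
          moreover from this(1) have "m0 = K div 4" by (simp add: m0_def max_def split: if_splits)
          then have "4 * m0 \<le> K" by linarith
          then have "real (4 * m0) \<le> real K" unfolding of_nat_le_iff .
          ultimately show ?thesis by simp
        qed simp
        have KE: "real K = real_of_int \<lfloor>real n * E\<rfloor>" unfolding K_def using nE by (simp add: of_nat_nat)
        have "S \<le> n * E" using SK KE of_int_floor_le[of "real n * E"] by linarith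
        then have SE: "S / n \<le> E" using n0 by (simp add: field_simps)
        have nS: "mat_norm1 (Y - outer_square \<sigma>) / (real n)\<^sup>2 = S / n" by (simp add: S_def power2_eq_square)
        have "label_err n (entrywise_sign v) \<sigma> \<le> exp (Ce' * sqrt x / 2 - x / 2)" if v: "top_eigenvector Y v" for v
        proof -
          have "mat_norm1 (Y - outer_square \<sigma>) \<le> (real n)\<^sup>2 / 8"
          proof -
            have "mat_norm1 (Y - outer_square \<sigma>) / (real n)\<^sup>2 \<le> 1 / 8" unfolding nS using SE good(2) by linarith
            then show ?thesis using n0 by (simp add: field_simps)
          qed
          moreover have "sign_vector n \<sigma>" using \<sigma> by (simp add: balanced_labels_def)
          ultimately have "label_err n (entrywise_sign v) \<sigma> \<le> 8 * mat_norm1 (Y - outer_square \<sigma>) / (real n)\<^sup>2"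
            using top_eigenvector_label_err[OF n0 _ symY Y1 _ v] by blast
          also have "\<dots> = 8 * (S / n)" using nS by simp
          also have "\<dots> \<le> exp 3 * E"
          proof (rule mult_mono[OF _ SE])
            have "(2 :: real) ^ 3 \<le> exp 1 ^ 3" using exp_ge_add_one_self[of 1] by (intro power_mono) auto
            also have "exp 1 ^ 3 = exp (3 :: real)" using exp_of_nat_mult[of 3 "1 :: real"] by simp
            finally show "8 \<le> exp (3 :: real)" by simp
          qed (auto simp: S_def mat_norm1_def intro!: divide_nonneg_nonneg sum_nonneg)
          also have "\<dots> \<le> exp (Ce' * sqrt x / 2 - x / 2)"
          proof -
            have "1 \<le> sqrt x" using x12 by simp
            moreover have "Ce' * sqrt x = Ce * sqrt x + 6 * sqrt x" by (simp add: Ce'_def algebra_simps)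
            ultimately show ?thesis by (simp add: E_def exp_add[symmetric])
          qed
          finally show ?thesis .
        qed
        then show "1 / real n * mat_norm1 (Y - outer_square \<sigma>) \<le> real_of_int \<lfloor>real n * E\<rfloor> \<and>
              (\<forall>v. top_eigenvector Y v \<longrightarrow> label_err n (entrywise_sign v) \<sigma> \<le> exp (Ce' * sqrt x / 2 - x / 2))"
          using SK KE by (simp add: S_def)
      qed
    qed
    then have "edge_prob n ?P
      {a. sbm_regular n \<sigma> p q d m0 m1 (sym_entry a)}
      \<le> edge_prob n ?P (?f -` G)"
      by (intro measure_pmf.finite_measure_mono) auto
    also have "\<dots> = measure_pmf.prob (semirandom_sbm_pmf n \<sigma> p q adv) G"
      by (simp add: semirandom_sbm_pmf_def sbm_pmf_eq vimage_comp[symmetric] vimage_def)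
    finally show "1 - 10 * exp (- sqrt (ln (real n))) \<le> measure_pmf.prob (semirandom_sbm_pmf n \<sigma> p q adv)
        {B. recovers n \<sigma> (exp (- ((1 - Ce * sqrt (1 / (real n * sbm_snr p q))) * (real n / 2) * sbm_snr p q)))
           (exp (- ((1 - Ce' * sqrt (1 / (real n * sbm_snr p q))) * (real n / 2) * sbm_snr p q))) B}"
      using prob unfolding expo G_def E_def[symmetric] by linarith
  qed (rule Ce0)+
qed

section \<open>The limit along even n\<close>

lemma tendsto_if_even:
  fixes f :: "nat \<Rightarrow> real"
  assumes "filterlim x at_top (inf sequentially (principal {n. even n}))"
  shows "(\<lambda>n. if even n \<and> C \<le> x n then C' * sqrt (1 / x n) else 0) \<longlonglongrightarrow> (0 :: real)"
proof (rule LIMSEQ_I)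
  fix r :: real assume r: "0 < r"
  define b where "b = (\<bar>C'\<bar> / r)\<^sup>2 + 1"
  have "eventually (\<lambda>n. b \<le> x n) (inf sequentially (principal {n. even n}))"
    using assms unfolding filterlim_at_top by blast
  then obtain N where N: "\<And>n. N \<le> n \<Longrightarrow> even n \<Longrightarrow> b \<le> x n"
    by (auto simp: eventually_inf_principal eventually_sequentially)
  have "\<bar>C' * sqrt (1 / x n)\<bar> < r" if "b \<le> x n" for n
  proof -
    have "0 \<le> (\<bar>C'\<bar> / r)\<^sup>2" by simp
    with that have x: "1 \<le> x n" "(\<bar>C'\<bar> / r)\<^sup>2 < x n" unfolding b_def by linarith+
    then have "\<bar>C'\<bar> / r < sqrt (x n)" using real_less_rsqrt by blast
    then show ?thesis using r x by (simp add: abs_mult real_sqrt_divide field_simps)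
  qed
  then have "norm ((if even n \<and> C \<le> x n then C' * sqrt (1 / x n) else 0) - 0) < r" if "N \<le> n" for n
    using N[OF that] r by auto
  then show "\<exists>no. \<forall>n\<ge>no. norm ((if even n \<and> C \<le> x n then C' * sqrt (1 / x n) else 0) - 0) < r" by blast
qed

lemma eventually_ge_of_even:
  fixes x :: "nat \<Rightarrow> real"
  assumes "filterlim x at_top (inf sequentially (principal {n. even n}))"
  shows "eventually (\<lambda>n. even n \<longrightarrow> C \<le> x n) sequentially"
  using assms unfolding filterlim_at_top by (simp add: eventually_inf_principal)

theorem theorem4:
  fixes c0 c1 :: real
  assumes "0 < c0" "c0 < 1" "0 < c1" "c1 < 1"
  shows
    "(\<exists>C_I > 0. \<exists>C_e > 0. \<exists>C_e' > 0.
        \<forall>(n :: nat) \<sigma> p q adv.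
          balanced_labels n \<sigma> \<longrightarrow>
          0 < c0 * p \<and> c0 * p \<le> q \<and> q < p \<and> p \<le> 1 - c1 \<longrightarrow>
          real n * sbm_snr p q \<ge> C_I \<longrightarrow>
          monotone_adversary n \<sigma> adv \<longrightarrow>
          measure_pmf.prob (semirandom_sbm_pmf n \<sigma> p q adv)
            {B. \<forall>Y \<in> sdp_set n \<sigma> B.
                  1 / real n * mat_norm1 (Y - outer_square \<sigma>)
                    \<le> real_of_int \<lfloor>real n *
                        exp (- ((1 - C_e * sqrt (1 / (real n * sbm_snr p q)))
                                  * (real n / 2) * sbm_snr p q))\<rfloor> \<and>
                  (\<forall>v. top_eigenvector Y v \<longrightarrow>
                    label_err n (entrywise_sign v) \<sigma>
                      \<le> exp (- ((1 - C_e' * sqrt (1 / (real n * sbm_snr p q)))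
                                  * (real n / 2) * sbm_snr p q)))}
            \<ge> 1 - 10 * exp (- sqrt (ln (real n))))
     \<and>
     (\<forall>p q :: nat \<Rightarrow> real.
        (\<forall>n. even n \<and> 0 < n \<longrightarrow>
           0 < c0 * p n \<and> c0 * p n \<le> q n \<and> q n < p n \<and> p n \<le> 1 - c1) \<longrightarrow>
        filterlim (\<lambda>n. real n * sbm_snr (p n) (q n)) at_top
          (inf sequentially (principal {n. even n})) \<longrightarrow>
        (\<exists>\<delta> \<epsilon> \<epsilon>' :: nat \<Rightarrow> real.
           \<delta> \<longlonglongrightarrow> 0 \<and> \<epsilon> \<longlonglongrightarrow> 0 \<and> \<epsilon>' \<longlonglongrightarrow> 0 \<and>
           (\<forall>n \<sigma> adv. even n \<and> 0 < n \<longrightarrow>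
              balanced_labels n \<sigma> \<longrightarrow>
              monotone_adversary n \<sigma> adv \<longrightarrow>
              measure_pmf.prob (semirandom_sbm_pmf n \<sigma> (p n) (q n) adv)
                {B. \<forall>Y \<in> sdp_set n \<sigma> B.
                      1 / real n * mat_norm1 (Y - outer_square \<sigma>)
                        \<le> real_of_int \<lfloor>real n *
                            exp (- ((1 - \<epsilon> n) * (real n / 2) * sbm_snr (p n) (q n)))\<rfloor> \<and>
                      (\<forall>v. top_eigenvector Y v \<longrightarrow>
                        label_err n (entrywise_sign v) \<sigma>
                          \<le> exp (- ((1 - \<epsilon>' n) * (real n / 2) * sbm_snr (p n) (q n))))}
                \<ge> 1 - \<delta> n)))"
proof -
  obtain C_I C_e C_e' :: real where C: "0 < C_I" "0 < C_e" "0 < C_e'"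
    and bound: "\<And>n \<sigma> p q adv. balanced_labels n \<sigma> \<Longrightarrow>
      0 < c0 * p \<and> c0 * p \<le> q \<and> q < p \<and> p \<le> 1 - c1 \<Longrightarrow>
      C_I \<le> real n * sbm_snr p q \<Longrightarrow> monotone_adversary n \<sigma> adv \<Longrightarrow>
      1 - 10 * exp (- sqrt (ln (real n))) \<le> measure_pmf.prob (semirandom_sbm_pmf n \<sigma> p q adv)
        {B. recovers n \<sigma> (exp (- ((1 - C_e * sqrt (1 / (real n * sbm_snr p q))) * (real n / 2) * sbm_snr p q)))
           (exp (- ((1 - C_e' * sqrt (1 / (real n * sbm_snr p q))) * (real n / 2) * sbm_snr p q))) B}"
    by (rule sbm_error_bound[OF assms(1,3)]) (rule that)
  show ?thesis
  proof (rule conjI, goal_cases)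
    case 1
    show ?case using C bound unfolding recovers_def by blast
  next
    case 2
    show ?case (is "\<forall>p q. _ \<longrightarrow> _ \<longrightarrow> ?goal p q")
    proof (intro allI impI)
      fix p q :: "nat \<Rightarrow> real"
      assume pq: "\<forall>n. even n \<and> 0 < n \<longrightarrow> 0 < c0 * p n \<and> c0 * p n \<le> q n \<and> q n < p n \<and> p n \<le> 1 - c1"
        and lim: "filterlim (\<lambda>n. real n * sbm_snr (p n) (q n)) at_top (inf sequentially (principal {n. even n}))"
      define x where "x n = real n * sbm_snr (p n) (q n)" for n
      \<comment> \<open>Balanced labels exist only for even n, and p, q are unconstrained for odd n,
        so the sequences get harmless values there. For the finitely many even n with n I < C_I,
        \<delta> is 1 and the probability bound is trivial.\<close>
      define \<delta> where "\<delta> n = (if even n \<and> x n < C_I then 1 else 10 * exp (- sqrt (ln (real n))))" for n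
      define \<epsilon> where "\<epsilon> C n = (if even n \<and> C_I \<le> x n then C * sqrt (1 / x n) else 0)" for C n
      have "((\<lambda>n. 10 * exp (- sqrt (ln (real n)))) \<longlongrightarrow> 0) sequentially" by real_asymp
      moreover have "eventually (\<lambda>n. 10 * exp (- sqrt (ln (real n))) = \<delta> n) sequentially"
        using eventually_ge_of_even[OF lim, of C_I] by eventually_elim (auto simp: \<delta>_def x_def)
      ultimately have "\<delta> \<longlonglongrightarrow> 0" by (rule Lim_transform_eventually)
      moreover have "\<epsilon> C \<longlonglongrightarrow> 0" for C
        unfolding \<epsilon>_def x_def by (rule tendsto_if_even[OF lim])
      moreover have "1 - \<delta> n \<le> measure_pmf.prob (semirandom_sbm_pmf n \<sigma> (p n) (q n) adv)
                {B. recovers n \<sigma> (exp (- ((1 - \<epsilon> C_e n) * (real n / 2) * sbm_snr (p n) (q n))))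
                   (exp (- ((1 - \<epsilon> C_e' n) * (real n / 2) * sbm_snr (p n) (q n)))) B}"
        if "even n \<and> 0 < n" "balanced_labels n \<sigma>" "monotone_adversary n \<sigma> adv" for n \<sigma> adv
      proof (cases "x n < C_I")
        case True
        then show ?thesis using that by (simp add: \<delta>_def)
      next
        case False
        then have eqs: "\<delta> n = 10 * exp (- sqrt (ln (real n)))" "\<epsilon> C n = C * sqrt (1 / (real n * sbm_snr (p n) (q n)))" for C
          using that(1) by (auto simp: \<delta>_def \<epsilon>_def x_def)
        show ?thesis
          unfolding eqs using False that pq by (intro bound) (auto simp: x_def)
      qed
      ultimately show "?goal p q"
        unfolding recovers_def by (intro exI[of _ \<delta>] exI[of _ "\<epsilon> C_e"] exI[of _ "\<epsilon> C_e'"] conjI allI impI) auto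
    qed
  qed
qed

end
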